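(* Let $0<\varepsilon\le1$ and $\gamma$ be constants, $s$ an integer with $|s|\le(1-\varepsilon)n$, and $F$ a deterministic complex $n\times n$ matrix with rows $\mathbf f_1,\dots,\mathbf f_n$ and entries of modulus at most $n^\gamma$. Let $X_n$ be a random matrix whose rows $\mathbf x_1,\dots,\mathbf x_n$ are independent random vectors sampled uniformly from the set $\mathcal S$ of vectors in $\{-1,1\}^n$ with coordinate sum $s-1$ or $s+1$. Then for any $B>0$, $$\mathbb P\big(\mathbf x_1+\mathbf f_1\text{ belongs to the subspace }H\text{ generated by }\mathbf x_2+\mathbf f_2,\dots,\mathbf x_n+\mathbf f_n\big)=O(n^{-B}),$$ where the implied constant depends on $B$. *)

theory Defs
  imports "HOL-Probability.Probability"
begin

definition sign_set :: "nat \<Rightarrow> int \<Rightarrow> (nat \<Rightarrow> int) set" where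
  "sign_set n s = {x. (\<forall>j<n. x j \<in> {-1, 1}) \<and> (\<forall>j. n \<le> j \<longrightarrow> x j = 0)
                    \<and> (sum x {..<n} = s - 1 \<or> sum x {..<n} = s + 1)}"

definition in_cspan :: "nat \<Rightarrow> (nat \<Rightarrow> complex) \<Rightarrow> nat set \<Rightarrow> (nat \<Rightarrow> nat \<Rightarrow> complex) \<Rightarrow> bool" where
  "in_cspan n v I w \<longleftrightarrow> (\<exists>c :: nat \<Rightarrow> complex. \<forall>j<n. v j = (\<Sum>i\<in>I. c i * w i j))"

end

theory Submission
  imports Defs "HOL-Real_Asymp.Real_Asymp"
begin

text \<open>
  If the first row lies in the span of the others, then a nonzero null vector \<open>v\<close> of rows
  \<open>1..<n\<close> (rows are numbered from 0) is also annihilated by row 0. Since \<open>v\<close> does not depend on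
  row 0, it suffices that, outside an event of probability \<open>O(n\<^sup>-\<^sup>B)\<close>, such a \<open>v\<close> has all atoms
  of \<open>x \<bullet> v\<close>, for \<open>x\<close> uniform in the sign set, of mass at most \<open>\<xi> = n\<^sup>-\<^sup>B\<close>.

  Suppose that \<open>x \<bullet> v\<close> has a largest atom of size about \<open>q > \<xi>\<close>. If \<open>q\<close> is bounded below, then \<open>v\<close>
  is constant up to a small proportion of coordinates, and a union bound over the exceptional set
  suffices. Otherwise, for every set \<open>S\<close> of nearly all coordinates, the density of additive relations
  \<open>v\<^sub>i\<^sub>1 + ... + v\<^sub>i\<^sub>K = v\<^sub>j\<^sub>1 + ... + v\<^sub>j\<^sub>K\<close> inside \<open>S\<close> exceeds \<open>q\<close> by a large constant
  factor \<open>g\<close> (a Halasz-type inequality, obtained without Fourier analysis: a threefold sum of independent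
  variables on an ordered group has smaller atoms, by a constant factor, than its summands). Imposing \<open>d\<close> random
  relations one after another therefore costs at most \<open>(g q)\<^sup>-\<^sup>d\<close> in a union bound, after which
  \<open>v\<close> ranges over a space of dimension \<open>n - d\<close>; revealing the rows one by one, such a space meets the
  kernel in a vector of this kind with probability at most \<open>2\<^sup>n q\<^sup>d\<^sup>-\<^sup>1\<close>. The powers of \<open>q\<close> cancel up to
  one factor and \<open>g\<^sup>-\<^sup>d\<close> beats \<open>2\<^sup>n\<close>.
\<close>

subsection \<open>Atoms of threefold sums\<close>

text \<open>The null vector ranges over a continuum, so no union bound over candidates is directly
  available. Additive relations supply a finite family instead: each structured \<open>v\<close>
  satisfies a sizeable share of them, and each nontrivial one removes a dimension. The next relation
  must live on coordinates not yet eliminated; hence the energy estimate for every \<open>S\<close>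
  with at least \<open>(1 - \<epsilon>/8) * n\<close> elements, and hence only \<open>d\<close> of
  order \<open>\<epsilon> * n\<close> relations. The factor \<open>2 ^ n\<close> stems from the two
  outcomes of each exposed row (it annihilates a given vector, or it cuts the dimension), so
  \<open>g\<close> must be exponential in \<open>1/\<epsilon>\<close>. This is only a matter of
  constants: each tripling of the number of summands shrinks atoms that are already small by
  \<open>19/20\<close>, and sums of \<open>2 * K\<close> terms start with atoms controlled by the
  energy itself. Relations between rearrangements of the same coordinates hold for all
  \<open>v\<close> and eliminate nothing; their density is of order \<open>n ^ (- K)\<close>, so
  \<open>K > B\<close> makes them negligible against \<open>q \<ge> n ^ (- B)\<close>.\<close>

definition lex_le :: "complex \<Rightarrow> complex \<Rightarrow> bool" where
  "lex_le x y \<longleftrightarrow> Re x < Re y \<or> (Re x = Re y \<and> Im x \<le> Im y)"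

lemma lex_le_refl [simp]: "lex_le x x"
  by (simp add: lex_le_def)

lemma lex_le_total: "lex_le x y \<or> lex_le y x"
  by (auto simp: lex_le_def)

lemma lex_le_trans: "lex_le x y \<Longrightarrow> lex_le y z \<Longrightarrow> lex_le x z"
  by (auto simp: lex_le_def)

lemma lex_le_antisym: "lex_le x y \<Longrightarrow> lex_le y x \<Longrightarrow> x = y"
  by (auto simp: lex_le_def complex_eq_iff)

lemma lex_le_add: "lex_le a b \<Longrightarrow> lex_le c d \<Longrightarrow> lex_le (a + c) (b + d)"
  by (auto simp: lex_le_def)

lemma lex_le_minus [simp]: "lex_le (- a) (- b) \<longleftrightarrow> lex_le b a"
  by (auto simp: lex_le_def)

text \<open>The rank \<open>N\<close> turns the order into natural numbers. Among elements of rank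
  at least a quarter of the mass, \<open>z\<close> has least rank, so the largest element strictly
  below \<open>z\<close> has rank under a quarter, and this rank counts everything strictly below
  \<open>z\<close>.\<close>

lemma lex_quantile:
  fixes X :: "'a \<Rightarrow> complex"
  assumes fin: "finite \<Omega>" and ne: "\<Omega> \<noteq> {}"
  obtains x0 where "card \<Omega> \<le> 4 * card {\<omega>\<in>\<Omega>. lex_le (X \<omega>) x0}"
    and "4 * card {\<omega>\<in>\<Omega>. \<not> lex_le x0 (X \<omega>)} \<le> card \<Omega>"
proof -
  define N where "N \<omega> = card {\<omega>'\<in>\<Omega>. lex_le (X \<omega>') (X \<omega>)}" for \<omega>
  have mono: "N a < N b" if "a \<in> \<Omega>" "b \<in> \<Omega>" "\<not> lex_le (X b) (X a)" for a b
  proof -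
    have "lex_le (X a) (X b)" using that lex_le_total by blast
    then have "{\<omega>'\<in>\<Omega>. lex_le (X \<omega>') (X a)} \<subset> {\<omega>'\<in>\<Omega>. lex_le (X \<omega>') (X b)}"
      using that lex_le_trans by (auto intro: lex_le_trans)
    then show ?thesis unfolding N_def using fin by (intro psubset_card_mono) auto
  qed
  have ex_max: "\<exists>w\<in>L. \<forall>u\<in>L. lex_le (X u) (X w)" if L: "L \<subseteq> \<Omega>" "L \<noteq> {}" for L
  proof -
    have "finite L" using L fin finite_subset by blast
    then have "Max (N ` L) \<in> N ` L" "\<forall>u\<in>L. N u \<le> Max (N ` L)"
      using L by (auto intro!: Max_in)
    then obtain w where "w \<in> L" "\<forall>u\<in>L. N u \<le> N w" by auto
    then show ?thesis using mono L by (meson linorder_not_less subsetD)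
  qed
  obtain w where w: "w \<in> \<Omega>" "\<forall>u\<in>\<Omega>. lex_le (X u) (X w)" using ex_max[of \<Omega>] ne by auto
  have "{\<omega>'\<in>\<Omega>. lex_le (X \<omega>') (X w)} = \<Omega>" using w by auto
  then have "card \<Omega> \<le> 4 * N w" by (simp add: N_def)
  then obtain z where z: "z \<in> \<Omega>" "card \<Omega> \<le> 4 * N z"
    "\<And>y. y \<in> \<Omega> \<Longrightarrow> card \<Omega> \<le> 4 * N y \<Longrightarrow> N z \<le> N y"
    using w(1) ex_has_least_nat[of "\<lambda>z. z \<in> \<Omega> \<and> card \<Omega> \<le> 4 * N z" w N] by blast
  define L where "L = {\<omega>\<in>\<Omega>. \<not> lex_le (X z) (X \<omega>)}"
  have "4 * card L \<le> card \<Omega>"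
  proof (cases "L = {}")
    case False
    then obtain u where u: "u \<in> L" "\<forall>u'\<in>L. lex_le (X u') (X u)" using ex_max[of L] by (auto simp: L_def)
    have "N u < N z" using u(1) z(1) by (intro mono) (auto simp: L_def)
    then have "4 * N u < card \<Omega>" using z(3)[of u] u(1) by (force simp: L_def)
    moreover have "card L \<le> N u"
      unfolding N_def using u fin by (intro card_mono) (auto simp: L_def)
    ultimately show ?thesis by simp
  qed simp
  then show thesis using that[of "X z"] z(2) by (simp add: N_def L_def)
qed

text \<open>Multiplied out instead of divided by \<open>card \<Omega>\<close>, so that it holds for
  empty \<open>\<Omega>\<close> and adds up over a partition.\<close>

definition atoms_le :: "('a \<Rightarrow> complex) \<Rightarrow> 'a set \<Rightarrow> real \<Rightarrow> bool" where
  "atoms_le X \<Omega> q \<longleftrightarrow> (\<forall>a. real (card {\<omega>\<in>\<Omega>. X \<omega> = a}) \<le> q * card \<Omega>)"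

lemma card_eq_sum_indicator: "finite A \<Longrightarrow> card {x\<in>A. P x} = (\<Sum>x\<in>A. if P x then 1 else 0)"
  by (simp add: sum.If_cases Int_def)

lemma card_pairs_eq_sum:
  assumes "finite A" "finite B"
  shows "card {(x,y)\<in>A\<times>B. P x y} = (\<Sum>x\<in>A. card {y\<in>B. P x y})"
proof -
  have "{(x,y)\<in>A\<times>B. P x y} = (SIGMA x:A. {y\<in>B. P x y})" by auto
  then show ?thesis using assms by (simp add: card_SigmaI)
qed

lemma card_pairs_eq_sum':
  assumes "finite A" "finite B"
  shows "card {(x,y)\<in>A\<times>B. P x y} = (\<Sum>y\<in>B. card {x\<in>A. P x y})"
proof -
  have "(\<Sum>x\<in>A. card {y\<in>B. P x y}) = (\<Sum>x\<in>A. \<Sum>y\<in>B. if P x y then 1 else 0)"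
    using assms by (simp add: card_eq_sum_indicator)
  also have "\<dots> = (\<Sum>y\<in>B. \<Sum>x\<in>A. if P x y then 1 else 0)" by (rule sum.swap)
  also have "\<dots> = (\<Sum>y\<in>B. card {x\<in>A. P x y})" using assms by (simp add: card_eq_sum_indicator)
  finally show ?thesis using assms by (subst card_pairs_eq_sum) auto
qed

lemma atoms_le_add_bound:
  assumes fin: "finite \<Omega>2" "finite \<Omega>3" and q: "atoms_le X3 \<Omega>3 q"
  shows "real (card {(b,c)\<in>\<Omega>2\<times>\<Omega>3. X2 b + X3 c = d}) \<le> q * real (card \<Omega>2) * real (card \<Omega>3)"
proof -
  have "real (card {(b,c)\<in>\<Omega>2\<times>\<Omega>3. X2 b + X3 c = d}) = (\<Sum>b\<in>\<Omega>2. real (card {c\<in>\<Omega>3. X3 c = d - X2 b}))"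
    using fin by (subst card_pairs_eq_sum) (auto simp: algebra_simps)
  also have "\<dots> \<le> (\<Sum>b\<in>\<Omega>2. q * card \<Omega>3)" using q by (intro sum_mono) (simp add: atoms_le_def)
  finally show ?thesis by (simp add: algebra_simps)
qed

text \<open>For \<open>a\<close> in \<open>A\<close>, a solution has \<open>b\<close> outside
  \<open>B\<close> (at most a quarter of \<open>\<Omega>2\<close>) or \<open>c\<close> in
  \<open>C\<close> (about half of \<open>\<Omega>3\<close>), and the remaining variable is then
  pinned to an atom. This replaces the trivial factor 1 by \<open>3/4 + q/2\<close>. As
  \<open>A\<close> is at least a quarter of \<open>\<Omega>1\<close>, the average is
  \<open>1 - 1/4 * (1/4 - q/2) = 15/16 + q/8\<close>.\<close>

lemma contraction_one_sided:
  fixes X1 :: "'a \<Rightarrow> complex" and X2 :: "'b \<Rightarrow> complex" and X3 :: "'c \<Rightarrow> complex"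
  assumes fin: "finite \<Omega>1" "finite \<Omega>2" "finite \<Omega>3"
    and q: "atoms_le X2 \<Omega>2 q" "atoms_le X3 \<Omega>3 q" "0 \<le> q" "q \<le> 1/2"
    and A: "A \<subseteq> \<Omega>1" "card \<Omega>1 \<le> 4 * card A"
    and B: "B \<subseteq> \<Omega>2" "4 * card (\<Omega>2 - B) \<le> card \<Omega>2"
    and C: "C \<subseteq> \<Omega>3" "2 * real (card C) \<le> (1 + q) * real (card \<Omega>3)"
    and ABC: "\<And>a b c. a \<in> A \<Longrightarrow> b \<in> B \<Longrightarrow> c \<in> \<Omega>3 \<Longrightarrow> X1 a + X2 b + X3 c = d \<Longrightarrow> c \<in> C"
  shows "real (card {(a,b,c)\<in>\<Omega>1\<times>\<Omega>2\<times>\<Omega>3. X1 a + X2 b + X3 c = d})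
          \<le> q * (15/16 + q/8) * real (card \<Omega>1) * real (card \<Omega>2) * real (card \<Omega>3)"
proof -
  let ?n1 = "real (card \<Omega>1)" and ?n2 = "real (card \<Omega>2)" and ?n3 = "real (card \<Omega>3)"
  let ?M = "\<lambda>a. real (card {(b,c)\<in>\<Omega>2\<times>\<Omega>3. X1 a + X2 b + X3 c = d})"
  have gen: "?M a \<le> q * ?n2 * ?n3" for a
    using atoms_le_add_bound[OF fin(2,3) q(2), of X2 "d - X1 a"] by (simp add: algebra_simps)
  have finB: "finite B" "finite C" using B C fin finite_subset by auto
  have inA: "?M a \<le> q * ?n2 * ?n3 * (3/4 + q/2)" if a: "a \<in> A" for a
  proof -
    have sub: "{(b,c)\<in>\<Omega>2\<times>\<Omega>3. X1 a + X2 b + X3 c = d} \<subseteq>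
       {(b,c)\<in>(\<Omega>2-B)\<times>\<Omega>3. X2 b + X3 c = d - X1 a} \<union> {(b,c)\<in>\<Omega>2\<times>C. X2 b = d - X1 a - X3 c}"
      (is "_ \<subseteq> ?U \<union> ?V")
      using ABC[OF a] B by (auto simp: algebra_simps)
    have fU: "finite ?U" by (rule finite_subset[of _ "\<Omega>2 \<times> \<Omega>3"]) (use fin in auto)
    have fV: "finite ?V" by (rule finite_subset[of _ "\<Omega>2 \<times> \<Omega>3"]) (use fin C in auto)
    have "?M a \<le> real (card (?U \<union> ?V))" using fU fV by (intro of_nat_mono card_mono sub) auto
    also have "\<dots> \<le> real (card ?U) + real (card ?V)" using card_Un_le[of ?U ?V] by linarith
    also have "real (card ?U) \<le> q * real (card (\<Omega>2 - B)) * ?n3"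
      using fin by (intro atoms_le_add_bound q) auto
    also have "\<dots> \<le> q * (?n2/4) * ?n3" using B(2) q(3) by (intro mult_mono) auto
    also have "real (card ?V) \<le> (\<Sum>c\<in>C. q * ?n2)"
    proof -
      have "real (card ?V) = (\<Sum>c\<in>C. real (card {b\<in>\<Omega>2. X2 b = d - X1 a - X3 c}))"
        using fin finB by (subst card_pairs_eq_sum') auto
      also have "\<dots> \<le> (\<Sum>c\<in>C. q * ?n2)" using q(1) by (intro sum_mono) (simp add: atoms_le_def)
      finally show ?thesis .
    qed
    also have "\<dots> = (q * ?n2) * real (card C)" by simp
    also have "\<dots> \<le> (q * ?n2) * ((1 + q)/2 * ?n3)" using C(2) q(3) by (intro mult_left_mono) auto
    finally show ?thesis by (simp add: field_simps)
  qed
  have fA: "finite A" using A fin finite_subset by auto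
  have "real (card {(a,b,c)\<in>\<Omega>1\<times>\<Omega>2\<times>\<Omega>3. X1 a + X2 b + X3 c = d}) = (\<Sum>a\<in>\<Omega>1. ?M a)"
  proof -
    have "{(a,b,c)\<in>\<Omega>1\<times>\<Omega>2\<times>\<Omega>3. X1 a + X2 b + X3 c = d} =
        {(a,y)\<in>\<Omega>1\<times>(\<Omega>2\<times>\<Omega>3). X1 a + X2 (fst y) + X3 (snd y) = d}" by auto
    moreover have "{y\<in>\<Omega>2\<times>\<Omega>3. X1 a + X2 (fst y) + X3 (snd y) = d} = {(b,c)\<in>\<Omega>2\<times>\<Omega>3. X1 a + X2 b + X3 c = d}" for a
      by auto
    ultimately show ?thesis using fin by (simp only:) (subst card_pairs_eq_sum, auto)
  qed
  also have "\<dots> = (\<Sum>a\<in>\<Omega>1-A. ?M a) + (\<Sum>a\<in>A. ?M a)" using A fin by (simp add: sum.subset_diff)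
  also have "\<dots> \<le> (\<Sum>a\<in>\<Omega>1-A. q * ?n2 * ?n3) + (\<Sum>a\<in>A. q * ?n2 * ?n3 * (3/4 + q/2))"
    by (intro add_mono sum_mono gen inA)
  also have "\<dots> = q * ?n2 * ?n3 * (?n1 - real (card A) * (1/4 - q/2))"
    using A fin fA by (simp add: card_Diff_subset of_nat_diff card_mono algebra_simps)
  also have "\<dots> \<le> q * ?n2 * ?n3 * (?n1 - ?n1/4 * (1/4 - q/2))"
    using A(2) q by (intro mult_left_mono diff_left_mono mult_right_mono) auto
  finally show ?thesis by (simp add: algebra_simps)
qed

text \<open>\<open>x0\<close> is a lower quartile of \<open>X1\<close> and \<open>y0\<close> an
  upper quartile of \<open>X2\<close>; opposite quartiles serve both cases. If the half-line above
  \<open>t\<close> is light, \<open>X1 \<le> x0\<close> on a quarter and \<open>X2 \<le> y0\<close>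
  on three quarters force \<open>X3\<close> into it. If the one below is light,
  \<open>X2 \<ge> y0\<close> on a quarter and \<open>X1 \<ge> x0\<close> on three quarters do
  so.\<close>

lemma contraction:
  fixes X1 :: "'a \<Rightarrow> complex" and X2 :: "'b \<Rightarrow> complex" and X3 :: "'c \<Rightarrow> complex"
  assumes fin: "finite \<Omega>1" "finite \<Omega>2" "finite \<Omega>3"
    and q: "atoms_le X1 \<Omega>1 q" "atoms_le X2 \<Omega>2 q" "atoms_le X3 \<Omega>3 q" "0 \<le> q" "q \<le> 1/2"
  shows "real (card {(a,b,c)\<in>\<Omega>1\<times>\<Omega>2\<times>\<Omega>3. X1 a + X2 b + X3 c = d})
          \<le> q * (15/16 + q/8) * real (card \<Omega>1) * real (card \<Omega>2) * real (card \<Omega>3)"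
proof (cases "\<Omega>1 = {} \<or> \<Omega>2 = {}")
  case True then show ?thesis by auto
next
  case False
  obtain x0 where x0: "card \<Omega>1 \<le> 4 * card {\<omega>\<in>\<Omega>1. lex_le (X1 \<omega>) x0}"
    "4 * card {\<omega>\<in>\<Omega>1. \<not> lex_le x0 (X1 \<omega>)} \<le> card \<Omega>1" using lex_quantile[of \<Omega>1 X1] fin False by auto
  obtain y1 where y1: "card \<Omega>2 \<le> 4 * card {\<omega>\<in>\<Omega>2. lex_le (- X2 \<omega>) y1}"
    "4 * card {\<omega>\<in>\<Omega>2. \<not> lex_le y1 (- X2 \<omega>)} \<le> card \<Omega>2"
    using lex_quantile[of \<Omega>2 "\<lambda>\<omega>. - X2 \<omega>"] fin False by auto
  define y0 where "y0 = - y1"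
  have y0: "card \<Omega>2 \<le> 4 * card {\<omega>\<in>\<Omega>2. lex_le y0 (X2 \<omega>)}"
    "4 * card {\<omega>\<in>\<Omega>2. \<not> lex_le (X2 \<omega>) y0} \<le> card \<Omega>2"
    using y1 by (metis (no_types, lifting) y0_def lex_le_minus minus_minus Collect_cong)+
  define t where "t = d - x0 - y0"
  define Cu where "Cu = {c\<in>\<Omega>3. lex_le t (X3 c)}"
  define Cl where "Cl = {c\<in>\<Omega>3. lex_le (X3 c) t}"
  have f: "finite Cu" "finite Cl" using fin by (auto simp: Cu_def Cl_def)
  have "Cu \<union> Cl = \<Omega>3" using lex_le_total by (auto simp: Cu_def Cl_def)
  \<comment> \<open>The two half-lines share only the atom at \<open>t\<close>, the source of the
    extra \<open>q\<close> in \<open>1 + q\<close>.\<close>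
  moreover have "Cu \<inter> Cl = {c\<in>\<Omega>3. X3 c = t}" by (auto simp: Cu_def Cl_def intro: lex_le_antisym)
  ultimately have "real (card Cu) + card Cl = card \<Omega>3 + real (card {c\<in>\<Omega>3. X3 c = t})"
    using card_Un_Int[OF f] by (simp only: of_nat_add[symmetric])
  also have "\<dots> \<le> (1 + q) * real (card \<Omega>3)" using q(3) by (auto simp: atoms_le_def algebra_simps)
  finally consider "2 * real (card Cu) \<le> (1 + q) * real (card \<Omega>3)" | "2 * real (card Cl) \<le> (1 + q) * real (card \<Omega>3)" by linarith
  then show ?thesis
  proof cases
    case 1
    have "\<Omega>2 - {\<omega>\<in>\<Omega>2. lex_le (X2 \<omega>) y0} = {\<omega>\<in>\<Omega>2. \<not> lex_le (X2 \<omega>) y0}" by auto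
    note eq = this
    show ?thesis
    proof (intro contraction_one_sided[where A = "{\<omega>\<in>\<Omega>1. lex_le (X1 \<omega>) x0}" and B = "{\<omega>\<in>\<Omega>2. lex_le (X2 \<omega>) y0}" and C = Cu]
       fin q x0 y0 1)
      fix a b c assume *: "a \<in> {\<omega>\<in>\<Omega>1. lex_le (X1 \<omega>) x0}" "b \<in> {\<omega>\<in>\<Omega>2. lex_le (X2 \<omega>) y0}" "c \<in> \<Omega>3" "X1 a + X2 b + X3 c = d"
      have "t = d - (x0 + y0)" "X3 c = d - (X1 a + X2 b)" using * by (auto simp: t_def)
      moreover have "lex_le (X1 a + X2 b) (x0 + y0)" using * by (auto intro: lex_le_add)
      ultimately show "c \<in> Cu" using * by (auto simp: Cu_def lex_le_def)
    qed (use y0 eq in \<open>auto simp: Cu_def\<close>)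
  next
    case 2
    have eq: "\<Omega>1 - {\<omega>\<in>\<Omega>1. lex_le x0 (X1 \<omega>)} = {\<omega>\<in>\<Omega>1. \<not> lex_le x0 (X1 \<omega>)}" by auto
    have "real (card {(b,a,c)\<in>\<Omega>2\<times>\<Omega>1\<times>\<Omega>3. X2 b + X1 a + X3 c = d})
          \<le> q * (15/16 + q/8) * real (card \<Omega>2) * real (card \<Omega>1) * real (card \<Omega>3)"
    proof (intro contraction_one_sided[where A = "{\<omega>\<in>\<Omega>2. lex_le y0 (X2 \<omega>)}" and B = "{\<omega>\<in>\<Omega>1. lex_le x0 (X1 \<omega>)}" and C = Cl]
       fin q x0 y0 2)
      fix a b c assume *: "a \<in> {\<omega>\<in>\<Omega>2. lex_le y0 (X2 \<omega>)}" "b \<in> {\<omega>\<in>\<Omega>1. lex_le x0 (X1 \<omega>)}" "c \<in> \<Omega>3" "X2 a + X1 b + X3 c = d"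
      have "t = d - (x0 + y0)" "X3 c = d - (X1 b + X2 a)" using * by (auto simp: t_def)
      moreover have "lex_le (x0 + y0) (X1 b + X2 a)" using * by (auto intro: lex_le_add)
      ultimately show "c \<in> Cl" using * by (auto simp: Cl_def lex_le_def)
    qed (use x0 eq in \<open>auto simp: Cl_def\<close>)
    moreover have "card {(b,a,c)\<in>\<Omega>2\<times>\<Omega>1\<times>\<Omega>3. X2 b + X1 a + X3 c = d} = card {(a,b,c)\<in>\<Omega>1\<times>\<Omega>2\<times>\<Omega>3. X1 a + X2 b + X3 c = d}"
      by (rule bij_betw_same_card[of "\<lambda>(b,a,c). (a,b,c)"])
        (auto simp: bij_betw_def inj_on_def image_iff add.commute)
    ultimately show ?thesis by (simp add: mult_ac)
  qed
qed

subsection \<open>Additive energy\<close>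

text \<open>Lists with repetition model independent uniform choices, so that appending adds
  independent sums; \<open>dtuples\<close> is the sampling without replacement that flips of
  coordinates produce.\<close>

definition tuples :: "nat \<Rightarrow> 'a set \<Rightarrow> 'a list set" where
  "tuples k T = {xs. set xs \<subseteq> T \<and> length xs = k}"

definition dtuples :: "nat \<Rightarrow> 'a set \<Rightarrow> 'a list set" where
  "dtuples k T = {xs. length xs = k \<and> distinct xs \<and> set xs \<subseteq> T}"

abbreviation vsum :: "('a \<Rightarrow> complex) \<Rightarrow> 'a list \<Rightarrow> complex" where
  "vsum v xs \<equiv> sum_list (map v xs)"

definition energy :: "('a \<Rightarrow> complex) \<Rightarrow> nat \<Rightarrow> 'a set \<Rightarrow> nat" where
  "energy v K T = card {(xs, ys) \<in> tuples K T \<times> tuples K T. vsum v xs = vsum v ys}"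

lemma finite_tuples [simp]: "finite T \<Longrightarrow> finite (tuples k T)"
  by (simp add: tuples_def finite_lists_length_eq)

lemma card_tuples: "finite T \<Longrightarrow> card (tuples k T) = card T ^ k"
  by (simp add: tuples_def card_lists_length_eq)

lemma dtuples_subset: "dtuples k T \<subseteq> tuples k T"
  by (auto simp: tuples_def dtuples_def)

lemma finite_dtuples [simp]: "finite T \<Longrightarrow> finite (dtuples k T)"
  using dtuples_subset finite_tuples finite_subset by metis

lemma card_dtuples_Suc:
  assumes "finite T" "k < card T"
  shows "card (dtuples (Suc k) T) = (card T - k) * card (dtuples k T)"
proof -
  have "{card T - Suc k + 1..card T} = insert (card T - k) {card T - k + 1..card T}"
    using assms by auto
  moreover have "card T - k \<notin> {card T - k + 1..card T}" by auto
  ultimately have "\<Prod>{card T - Suc k + 1..card T} = (card T - k) * \<Prod>{card T - k + 1..card T}"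
    by (metis finite_atLeastAtMost prod.insert)
  moreover have "card (dtuples (Suc k) T) = \<Prod>{card T - Suc k + 1..card T}"
    unfolding dtuples_def by (rule card_lists_distinct_length_eq) (use assms in auto)
  moreover have "card (dtuples k T) = \<Prod>{card T - k + 1..card T}"
    unfolding dtuples_def by (rule card_lists_distinct_length_eq) (use assms in auto)
  ultimately show ?thesis by simp
qed

text \<open>Birthday estimate. With \<open>t = card T\<close>, the induction rests on
  \<open>(1 - k/t) * (1 - k^2/(2*t)) \<ge> 1 - (k+1)^2/(2*t)\<close>.\<close>

lemma card_dtuples_lower:
  assumes "finite T" "k \<le> card T"
  shows "real (card T) ^ k * (1 - real k ^ 2 / (2 * real (card T))) \<le> real (card (dtuples k T))"
  using assms(2)
proof (induction k)
  case 0
  have "dtuples 0 T = {[]}" by (auto simp: dtuples_def)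
  then show ?case by simp
next
  case (Suc k)
  let ?t = "real (card T)"
  have t: "?t > 0" "real k < ?t" using Suc.prems by auto
  have "1 - real (Suc k) ^ 2 / (2 * ?t) = 1 - (real k ^ 2 + 2 * real k + 1) / (2 * ?t)"
    by (simp add: power2_eq_square algebra_simps)
  also have "\<dots> \<le> (1 - real k / ?t) * (1 - real k ^ 2 / (2 * ?t))"
  proof -
    have "0 \<le> (real k / ?t) * (real k ^ 2 / (2 * ?t)) + 1 / (2 * ?t)" using t by simp
    also have "\<dots> = (1 - real k / ?t) * (1 - real k ^ 2 / (2 * ?t)) - (1 - (real k ^ 2 + 2 * real k + 1) / (2 * ?t))"
      using t by (simp add: field_simps)
    finally show ?thesis by simp
  qed
  finally have "?t ^ Suc k * (1 - real (Suc k) ^ 2 / (2 * ?t)) \<le> ?t ^ Suc k * ((1 - real k / ?t) * (1 - real k ^ 2 / (2 * ?t)))"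
    by (intro mult_left_mono) auto
  also have "\<dots> = (?t - real k) * (?t ^ k * (1 - real k ^ 2 / (2 * ?t)))"
    using t by (simp add: field_simps)
  also have "\<dots> \<le> (?t - real k) * real (card (dtuples k T))"
    using Suc t by (intro mult_left_mono) auto
  also have "\<dots> = real (card (dtuples (Suc k) T))"
    using card_dtuples_Suc[OF assms(1), of k] Suc.prems by (simp add: of_nat_diff)
  finally show ?case .
qed

lemma card_tuples_le_dtuples:
  assumes "finite T" "k ^ 2 \<le> card T"
  shows "card (tuples k T) \<le> 2 * card (dtuples k T)"
proof (cases "k = 0")
  case True
  have "dtuples 0 T = {[]}" "tuples 0 T = {[]}" by (auto simp: dtuples_def tuples_def)
  then show ?thesis using True by simp
next
  case False
  let ?t = "real (card T)"
  have "k \<le> k ^ 2" using False by (simp add: power2_eq_square)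
  then have kt: "k \<le> card T" using assms by simp
  have t: "?t > 0" using kt False by simp
  have "real k ^ 2 \<le> ?t" using assms(2) by (simp only: of_nat_power[symmetric] of_nat_le_iff)
  then have "1/2 \<le> 1 - real k ^ 2 / (2 * ?t)" using t by (simp add: field_simps)
  then have "?t ^ k * (1/2) \<le> ?t ^ k * (1 - real k ^ 2 / (2 * ?t))" by (intro mult_left_mono) auto
  also have "\<dots> \<le> real (card (dtuples k T))" using card_dtuples_lower[OF assms(1) kt] .
  finally have "real (card T ^ k) \<le> real (2 * card (dtuples k T))" by simp
  then show ?thesis using assms by (simp only: card_tuples of_nat_le_iff)
qed

lemma bij_tuples_append: "bij_betw (\<lambda>(xs, ys). xs @ ys) (tuples j T \<times> tuples k T) (tuples (j + k) T)"
proof (rule bij_betw_byWitness[where f' = "\<lambda>xs. (take j xs, drop j xs)"])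
  show "(\<lambda>xs. (take j xs, drop j xs)) ` tuples (j + k) T \<subseteq> tuples j T \<times> tuples k T"
    by (auto simp: tuples_def dest: in_set_takeD in_set_dropD)
qed (auto simp: tuples_def)

lemma card_tuples_append:
  "card {xs \<in> tuples (j + k) T. P xs} = card {(xs, ys) \<in> tuples j T \<times> tuples k T. P (xs @ ys)}"
proof -
  let ?f = "\<lambda>(xs, ys). xs @ ys" and ?A = "{(xs, ys) \<in> tuples j T \<times> tuples k T. P (xs @ ys)}"
  have surj: "?f ` (tuples j T \<times> tuples k T) = tuples (j + k) T" and inj: "inj_on ?f (tuples j T \<times> tuples k T)"
    using bij_tuples_append[of j T k] by (simp_all add: bij_betw_def)
  have "{xs \<in> tuples (j + k) T. P xs} = ?f ` ?A" unfolding surj[symmetric] by auto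
  moreover have "inj_on ?f ?A" by (rule inj_on_subset[OF inj]) auto
  ultimately show ?thesis by (simp only: card_image)
qed

text \<open>The threshold \<open>1/10\<close> is the value of \<open>q\<close> at which
  \<open>15/16 + q/8\<close> equals \<open>19/20\<close>.\<close>

lemma atoms_le_tuples_triple:
  assumes T: "finite T" and q: "atoms_le (vsum v) (tuples k T) q" "0 \<le> q" "q \<le> 1/10"
  shows "atoms_le (vsum v) (tuples (3 * k) T) (19/20 * q)"
  unfolding atoms_le_def
proof
  fix a
  have "card {xs\<in>tuples (3 * k) T. vsum v xs = a} = card {(xs, zs) \<in> tuples k T \<times> tuples (k + k) T. vsum v xs + vsum v zs = a}"
  proof -
    have "3 * k = k + (k + k)" by simp
    then show ?thesis
      using card_tuples_append[of k "k + k" T "\<lambda>xs. vsum v xs = a"] by (simp only: map_append sum_list_append)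
  qed
  also have "\<dots> = (\<Sum>xs\<in>tuples k T. card {zs \<in> tuples (k + k) T. vsum v xs + vsum v zs = a})"
    using T by (subst card_pairs_eq_sum) auto
  also have "\<dots> = (\<Sum>xs\<in>tuples k T. card {(ys, zs) \<in> tuples k T \<times> tuples k T. vsum v xs + vsum v ys + vsum v zs = a})"
    by (subst card_tuples_append) (simp add: add.assoc)
  also have "\<dots> = card {(xs, y) \<in> tuples k T \<times> (tuples k T \<times> tuples k T). vsum v xs + vsum v (fst y) + vsum v (snd y) = a}"
    using T by (subst card_pairs_eq_sum) (auto intro!: sum.cong arg_cong[where f = card])
  also have "\<dots> = card {(xs, ys, zs) \<in> tuples k T \<times> tuples k T \<times> tuples k T. vsum v xs + vsum v ys + vsum v zs = a}"
    by (intro arg_cong[where f = card]) auto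
  finally have "real (card {xs\<in>tuples (3 * k) T. vsum v xs = a}) = real \<dots>" by (rule arg_cong)
  also have "\<dots> \<le> q * (15/16 + q/8) * real (card (tuples k T)) * real (card (tuples k T)) * real (card (tuples k T))"
    by (rule contraction) (use assms in auto)
  also have "\<dots> \<le> q * (19/20) * real (card (tuples k T)) * real (card (tuples k T)) * real (card (tuples k T))"
    using q by (intro mult_right_mono mult_left_mono) auto
  also have "\<dots> = 19/20 * q * real (card (tuples (3 * k) T))"
  proof -
    have "3 * k = k + k + k" by simp
    then have "real (card (tuples (3 * k) T)) = real (card (tuples k T)) * real (card (tuples k T)) * real (card (tuples k T))"
      using T by (simp only: card_tuples power_add of_nat_mult)
    then show ?thesis by simp
  qed
  finally show "real (card {xs\<in>tuples (3 * k) T. vsum v xs = a}) \<le> 19/20 * q * real (card (tuples (3 * k) T))" .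
qed

lemma atoms_le_tuples_pow3:
  assumes T: "finite T" and q: "atoms_le (vsum v) (tuples k T) q" "0 \<le> q" "q \<le> 1/10"
  shows "atoms_le (vsum v) (tuples (3 ^ r * k) T) ((19/20) ^ r * q)"
proof (induction r)
  case (Suc r)
  have "(19/20) ^ r * q \<le> 1 * q" using q by (intro mult_right_mono power_le_one) auto
  then show ?case using atoms_le_tuples_triple[OF T Suc] q by (simp add: mult.assoc)
qed (use q in simp)

lemma sum_by_value:
  assumes "finite \<Omega>" "finite A" "X ` \<Omega> \<subseteq> A"
  shows "(\<Sum>\<omega>\<in>\<Omega>. g (X \<omega>)) = (\<Sum>a\<in>A. card {\<omega>\<in>\<Omega>. X \<omega> = a} * (g a :: nat))"
proof -
  have "(\<Sum>\<omega>\<in>\<Omega>. g (X \<omega>)) = (\<Sum>a\<in>A. \<Sum>\<omega>\<in>{\<omega>\<in>\<Omega>. X \<omega> = a}. g (X \<omega>))"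
    using sum.group[OF assms, of "\<lambda>\<omega>. g (X \<omega>)"] by simp
  then show ?thesis by simp
qed

text \<open>With \<open>N a\<close> the multiplicity of the value \<open>a\<close>, the left side
  correlates \<open>N\<close> with its reflection, and \<open>2*x*y \<le> x^2 + y^2\<close> bounds
  this by the sum of squares. The set \<open>A\<close> is closed under the reflection at
  \<open>b\<close>, so reflected squares have the same sum.\<close>

lemma card_sum_eq_le_energy:
  fixes X :: "'a \<Rightarrow> complex"
  assumes "finite \<Omega>"
  shows "card {(x, y) \<in> \<Omega> \<times> \<Omega>. X x + X y = b} \<le> card {(x, y) \<in> \<Omega> \<times> \<Omega>. X x = X y}"
proof -
  define A where "A = X ` \<Omega> \<union> (\<lambda>a. b - a) ` X ` \<Omega>"
  define N where "N a = card {\<omega>\<in>\<Omega>. X \<omega> = a}" for a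
  have A: "finite A" "X ` \<Omega> \<subseteq> A" using assms by (auto simp: A_def)
  have refl: "bij_betw (\<lambda>a. b - a) A A"
    by (rule bij_betw_byWitness[where f' = "\<lambda>a. b - a"]) (auto simp: A_def)
  have "card {(x, y) \<in> \<Omega> \<times> \<Omega>. X x + X y = b} = (\<Sum>x\<in>\<Omega>. card {y\<in>\<Omega>. X x + X y = b})"
    using assms by (subst card_pairs_eq_sum) auto
  also have "\<dots> = (\<Sum>x\<in>\<Omega>. N (b - X x))" by (auto simp: N_def algebra_simps intro!: sum.cong arg_cong[where f = card])
  also have "\<dots> = (\<Sum>a\<in>A. N a * N (b - a))" using sum_by_value[OF assms A, of "\<lambda>a. N (b - a)"] by (simp add: N_def)
  finally have 1: "card {(x, y) \<in> \<Omega> \<times> \<Omega>. X x + X y = b} = (\<Sum>a\<in>A. N a * N (b - a))" .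
  have "2 * (\<Sum>a\<in>A. N a * N (b - a)) \<le> (\<Sum>a\<in>A. N a * N a + N (b - a) * N (b - a))"
    unfolding sum_distrib_left
  proof (intro sum_mono)
    fix a
    have "0 \<le> (int (N a) - int (N (b - a)))\<^sup>2" by simp
    then have "int (2 * (N a * N (b - a))) \<le> int (N a * N a + N (b - a) * N (b - a))"
      by (simp add: power2_eq_square algebra_simps)
    then show "2 * (N a * N (b - a)) \<le> N a * N a + N (b - a) * N (b - a)" by (simp only: of_nat_le_iff)
  qed
  also have "\<dots> = 2 * (\<Sum>a\<in>A. N a * N a)"
    using sum.reindex_bij_betw[OF refl, of "\<lambda>a. N a * N a"] by (simp add: sum.distrib)
  also have "(\<Sum>a\<in>A. N a * N a) = (\<Sum>x\<in>\<Omega>. N (X x))" using sum_by_value[OF assms A, of N] by (simp add: N_def)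
  also have "\<dots> = card {(x, y) \<in> \<Omega> \<times> \<Omega>. X x = X y}"
    using assms by (subst card_pairs_eq_sum) (auto simp: N_def intro!: sum.cong arg_cong[where f = card])
  finally show ?thesis using 1 by simp
qed

lemma card_atom_le_energy:
  assumes "finite T"
  shows "card {xs \<in> tuples (K + K) T. vsum v xs = b} \<le> energy v K T"
  using card_sum_eq_le_energy[of "tuples K T" "vsum v" b] assms
  by (simp add: card_tuples_append energy_def)

lemma energy_mono:
  assumes "finite S" "T \<subseteq> S"
  shows "energy v K T \<le> energy v K S"
  unfolding energy_def
proof (rule card_mono)
  show "finite {(xs, ys) \<in> tuples K S \<times> tuples K S. vsum v xs = vsum v ys}"
    by (rule finite_subset[of _ "tuples K S \<times> tuples K S"]) (use assms(1) in auto)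
qed (use assms(2) in \<open>auto simp: tuples_def\<close>)

text \<open>Two losses and one gain: passing from \<open>S\<close> to a \<open>T\<close> of at least
  half its size costs \<open>2 ^ (2 * K) = 4 ^ K\<close>, distinctness costs 2, and \<open>r\<close>
  triplings gain \<open>(19/20) ^ r\<close>.\<close>

lemma atoms_le_dtuples:
  assumes T: "finite T" and S: "finite S" "T \<subseteq> S" "card S \<le> 2 * card T" and m: "(3 ^ r * (2 * K)) ^ 2 \<le> card T"
    and e: "real (energy v K S) \<le> e * real (card S) ^ (2 * K)" "0 \<le> e" "4 ^ K * e \<le> 1/10"
  shows "atoms_le (vsum v) (dtuples (3 ^ r * (2 * K)) T) (2 * ((19/20) ^ r * (4 ^ K * e)))"
proof -
  let ?m = "3 ^ r * (2 * K)"
  have "atoms_le (vsum v) (tuples (2 * K) T) (4 ^ K * e)"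
    unfolding atoms_le_def
  proof
    fix a
    have "real (card {xs \<in> tuples (2 * K) T. vsum v xs = a}) \<le> real (energy v K S)"
      using card_atom_le_energy[OF T, of K v a] energy_mono[OF S(1,2), of v K]
      by (simp add: mult_2)
    also have "\<dots> \<le> e * (2 * real (card T)) ^ (2 * K)"
      using S(3) e(2) by (intro order.trans[OF e(1)] mult_left_mono power_mono) auto
    also have "(2 * real (card T)) ^ (2 * K) = 4 ^ K * real (card (tuples (2 * K) T))"
    proof -
      have "(2::real) ^ (2 * K) = 4 ^ K" by (simp only: power_mult) simp
      then show ?thesis using T by (simp add: card_tuples power_mult_distrib)
    qed
    also have "e * (4 ^ K * real (card (tuples (2 * K) T))) = 4 ^ K * e * real (card (tuples (2 * K) T))" by simp
    finally show "real (card {xs \<in> tuples (2 * K) T. vsum v xs = a}) \<le> 4 ^ K * e * real (card (tuples (2 * K) T))" .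
  qed
  then have *: "atoms_le (vsum v) (tuples ?m T) ((19/20) ^ r * (4 ^ K * e))"
    using e by (intro atoms_le_tuples_pow3 T) auto
  show ?thesis unfolding atoms_le_def
  proof
    fix a
    have "real (card {xs \<in> dtuples ?m T. vsum v xs = a}) \<le> real (card {xs \<in> tuples ?m T. vsum v xs = a})"
      using T dtuples_subset[of ?m T] by (intro of_nat_mono card_mono) auto
    also have "\<dots> \<le> (19/20) ^ r * (4 ^ K * e) * real (card (tuples ?m T))"
      using * by (simp add: atoms_le_def)
    also have "\<dots> \<le> (19/20) ^ r * (4 ^ K * e) * (2 * real (card (dtuples ?m T)))"
      using e(2) card_tuples_le_dtuples[OF T m] by (intro mult_left_mono) auto
    finally show "real (card {xs \<in> dtuples ?m T. vsum v xs = a}) \<le> 2 * ((19/20) ^ r * (4 ^ K * e)) * real (card (dtuples ?m T))"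
      by simp
  qed
qed

subsection \<open>Anticoncentration on the sign set\<close>

definition ip :: "nat \<Rightarrow> (nat \<Rightarrow> int) \<Rightarrow> (nat \<Rightarrow> complex) \<Rightarrow> complex" where
  "ip n x v = (\<Sum>j<n. of_int (x j) * v j)"

definition sign_vec :: "nat \<Rightarrow> (nat \<Rightarrow> int) \<Rightarrow> bool" where
  "sign_vec n x \<longleftrightarrow> (\<forall>j<n. x j \<in> {-1, 1}) \<and> (\<forall>j. n \<le> j \<longrightarrow> x j = 0)"

lemma sign_set_iff: "x \<in> sign_set n s \<longleftrightarrow> sign_vec n x \<and> (sum x {..<n} = s - 1 \<or> sum x {..<n} = s + 1)"
  by (auto simp: sign_set_def sign_vec_def)

lemma finite_sign_vec [simp]: "finite (Collect (sign_vec n))"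
proof -
  have "Collect (sign_vec n) \<subseteq> (\<lambda>P j. if j < n then if j \<in> P then 1 else -1 else 0) ` Pow {..<n}"
  proof
    fix x assume "x \<in> Collect (sign_vec n)"
    then have "x = (\<lambda>j. if j < n then if j \<in> {j. j < n \<and> x j = 1} then 1 else -1 else 0)"
      by (fastforce simp: sign_vec_def fun_eq_iff)
    then show "x \<in> (\<lambda>P j. if j < n then if j \<in> P then 1 else -1 else 0) ` Pow {..<n}" by blast
  qed
  then show ?thesis by (rule finite_subset) auto
qed

lemma finite_sign_set [simp]: "finite (sign_set n s)"
  by (rule finite_subset[OF _ finite_sign_vec[of n]]) (auto simp: sign_set_iff)

lemma card_dtuples: "finite A \<Longrightarrow> m \<le> card A \<Longrightarrow> card (dtuples m A) = \<Prod>{card A - m + 1..card A}"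
  unfolding dtuples_def by (rule card_lists_distinct_length_eq)

definition flip :: "(nat \<Rightarrow> int) \<Rightarrow> nat list \<Rightarrow> nat \<Rightarrow> int" where
  "flip x I = (\<lambda>j. if j \<in> set I then - x j else x j)"

lemma flip_flip [simp]: "flip (flip x I) I = x"
  by (auto simp: flip_def)

lemma flip_props:
  assumes x: "sign_vec n x" and S: "S \<subseteq> {..<n}" and I: "I \<in> dtuples m {j\<in>S. x j = \<sigma>}" and \<sigma>: "\<sigma> \<in> {-1, 1}"
  shows "sign_vec n (flip x I)"
    and "sum (flip x I) {..<n} = sum x {..<n} - 2 * \<sigma> * int m"
    and "ip n (flip x I) v = ip n x v - 2 * of_int \<sigma> * vsum v I"
    and "card {j\<in>S. flip x I j = \<sigma>} = card {j\<in>S. x j = \<sigma>} - m"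
    and "card {j\<in>S. flip x I j = - \<sigma>} = card {j\<in>S. x j = - \<sigma>} + m"
    and "I \<in> dtuples m {j\<in>S. flip x I j = - \<sigma>}"
proof -
  have I': "length I = m" "distinct I" "set I \<subseteq> S" "\<And>j. j \<in> set I \<Longrightarrow> x j = \<sigma>"
    using I by (auto simp: dtuples_def)
  have sub: "set I \<subseteq> {..<n}" using I' S by auto
  have fS: "finite S" using S finite_subset by blast
  have cI: "card (set I) = m" using I' distinct_card by metis
  show "sign_vec n (flip x I)" using x by (auto simp: sign_vec_def flip_def)
  have "sum (flip x I) {..<n} = (\<Sum>j<n. x j - (if j \<in> set I then 2 * \<sigma> else 0))"
    using I' by (intro sum.cong) (auto simp: flip_def)
  also have "\<dots> = sum x {..<n} - (\<Sum>j\<in>{..<n} \<inter> set I. 2 * \<sigma>)"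
    by (simp add: sum_subtractf sum.If_cases)
  also have "{..<n} \<inter> set I = set I" using sub by auto
  finally show "sum (flip x I) {..<n} = sum x {..<n} - 2 * \<sigma> * int m" by (simp add: cI)
  have "ip n (flip x I) v = (\<Sum>j<n. of_int (x j) * v j - (if j \<in> set I then 2 * of_int \<sigma> * v j else 0))"
    unfolding ip_def using I' by (intro sum.cong) (auto simp: flip_def)
  also have "\<dots> = ip n x v - (\<Sum>j\<in>{..<n} \<inter> set I. 2 * of_int \<sigma> * v j)"
    by (simp add: sum_subtractf sum.If_cases ip_def)
  also have "{..<n} \<inter> set I = set I" using sub by auto
  also have "(\<Sum>j\<in>set I. 2 * of_int \<sigma> * v j) = 2 * of_int \<sigma> * vsum v I"
    using I'(2) by (simp add: sum_distrib_left[symmetric] sum_list_distinct_conv_sum_set)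
  finally show "ip n (flip x I) v = ip n x v - 2 * of_int \<sigma> * vsum v I" .
  have "{j\<in>S. flip x I j = \<sigma>} = {j\<in>S. x j = \<sigma>} - set I" using I' \<sigma> by (auto simp: flip_def)
  then show "card {j\<in>S. flip x I j = \<sigma>} = card {j\<in>S. x j = \<sigma>} - m"
    using I' cI card_Diff_subset[of "set I" "{j\<in>S. x j = \<sigma>}"] by auto
  have "{j\<in>S. flip x I j = - \<sigma>} = {j\<in>S. x j = - \<sigma>} \<union> set I" "{j\<in>S. x j = - \<sigma>} \<inter> set I = {}"
    using I' \<sigma> by (auto simp: flip_def)
  then show "card {j\<in>S. flip x I j = - \<sigma>} = card {j\<in>S. x j = - \<sigma>} + m"
    using fS cI by (simp add: card_Un_disjoint)
  show "I \<in> dtuples m {j\<in>S. flip x I j = - \<sigma>}"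
    using I' by (auto simp: dtuples_def flip_def)
qed

text \<open>
  Conditionally on the positions of the remaining \<open>\<tau>\<close>-entries, some \<open>m\<close> of the \<open>\<tau>\<close>-entries of \<open>x\<close> inside \<open>S\<close> form a
  uniformly random \<open>m\<close>-subset of the set \<open>T\<close> of free positions. No independence is lost to the
  prescribed row sum because flipping these entries shifts the sum by the constant \<open>2 * \<tau> * m\<close>.
\<close>

lemma slice_class_bound:
  assumes S: "S \<subseteq> {..<n}" and \<tau>: "\<tau> \<in> {-1, 1}"
    and \<Omega>: "\<Omega> = {x \<in> sign_set n s. card {j\<in>S. x j = \<tau>} = h}"
    and h: "2 * h \<le> card S" "m \<le> h"
    and T: "\<And>T. T \<subseteq> S \<Longrightarrow> card S \<le> 2 * card T \<Longrightarrow> atoms_le (vsum v) (dtuples m T) M"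
  shows "atoms_le (\<lambda>x. ip n x v) \<Omega> M"
  unfolding atoms_le_def
proof
  fix a
  have fS: "finite S" using S finite_subset by blast
  have f\<Omega>: "finite \<Omega>" by (simp add: \<Omega>)
  define P where "P x = {j\<in>S. x j = \<tau>}" for x :: "nat \<Rightarrow> int"
  define Q where "Q x = {j\<in>S. x j = - \<tau>}" for x :: "nat \<Rightarrow> int"
  have fPQ: "finite (P x)" "finite (Q x)" for x using fS by (auto simp: P_def Q_def)
  define Z where "Z = {z. sign_vec n z \<and> (sum z {..<n} = s - 1 - 2 * \<tau> * int m \<or> sum z {..<n} = s + 1 - 2 * \<tau> * int m)
     \<and> card (P z) = h - m}"
  have fZ: "finite Z" by (rule finite_subset[OF _ finite_sign_vec[of n]]) (auto simp: Z_def)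
  define E where "E = (SIGMA x:\<Omega>. dtuples m (P x))"
  define E' where "E' = (SIGMA z:Z. dtuples m (Q z))"
  have fE: "finite E" "finite E'" using f\<Omega> fZ fPQ by (auto simp: E_def E'_def)
  have to: "(flip x I, I) \<in> E'" if "(x, I) \<in> E" for x I
    using that flip_props[of n x S I m \<tau>] S \<tau>
    by (auto simp: E_def E'_def P_def Q_def Z_def \<Omega> sign_set_iff)
  have from': "(flip z I, I) \<in> E" "ip n (flip z I) v = ip n z v + 2 * of_int \<tau> * vsum v I" if "(z, I) \<in> E'" for z I
    using that flip_props[of n z S I m "- \<tau>"] S \<tau> h
    by (auto simp: E_def E'_def P_def Q_def Z_def \<Omega> sign_set_iff)
  have bij: "bij_betw (\<lambda>(x, I). (flip x I, I)) E' E"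
    by (rule bij_betw_byWitness[where f' = "\<lambda>(x, I). (flip x I, I)"]) (use to from' in auto)
  \<comment> \<open>Every \<open>x\<close> in \<open>\<Omega>\<close> has exactly \<open>h\<close>
    entries \<open>\<tau>\<close> in \<open>S\<close>, hence the same number \<open>D\<close> of
    ordered choices, so pairs in \<open>E\<close> represent \<open>\<Omega>\<close>
    uniformly.\<close>
  define D where "D = \<Prod>{h - m + 1..h}"
  have Dpos: "D > 0" by (auto simp: D_def intro!: prod_pos)
  have cP: "card (dtuples m (P x)) = D" if "x \<in> \<Omega>" for x
    unfolding D_def using that fPQ h by (subst card_dtuples) (auto simp: \<Omega> P_def)
  have "D * card {x\<in>\<Omega>. ip n x v = a} = (\<Sum>x\<in>{x\<in>\<Omega>. ip n x v = a}. card (dtuples m (P x)))"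
    using cP by simp
  also have "\<dots> = card (SIGMA x:{x\<in>\<Omega>. ip n x v = a}. dtuples m (P x))"
    using f\<Omega> fPQ by (simp add: card_SigmaI)
  also have "(SIGMA x:{x\<in>\<Omega>. ip n x v = a}. dtuples m (P x)) = {(x, I) \<in> E. ip n x v = a}"
    by (auto simp: E_def)
  also have "card \<dots> = card {(z, I) \<in> E'. ip n z v + 2 * of_int \<tau> * vsum v I = a}"
  proof -
    have "bij_betw (\<lambda>(x, I). (flip x I, I)) {(z, I) \<in> E'. ip n z v + 2 * of_int \<tau> * vsum v I = a} {(x, I) \<in> E. ip n x v = a}"
    proof (rule bij_betw_byWitness[where f' = "\<lambda>(x, I). (flip x I, I)"])
      show "(\<lambda>(x, I). (flip x I, I)) ` {(x, I) \<in> E. ip n x v = a} \<subseteq> {(z, I) \<in> E'. ip n z v + 2 * of_int \<tau> * vsum v I = a}"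
      proof clarify
        fix x I assume *: "(x, I) \<in> E" "a = ip n x v"
        show "(flip x I, I) \<in> E' \<and> ip n (flip x I) v + 2 * of_int \<tau> * vsum v I = ip n x v"
          using to[OF *(1)] from'(2)[OF to[OF *(1)]] by (simp only: flip_flip simp_thms)
      qed
      show "(\<lambda>(x, I). (flip x I, I)) ` {(z, I) \<in> E'. ip n z v + 2 * of_int \<tau> * vsum v I = a} \<subseteq> {(x, I) \<in> E. ip n x v = a}"
      proof clarify
        fix z I assume *: "(z, I) \<in> E'"
        show "(flip z I, I) \<in> E \<and> ip n (flip z I) v = ip n z v + 2 * of_int \<tau> * vsum v I"
          using from'[OF *] by (simp only: simp_thms)
      qed
    qed auto
    from bij_betw_same_card[OF this] show ?thesis by (rule sym)
  qed
  also have "{(z, I) \<in> E'. ip n z v + 2 * of_int \<tau> * vsum v I = a} = (SIGMA z:Z. {I \<in> dtuples m (Q z). ip n z v + 2 * of_int \<tau> * vsum v I = a})"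
    by (auto simp: E'_def)
  also have "card \<dots> = (\<Sum>z\<in>Z. card {I \<in> dtuples m (Q z). ip n z v + 2 * of_int \<tau> * vsum v I = a})"
    using fZ fPQ by (simp add: card_SigmaI)
  finally have "real (D * card {x\<in>\<Omega>. ip n x v = a}) = real (\<Sum>z\<in>Z. card {I \<in> dtuples m (Q z). ip n z v + 2 * of_int \<tau> * vsum v I = a})"
    by (rule arg_cong)
  then have "real D * real (card {x\<in>\<Omega>. ip n x v = a}) = (\<Sum>z\<in>Z. real (card {I \<in> dtuples m (Q z). ip n z v + 2 * of_int \<tau> * vsum v I = a}))"
    by (simp only: of_nat_mult of_nat_sum)
  also have "\<dots> \<le> (\<Sum>z\<in>Z. M * real (card (dtuples m (Q z))))"
  proof (intro sum_mono)
    fix z assume z: "z \<in> Z"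
    have "P z \<union> Q z = S" using z S \<tau> by (fastforce simp: P_def Q_def Z_def sign_vec_def)
    moreover have "P z \<inter> Q z = {}" using \<tau> by (auto simp: P_def Q_def)
    ultimately have "card (P z) + card (Q z) = card S" using fPQ card_Un_disjoint by metis
    \<comment> \<open>\<open>P z\<close> has only \<open>h - m\<close> elements and
      \<open>2 * h \<le> card S\<close>.\<close>
    then have "card S \<le> 2 * card (Q z)" using z h by (auto simp: Z_def)
    then have at: "atoms_le (vsum v) (dtuples m (Q z)) M" by (intro T) (auto simp: Q_def)
    have "{I \<in> dtuples m (Q z). ip n z v + 2 * of_int \<tau> * vsum v I = a} = {I \<in> dtuples m (Q z). vsum v I = (a - ip n z v) / (2 * of_int \<tau>)}"
      using \<tau> by (auto simp: field_simps)
    then show "real (card {I \<in> dtuples m (Q z). ip n z v + 2 * of_int \<tau> * vsum v I = a}) \<le> M * real (card (dtuples m (Q z)))"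
      using at by (simp add: atoms_le_def)
  qed
  also have "\<dots> = M * real (card E')" using fZ fPQ by (simp add: E'_def card_SigmaI sum_distrib_left)
  also have "card E' = card E" using bij_betw_same_card[OF bij] .
  also have "card E = D * card \<Omega>" using f\<Omega> fPQ cP by (simp add: E_def card_SigmaI)
  finally show "real (card {x\<in>\<Omega>. ip n x v = a}) \<le> M * real (card \<Omega>)"
    using Dpos by (simp add: mult.left_commute)
qed

text \<open>Rows are classified by the number of entries 1 in \<open>S\<close>, and in each class
  the rarer sign inside \<open>S\<close> is the one flipped; this leaves at least half of
  \<open>S\<close> as free positions.\<close>

lemma slice_bound:
  assumes S: "S \<subseteq> {..<n}"
    and m: "\<And>x \<tau>. x \<in> sign_set n s \<Longrightarrow> \<tau> \<in> {-1, 1} \<Longrightarrow> m \<le> card {j\<in>S. x j = \<tau>}"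
    and T: "\<And>T. T \<subseteq> S \<Longrightarrow> card S \<le> 2 * card T \<Longrightarrow> atoms_le (vsum v) (dtuples m T) M"
  shows "atoms_le (\<lambda>x. ip n x v) (sign_set n s) M"
proof -
  have fS: "finite S" using S finite_subset by blast
  define \<Omega> where "\<Omega> h = {x \<in> sign_set n s. card {j\<in>S. x j = 1} = h}" for h
  have part: "sign_set n s = (\<Union>h\<in>{..card S}. \<Omega> h)"
    using fS by (auto simp: \<Omega>_def intro: card_mono)
  have at: "atoms_le (\<lambda>x. ip n x v) (\<Omega> h) M" if "h \<le> card S" for h
  proof (cases "\<Omega> h = {}")
    case True then show ?thesis by (simp add: atoms_le_def)
  next
    case False
    then obtain x where x: "x \<in> \<Omega> h" by blast
    have tot: "card {j\<in>S. y j = 1} + card {j\<in>S. y j = -1} = card S" if "y \<in> sign_set n s" for y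
    proof -
      have "{j\<in>S. y j = 1} \<union> {j\<in>S. y j = -1} = S" using that S by (fastforce simp: sign_set_iff sign_vec_def)
      moreover have "{j\<in>S. y j = 1} \<inter> {j\<in>S. y j = -1} = {}" by auto
      ultimately show ?thesis using fS by (metis (no_types, lifting) card_Un_disjoint finite_Un)
    qed
    show ?thesis
    proof (cases "2 * h \<le> card S")
      case True
      show ?thesis
        by (rule slice_class_bound[OF S, of 1 _ s h m]) (use True x m T in \<open>auto simp: \<Omega>_def\<close>)
    next
      case False
      have eq: "\<Omega> h = {y \<in> sign_set n s. card {j\<in>S. y j = -1} = card S - h}"
        using tot that by (fastforce simp: \<Omega>_def)
      have "m \<le> card S - h" using m[of x "-1"] x eq by auto
      then show ?thesis
        by (intro slice_class_bound[OF S, of "-1" _ s "card S - h" m]) (use False eq T in auto)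
    qed
  qed
  have card_part: "card {x \<in> sign_set n s. p x} = (\<Sum>h\<in>{..card S}. card {x \<in> \<Omega> h. p x})" for p
  proof -
    have "{x \<in> sign_set n s. p x} = (\<Union>h\<in>{..card S}. {x \<in> \<Omega> h. p x})" using part by auto
    then show ?thesis by (simp only:) (rule card_UN_disjoint, auto simp: \<Omega>_def)
  qed
  show ?thesis unfolding atoms_le_def
  proof
    fix a
    have "real (card {x \<in> sign_set n s. ip n x v = a}) = (\<Sum>h\<in>{..card S}. real (card {x \<in> \<Omega> h. ip n x v = a}))"
      using card_part by simp
    also have "\<dots> \<le> (\<Sum>h\<in>{..card S}. M * real (card (\<Omega> h)))"
      using at by (intro sum_mono) (auto simp: atoms_le_def)
    also have "\<dots> = M * real (card (sign_set n s))"
      using card_part[of "\<lambda>_. True"] by (simp add: sum_distrib_left)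
    finally show "real (card {x \<in> sign_set n s. ip n x v = a}) \<le> M * real (card (sign_set n s))" .
  qed
qed

section \<open>Small ball estimate for sums of independent steps\<close>

lemma tuples_Suc: "tuples (Suc m) \<Omega> = (\<lambda>(\<omega>, ts). \<omega> # ts) ` (\<Omega> \<times> tuples m \<Omega>)"
  by (auto simp: tuples_def image_iff length_Suc_conv)

lemma card_tuples_Suc:
  assumes "finite \<Omega>"
  shows "card {ts \<in> tuples (Suc m) \<Omega>. P ts} = (\<Sum>\<omega>\<in>\<Omega>. card {ts \<in> tuples m \<Omega>. P (\<omega> # ts)})"
proof -
  have "{ts \<in> tuples (Suc m) \<Omega>. P ts} = (\<lambda>(\<omega>, ts). \<omega> # ts) ` (SIGMA \<omega>:\<Omega>. {ts \<in> tuples m \<Omega>. P (\<omega> # ts)})"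
    by (auto simp: tuples_Suc)
  also have "card \<dots> = card (SIGMA \<omega>:\<Omega>. {ts \<in> tuples m \<Omega>. P (\<omega> # ts)})"
    by (rule card_image) (auto simp: inj_on_def)
  finally show ?thesis using assms by (simp add: card_SigmaI)
qed

text \<open>
  \<open>heat_bound R c m l\<close> bounds the probability that a sum of \<open>m\<close> steps lies in a set of \<open>l\<close> points.
  For two shifts \<open>D\<^sub>1 \<noteq> D\<^sub>2\<close> of such a set, \<open>1\<^bsub>D\<^sub>1\<^esub> + 1\<^bsub>D\<^sub>2\<^esub> = 1\<^bsub>D\<^sub>1 \<union> D\<^sub>2\<^esub> + 1\<^bsub>D\<^sub>1 \<inter> D\<^sub>2\<^esub>\<close> moves \<open>l\<close> to
  \<open>l + k\<close> and \<open>l - k\<close> with \<open>k \<ge> 1\<close>, so that any concave supersolution of the discrete heat equation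
  in \<open>l\<close>, vanishing at 0 and at least 1 from \<open>R\<close> on, will do.
\<close>

definition heat_bound :: "nat \<Rightarrow> real \<Rightarrow> nat \<Rightarrow> nat \<Rightarrow> real" where
  "heat_bound R c m l = real l / real R + (1 - c / real R ^ 2) ^ m * (real R ^ 2 - (real R - min (real l) (real R)) ^ 2)"

text \<open>The profile is a parabola up to its vertex \<open>r\<close> and constant beyond. Before
  the vertex the second difference is \<open>- 2 * k^2\<close>; across it, with
  \<open>a = r - l\<close>, it is \<open>2 * a^2 - (a + k)^2\<close>, which is at most
  \<open>- 2\<close> because \<open>1 \<le> a \<le> k\<close>.\<close>

lemma heat_bound_profile:
  fixes l k r :: real
  assumes "1 \<le> k" "k \<le> l" "l + 1 \<le> r"
  shows "(r\<^sup>2 - (r - min (l + k) r)\<^sup>2) + (r\<^sup>2 - (r - min (l - k) r)\<^sup>2) \<le> 2 * (r\<^sup>2 - (r - min l r)\<^sup>2) - 2"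
proof (cases "l + k \<le> r")
  case True
  have "1 \<le> k\<^sup>2" using assms by (simp add: one_le_power)
  then show ?thesis using True assms by (simp add: min_absorb1 power2_eq_square algebra_simps)
next
  case False
  define a where "a = r - l"
  have a: "1 \<le> a" "a \<le> k" using False assms by (auto simp: a_def)
  have "(2 * a)\<^sup>2 \<le> (a + k)\<^sup>2" using a by (intro power_mono) auto
  moreover have "1 \<le> a\<^sup>2" using a by (simp add: one_le_power)
  ultimately have "2 * a\<^sup>2 + 2 \<le> (a + k)\<^sup>2" by (simp add: power_mult_distrib)
  moreover have "min (l + k) r = r" "min (l - k) r = l - k" "min l r = l" using False assms by auto
  moreover have "r - (l - k) = a + k" "r - l = a" by (simp_all add: a_def)
  ultimately show ?thesis by (simp only:) simp
qed

lemma heat_bound_pair: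
  assumes c: "0 \<le> c" "c \<le> 1" and l: "1 \<le> k" "k \<le> l" "l < R"
  shows "heat_bound R c m (l + k) + heat_bound R c m (l - k) \<le> 2 * heat_bound R c m l - 2 * (1 - c / real R ^ 2) ^ m"
proof -
  let ?g = "\<lambda>x::real. (real R)\<^sup>2 - (real R - min x (real R))\<^sup>2"
  have R: "1 \<le> real R" using l by simp
  have "c / real R ^ 2 \<le> 1" using c R by (simp add: divide_le_eq order.trans[OF c(2)] one_le_power)
  then have lam: "0 \<le> (1 - c / real R ^ 2) ^ m" by simp
  have "?g (real l + real k) + ?g (real l - real k) \<le> 2 * ?g (real l) - 2"
    using l by (intro heat_bound_profile) auto
  then have "(1 - c / real R ^ 2) ^ m * (?g (real l + real k) + ?g (real l - real k)) \<le> (1 - c / real R ^ 2) ^ m * (2 * ?g (real l) - 2)"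
    using lam by (intro mult_left_mono)
  moreover have "(real l + real k) / real R + (real l - real k) / real R = 2 * (real l / real R)"
    by (simp add: add_divide_distrib[symmetric])
  ultimately show ?thesis using l by (simp add: heat_bound_def of_nat_diff algebra_simps)
qed

text \<open>Peeling off one step replaces \<open>D\<close> by its translates
  \<open>Ds \<omega>\<close>. Averaging over pairs of first steps, each unequal pair gains from
  concavity, and \<open>coll\<close> says that a proportion \<open>c\<close> of the pairs is
  unequal. The term \<open>l / R\<close> settles \<open>l \<ge> R\<close>, the parabola settles
  \<open>m = 0\<close>.\<close>

lemma small_ball_walk:
  fixes w :: "'a \<Rightarrow> complex"
  assumes fin: "finite \<Omega>" "\<Omega> \<noteq> {}" and c: "0 \<le> c" "c \<le> 1" and R: "0 < R"
    and coll: "c * real (card \<Omega>) ^ 2 \<le> real (card {(a, b) \<in> \<Omega> \<times> \<Omega>. w a \<noteq> w b})"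
    and D: "finite D"
  shows "real (card {ts \<in> tuples m \<Omega>. vsum w ts \<in> D}) \<le> heat_bound R c m (card D) * real (card (tuples m \<Omega>))"
  using D
proof (induction m arbitrary: D)
  case 0
  have t0: "tuples 0 \<Omega> = {[]}" by (auto simp: tuples_def)
  have nonneg: "0 \<le> real R ^ 2 - (real R - min l (real R)) ^ 2" if "0 \<le> l" for l
  proof -
    have "(real R - min l (real R)) ^ 2 \<le> real R ^ 2" using that by (intro power_mono) auto
    then show ?thesis by simp
  qed
  show ?case
  proof (cases "D = {}")
    case False
    then have "1 \<le> card D" using 0 by (simp add: Suc_leI card_gt_0_iff)
    have "(real R - min (real (card D)) (real R)) ^ 2 \<le> (real R - 1) ^ 2"
      using \<open>1 \<le> card D\<close> R by (intro power_mono) auto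
    also have "\<dots> \<le> real R ^ 2 - 1" using R by (simp add: power2_eq_square algebra_simps)
    finally have "1 \<le> heat_bound R c 0 (card D)" by (simp add: heat_bound_def add_increasing)
    moreover have "card {ts \<in> tuples 0 \<Omega>. vsum w ts \<in> D} \<le> 1"
      unfolding t0 by (rule order.trans[OF card_mono[of "{[]}"]]) auto
    ultimately show ?thesis by (simp add: t0)
  qed (simp add: heat_bound_def nonneg)
next
  case (Suc m)
  let ?n = "real (card \<Omega>)" and ?l = "card D"
  let ?lam = "1 - c / real R ^ 2"
  have n: "?n > 0" using fin by (simp add: card_gt_0_iff)
  have R1: "1 \<le> real R" using R by simp
  have "c / real R ^ 2 \<le> 1" using c R1 by (simp add: divide_le_eq order.trans[OF c(2)] one_le_power)
  then have lam: "0 \<le> ?lam" by simp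
  define g where "g = real R ^ 2 - (real R - min (real ?l) (real R)) ^ 2"
  have g: "0 \<le> g" "g \<le> real R ^ 2"
  proof -
    have "(real R - min (real ?l) (real R)) ^ 2 \<le> real R ^ 2" by (intro power_mono) auto
    then show "0 \<le> g" by (simp add: g_def)
  qed (simp add: g_def)
  have hb: "heat_bound R c k ?l = real ?l / real R + ?lam ^ k * g" for k by (simp add: heat_bound_def g_def)
  consider "?l = 0" | "?l \<ge> R" | "1 \<le> ?l" "?l < R" by linarith
  then show ?case
  proof cases
    case 1
    then have "D = {}" using Suc.prems by simp
    then show ?thesis by (simp add: heat_bound_def)
  next
    case 2
    have "1 \<le> real ?l / real R" using 2 R by simp
    then have "1 \<le> heat_bound R c (Suc m) ?l" using lam g by (simp add: hb add_increasing2)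
    moreover have "card {ts \<in> tuples (Suc m) \<Omega>. vsum w ts \<in> D} \<le> card (tuples (Suc m) \<Omega>)"
      using fin by (intro card_mono) auto
    ultimately show ?thesis using mult_mono[of 1 "heat_bound R c (Suc m) ?l"
        "real (card {ts \<in> tuples (Suc m) \<Omega>. vsum w ts \<in> D})" "real (card (tuples (Suc m) \<Omega>))"] by simp
  next
    case 3
    define N where "N D' = real (card {ts \<in> tuples m \<Omega>. vsum w ts \<in> D'})" for D'
    define Ds where "Ds \<omega> = (\<lambda>d. d - w \<omega>) ` D" for \<omega>
    define t where "t = real (card (tuples m \<Omega>))"
    have t: "0 \<le> t" by (simp add: t_def)
    have fDs: "finite (Ds \<omega>)" "card (Ds \<omega>) = ?l" for \<omega>
      using Suc.prems by (auto simp: Ds_def card_image inj_on_def)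
    have IH: "N D' \<le> heat_bound R c m (card D') * t" if "finite D'" for D'
      using Suc.IH[OF that] by (simp add: N_def t_def)
    have modular: "N A + N B = N (A \<union> B) + N (A \<inter> B)" for A B
    proof -
      have "card {ts \<in> tuples m \<Omega>. vsum w ts \<in> A} + card {ts \<in> tuples m \<Omega>. vsum w ts \<in> B} =
        card ({ts \<in> tuples m \<Omega>. vsum w ts \<in> A} \<union> {ts \<in> tuples m \<Omega>. vsum w ts \<in> B}) +
        card ({ts \<in> tuples m \<Omega>. vsum w ts \<in> A} \<inter> {ts \<in> tuples m \<Omega>. vsum w ts \<in> B})"
        using fin by (intro card_Un_Int) auto
      moreover have "{ts \<in> tuples m \<Omega>. vsum w ts \<in> A} \<union> {ts \<in> tuples m \<Omega>. vsum w ts \<in> B} = {ts \<in> tuples m \<Omega>. vsum w ts \<in> A \<union> B}"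
        "{ts \<in> tuples m \<Omega>. vsum w ts \<in> A} \<inter> {ts \<in> tuples m \<Omega>. vsum w ts \<in> B} = {ts \<in> tuples m \<Omega>. vsum w ts \<in> A \<inter> B}" by auto
      ultimately show ?thesis by (simp only: N_def of_nat_add[symmetric])
    qed
    have pair: "N (Ds a) + N (Ds b) \<le> t * (2 * heat_bound R c m ?l - (if w a \<noteq> w b then 2 * ?lam ^ m else 0))" for a b
    proof (cases "w a = w b")
      case True
      then show ?thesis using IH[OF fDs(1)[of a]] IH[OF fDs(1)[of b]] by (simp add: fDs algebra_simps)
    next
      case False
      \<comment> \<open>The element sums of the two translates differ by
        \<open>l * (w a - w b)\<close>, which is nonzero in characteristic 0.\<close>
      have "Ds a \<noteq> Ds b"
      proof
        assume "Ds a = Ds b"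
        then have "\<Sum>(Ds a) = \<Sum>(Ds b)" by simp
        moreover have "\<Sum>(Ds \<omega>) = \<Sum>D - of_nat ?l * w \<omega>" for \<omega>
          unfolding Ds_def by (subst sum.reindex) (auto simp: inj_on_def sum_subtractf)
        ultimately show False using False 3 by simp
      qed
      then have "\<not> Ds a \<subseteq> Ds b" using fDs by (metis card_subset_eq)
      then have "card (Ds a \<inter> Ds b) < ?l" using fDs by (metis inf_le1 inf.absorb_iff1 psubset_card_mono psubsetI)
      moreover define k where "k = ?l - card (Ds a \<inter> Ds b)"
      ultimately have k: "1 \<le> k" "k \<le> ?l" "card (Ds a \<inter> Ds b) = ?l - k" by auto
      have "card (Ds a \<union> Ds b) + card (Ds a \<inter> Ds b) = ?l + ?l"
        using card_Un_Int[OF fDs(1)[of a] fDs(1)[of b]] fDs by simp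
      then have k': "card (Ds a \<union> Ds b) = ?l + k" using k by simp
      have "N (Ds a) + N (Ds b) \<le> heat_bound R c m (?l + k) * t + heat_bound R c m (?l - k) * t"
        unfolding modular[of "Ds a"] using IH[of "Ds a \<union> Ds b"] IH[of "Ds a \<inter> Ds b"] fDs(1) k k' by simp
      also have "\<dots> = t * (heat_bound R c m (?l + k) + heat_bound R c m (?l - k))" by (simp add: algebra_simps)
      also have "\<dots> \<le> t * (2 * heat_bound R c m ?l - 2 * ?lam ^ m)"
        using t heat_bound_pair[OF c k(1,2) 3(2)] by (intro mult_left_mono)
      finally show ?thesis using False by simp
    qed
    have "real (card {ts \<in> tuples (Suc m) \<Omega>. vsum w ts \<in> D}) = (\<Sum>\<omega>\<in>\<Omega>. real (card {ts \<in> tuples m \<Omega>. w \<omega> + vsum w ts \<in> D}))"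
      using fin by (subst card_tuples_Suc) auto
    also have "\<dots> = (\<Sum>\<omega>\<in>\<Omega>. N (Ds \<omega>))"
    proof (intro sum.cong refl)
      fix \<omega>
      have "w \<omega> + z \<in> D \<longleftrightarrow> z \<in> Ds \<omega>" for z unfolding Ds_def image_iff by (metis add_diff_cancel_left' diff_add_cancel add.commute)
      then show "real (card {ts \<in> tuples m \<Omega>. w \<omega> + vsum w ts \<in> D}) = N (Ds \<omega>)" by (simp add: N_def)
    qed
    finally have tot: "real (card {ts \<in> tuples (Suc m) \<Omega>. vsum w ts \<in> D}) = (\<Sum>\<omega>\<in>\<Omega>. N (Ds \<omega>))" .
    have "2 * ?n * (\<Sum>\<omega>\<in>\<Omega>. N (Ds \<omega>)) = (\<Sum>a\<in>\<Omega>. \<Sum>b\<in>\<Omega>. N (Ds a) + N (Ds b))"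
      by (simp add: sum.distrib sum_distrib_left mult.assoc)
    also have "\<dots> \<le> (\<Sum>a\<in>\<Omega>. \<Sum>b\<in>\<Omega>. t * (2 * heat_bound R c m ?l - (if w a \<noteq> w b then 2 * ?lam ^ m else 0)))"
      by (intro sum_mono pair)
    also have "\<dots> = t * (2 * heat_bound R c m ?l * ?n ^ 2 - 2 * ?lam ^ m * (\<Sum>a\<in>\<Omega>. \<Sum>b\<in>\<Omega>. if w a \<noteq> w b then 1 else 0))"
    proof -
      have "(\<Sum>a\<in>\<Omega>. \<Sum>b\<in>\<Omega>. t * (2 * heat_bound R c m ?l - (if w a \<noteq> w b then 2 * ?lam ^ m else 0)))
        = (\<Sum>a\<in>\<Omega>. \<Sum>b\<in>\<Omega>. t * (2 * heat_bound R c m ?l) - t * (2 * ?lam ^ m) * (if w a \<noteq> w b then 1 else 0))"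
        by (intro sum.cong refl) (simp add: algebra_simps)
      also have "\<dots> = ?n * (?n * (t * (2 * heat_bound R c m ?l))) - t * (2 * ?lam ^ m) * (\<Sum>a\<in>\<Omega>. \<Sum>b\<in>\<Omega>. if w a \<noteq> w b then 1 else 0)"
        by (simp only: sum_subtractf sum_constant sum_distrib_left[symmetric])
      finally show ?thesis by (simp add: power2_eq_square algebra_simps)
    qed
    also have "(\<Sum>a\<in>\<Omega>. \<Sum>b\<in>\<Omega>. if w a \<noteq> w b then 1 else 0) = real (card {(a, b) \<in> \<Omega> \<times> \<Omega>. w a \<noteq> w b})"
    proof -
      have "card {(a, b) \<in> \<Omega> \<times> \<Omega>. w a \<noteq> w b} = (\<Sum>a\<in>\<Omega>. \<Sum>b\<in>\<Omega>. if w a \<noteq> w b then 1 else 0)"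
        using fin(1) by (subst card_pairs_eq_sum) (simp_all only: card_eq_sum_indicator)
      then show ?thesis by (simp only: of_nat_sum if_distrib[of of_nat] of_nat_1 of_nat_0)
    qed
    also have "t * (2 * heat_bound R c m ?l * ?n ^ 2 - 2 * ?lam ^ m * real (card {(a, b) \<in> \<Omega> \<times> \<Omega>. w a \<noteq> w b}))
        \<le> t * (2 * heat_bound R c m ?l * ?n ^ 2 - 2 * ?lam ^ m * (c * ?n ^ 2))"
      using t lam coll by (intro mult_left_mono diff_left_mono) auto
    also have "\<dots> = 2 * ?n ^ 2 * t * (heat_bound R c m ?l - c * ?lam ^ m)" by (simp add: algebra_simps)
    also have "\<dots> \<le> 2 * ?n ^ 2 * t * heat_bound R c (Suc m) ?l"
    proof -
      \<comment> \<open>The gain in one step is \<open>c\<close> times \<open>?lam ^ m\<close>;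
        since \<open>g \<le> R^2\<close>, it covers the fraction \<open>c / R^2\<close> of the
        parabola term, which fixes the decay rate.\<close>
      have "c * (g / real R ^ 2) \<le> c * 1" using g c R1 by (intro mult_left_mono) (auto simp: divide_le_eq)
      then have "?lam ^ m * (c * (g / real R ^ 2)) \<le> ?lam ^ m * c" using lam by (intro mult_left_mono) auto
      moreover have "?lam ^ Suc m * g = ?lam ^ m * g - ?lam ^ m * (c * (g / real R ^ 2))" by (simp add: algebra_simps)
      ultimately have "heat_bound R c m ?l - c * ?lam ^ m \<le> heat_bound R c (Suc m) ?l"
        unfolding hb by (simp add: algebra_simps)
      then show ?thesis using t by (intro mult_left_mono) auto
    qed
    finally have "2 * ?n * (\<Sum>\<omega>\<in>\<Omega>. N (Ds \<omega>)) \<le> 2 * ?n * (heat_bound R c (Suc m) ?l * (?n * t))"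
      by (simp add: power2_eq_square algebra_simps)
    then have "(\<Sum>\<omega>\<in>\<Omega>. N (Ds \<omega>)) \<le> heat_bound R c (Suc m) ?l * (?n * t)" using n by simp
    then show ?thesis using fin tot by (simp add: t_def card_tuples)
  qed
qed

text \<open>For \<open>c > 0\<close>, fixing \<open>R\<close> first and then taking \<open>m\<close>
  large brings the bound below any prescribed constant, which is all that is asked of it.\<close>

lemma small_ball_walk_atom:
  fixes w :: "'a \<Rightarrow> complex"
  assumes "finite \<Omega>" "\<Omega> \<noteq> {}" "0 \<le> c" "c \<le> 1" "0 < R"
    and "c * real (card \<Omega>) ^ 2 \<le> real (card {(a, b) \<in> \<Omega> \<times> \<Omega>. w a \<noteq> w b})"
  shows "atoms_le (vsum w) (tuples m \<Omega>) (1 / real R + (1 - c / real R ^ 2) ^ m * (2 * real R))"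
  unfolding atoms_le_def
proof
  fix a :: complex
  have R: "1 \<le> real R" using assms by simp
  have "c / real R ^ 2 \<le> 1" using assms R by (simp add: divide_le_eq order.trans[OF assms(4)] one_le_power)
  then have lam: "0 \<le> (1 - c / real R ^ 2) ^ m" by simp
  have "real R ^ 2 - (real R - min 1 (real R)) ^ 2 \<le> 2 * real R" using R by (simp add: power2_eq_square algebra_simps)
  then have "heat_bound R c m 1 \<le> 1 / real R + (1 - c / real R ^ 2) ^ m * (2 * real R)"
    unfolding heat_bound_def using lam by (simp add: mult_left_mono)
  then have "heat_bound R c m (card {a}) * real (card (tuples m \<Omega>)) \<le> (1 / real R + (1 - c / real R ^ 2) ^ m * (2 * real R)) * real (card (tuples m \<Omega>))"
    by (intro mult_right_mono) auto
  then show "real (card {ts \<in> tuples m \<Omega>. vsum w ts = a}) \<le> (1 / real R + (1 - c / real R ^ 2) ^ m * (2 * real R)) * real (card (tuples m \<Omega>))"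
    using small_ball_walk[OF assms, of "{a}" m] by simp
qed

subsection \<open>Vectors with a large atom are almost constant\<close>

text \<open>
  Applying transpositions of coordinates preserves the uniform distribution on the sign set, and
  disjoint random transpositions change \<open>x \<bullet> v\<close> by a sum of nearly independent steps.
\<close>

fun transposed :: "(nat \<times> nat \<times> bool) list \<Rightarrow> (nat \<Rightarrow> int) \<Rightarrow> nat \<Rightarrow> int" where
  "transposed [] x = x"
| "transposed ((i, j, b) # ts) x = transposed ts (if b then x(i := x j, j := x i) else x)"

text \<open>The Boolean makes the swap lazy: half of all triples give step 0, so a positive share of
  nonzero steps already yields a positive share of unequal pairs. All steps refer to the initial
  \<open>x\<close>, since disjoint swaps never touch each other's coordinates.\<close>

definition swap_step :: "(nat \<Rightarrow> complex) \<Rightarrow> (nat \<Rightarrow> int) \<Rightarrow> nat \<times> nat \<times> bool \<Rightarrow> complex" where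
  "swap_step v x = (\<lambda>(i, j, b). if b then of_int (x j - x i) * (v i - v j) else 0)"

definition disjoint_swaps :: "nat \<Rightarrow> nat \<Rightarrow> (nat \<times> nat \<times> bool) list set" where
  "disjoint_swaps n m = {ts \<in> tuples m ({..<n} \<times> {..<n} \<times> UNIV). distinct (map fst ts @ map (\<lambda>t. fst (snd t)) ts)}"

lemma ip_swap:
  assumes "i < n" "j < n" "i \<noteq> j"
  shows "ip n (x(i := x j, j := x i)) v = ip n x v + of_int (x j - x i) * (v i - v j)"
proof -
  have split: "(\<Sum>k<n. f k) = f i + f j + (\<Sum>k\<in>{..<n} - {i, j}. f k)" for f :: "nat \<Rightarrow> complex"
  proof -
    have "(\<Sum>k<n. f k) = sum f {i, j} + (\<Sum>k\<in>{..<n} - {i, j}. f k)"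
      using assms by (subst add.commute, subst sum.subset_diff[of "{i, j}"]) auto
    then show ?thesis using assms by simp
  qed
  show ?thesis unfolding ip_def split using assms by (simp add: algebra_simps)
qed

lemma sum_swap_coords:
  fixes x :: "nat \<Rightarrow> int"
  assumes "i < n" "j < n" "i \<noteq> j"
  shows "sum (x(i := x j, j := x i)) {..<n} = sum x {..<n}"
proof -
  have "complex_of_int (sum (x(i := x j, j := x i)) {..<n}) = complex_of_int (sum x {..<n})"
    using ip_swap[OF assms, of x "\<lambda>_. 1"] by (simp add: ip_def del: fun_upd_apply)
  then show ?thesis by (simp only: of_int_eq_iff)
qed

lemma sign_set_swap:
  assumes "i < n" "j < n" "i \<noteq> j" "x \<in> sign_set n s"
  shows "x(i := x j, j := x i) \<in> sign_set n s"
  using assms sum_swap_coords[OF assms(1-3), of x] by (auto simp: sign_set_iff sign_vec_def)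

lemma disjoint_swaps_Cons:
  "(i, j, b) # ts \<in> disjoint_swaps n (Suc m) \<longleftrightarrow>
    i < n \<and> j < n \<and> i \<noteq> j \<and> ts \<in> disjoint_swaps n m \<and> (\<forall>t\<in>set ts. fst t \<notin> {i, j} \<and> fst (snd t) \<notin> {i, j})"
  by (auto simp: disjoint_swaps_def tuples_def)

lemma bij_transposed:
  assumes "ts \<in> disjoint_swaps n m"
  shows "bij_betw (transposed ts) (sign_set n s) (sign_set n s)"
  using assms
proof (induction ts arbitrary: m)
  case Nil then show ?case by (simp add: bij_betw_def)
next
  case (Cons t ts)
  obtain i j b where t: "t = (i, j, b)" by (cases t)
  obtain m' where m: "m = Suc m'" using Cons.prems by (auto simp: disjoint_swaps_def tuples_def)
  have d: "i < n" "j < n" "i \<noteq> j" "ts \<in> disjoint_swaps n m'" using Cons.prems unfolding t m disjoint_swaps_Cons by auto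
  have "bij_betw (\<lambda>x. if b then x(i := x j, j := x i) else x) (sign_set n s) (sign_set n s)"
    by (rule bij_betw_byWitness[where f' = "\<lambda>x. if b then x(i := x j, j := x i) else x"])
      (use sign_set_swap[OF d(1-3)] d in auto)
  from bij_betw_trans[OF this Cons.IH[OF d(4)]] show ?case by (simp add: t o_def)
qed

lemma ip_transposed:
  assumes "ts \<in> disjoint_swaps n m"
  shows "ip n (transposed ts x) v = ip n x v + vsum (swap_step v x) ts"
  using assms
proof (induction ts arbitrary: m x)
  case (Cons t ts)
  obtain i j b where t: "t = (i, j, b)" by (cases t)
  obtain m' where m: "m = Suc m'" using Cons.prems by (auto simp: disjoint_swaps_def tuples_def)
  have d: "i < n" "j < n" "i \<noteq> j" "ts \<in> disjoint_swaps n m'"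
    "\<forall>t\<in>set ts. fst t \<notin> {i, j} \<and> fst (snd t) \<notin> {i, j}" using Cons.prems unfolding t m disjoint_swaps_Cons by auto
  define y where "y = (if b then x(i := x j, j := x i) else x)"
  have "map (swap_step v y) ts = map (swap_step v x) ts"
    using d(5) by (intro map_cong refl) (auto simp: swap_step_def y_def split: prod.splits)
  then have "ip n (transposed ts y) v = ip n y v + vsum (swap_step v x) ts"
    using Cons.IH[OF d(4), of y] by (simp only:)
  moreover have "ip n y v = ip n x v + swap_step v x t"
    using ip_swap[OF d(1-3), of x v] by (simp add: y_def t swap_step_def)
  ultimately show ?case by (simp add: t y_def add.assoc)
qed simp

text \<open>A distinct list of \<open>2 * m\<close> indices, cut into halves and zipped with bits,
  is a list of disjoint swaps; so the birthday estimate for \<open>2 * m\<close> indices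
  applies.\<close>

lemma card_tuples_le_disjoint_swaps:
  assumes "(2 * m) ^ 2 \<le> n"
  shows "card (tuples m ({..<n} \<times> {..<n} \<times> (UNIV :: bool set))) \<le> 2 * card (disjoint_swaps n m)"
proof -
  let ?f = "\<lambda>(xs, bs). zip (take m xs) (zip (drop m xs) bs) :: (nat \<times> nat \<times> bool) list"
  let ?A = "dtuples (2 * m) {..<n} \<times> tuples m (UNIV :: bool set)"
  have inj: "inj_on ?f ?A"
  proof (rule inj_on_inverseI[where g = "\<lambda>ts. (map fst ts @ map (\<lambda>t. fst (snd t)) ts, map (\<lambda>t. snd (snd t)) ts)"])
    fix p assume "p \<in> ?A"
    then obtain xs bs where p: "p = (xs, bs)" "length xs = 2 * m" "length bs = m" by (auto simp: dtuples_def tuples_def)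
    have "map (\<lambda>t. fst (snd t)) (zip (take m xs) (zip (drop m xs) bs)) = map fst (map snd (zip (take m xs) (zip (drop m xs) bs)))"
      "map (\<lambda>t. snd (snd t)) (zip (take m xs) (zip (drop m xs) bs)) = map snd (map snd (zip (take m xs) (zip (drop m xs) bs)))"
      by (simp_all add: o_def)
    then show "(\<lambda>ts. (map fst ts @ map (\<lambda>t. fst (snd t)) ts, map (\<lambda>t. snd (snd t)) ts)) (?f p) = p"
      using p by simp
  qed
  have sub: "?f ` ?A \<subseteq> disjoint_swaps n m"
  proof clarify
    fix xs :: "nat list" and bs :: "bool list"
    assume xs: "xs \<in> dtuples (2 * m) {..<n}" and bs: "bs \<in> tuples m UNIV"
    let ?z = "zip (take m xs) (zip (drop m xs) bs)"
    have len: "length xs = 2 * m" "length bs = m" using xs bs by (auto simp: dtuples_def tuples_def)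
    have "map fst ?z = take m xs" "map (\<lambda>t. fst (snd t)) ?z = drop m xs"
      using len by (simp_all flip: map_map[unfolded o_def, of fst snd])
    then have "map fst ?z @ map (\<lambda>t. fst (snd t)) ?z = xs" by simp
    then have "distinct (map fst ?z @ map (\<lambda>t. fst (snd t)) ?z)" using xs by (simp only: dtuples_def mem_Collect_eq)
    moreover have "set ?z \<subseteq> {..<n} \<times> {..<n} \<times> UNIV"
    proof
      fix t assume "t \<in> set ?z"
      moreover obtain i j b where t: "t = (i, j, b)" by (cases t)
      ultimately have "i \<in> set (take m xs)" "(j, b) \<in> set (zip (drop m xs) bs)"
        by (blast dest: set_zip_leftD set_zip_rightD)+
      then have "i \<in> set (take m xs)" "j \<in> set (drop m xs)" by (blast dest: set_zip_leftD)+
      with t show "t \<in> {..<n} \<times> {..<n} \<times> UNIV" using xs by (auto simp: dtuples_def dest: in_set_takeD in_set_dropD)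
    qed
    moreover have "length ?z = m" using len by simp
    ultimately show "?z \<in> disjoint_swaps n m" unfolding disjoint_swaps_def tuples_def by blast
  qed
  have fin: "finite (disjoint_swaps n m)" by (simp add: disjoint_swaps_def)
  have "card (tuples m ({..<n} \<times> {..<n} \<times> (UNIV :: bool set))) = card (tuples (2 * m) {..<n}) * card (tuples m (UNIV :: bool set))"
    by (simp add: card_tuples card_UNIV_bool power_mult_distrib power_mult power2_eq_square)
  also have "\<dots> \<le> 2 * card (dtuples (2 * m) {..<n}) * card (tuples m (UNIV :: bool set))"
    using card_tuples_le_dtuples[of "{..<n}" "2 * m"] assms by (intro mult_right_mono) auto
  also have "\<dots> = 2 * card (?f ` ?A)" using card_image[OF inj] by (simp add: card_cartesian_product)
  also have "\<dots> \<le> 2 * card (disjoint_swaps n m)" using card_mono[OF fin sub] by simp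
  finally show ?thesis .
qed

lemma card_Collect_bij:
  assumes "bij_betw f A A"
  shows "card {x\<in>A. P (f x)} = card {x\<in>A. P x}"
proof -
  have "f ` {x\<in>A. P (f x)} = {x \<in> f ` A. P x}" by auto
  also have "f ` A = A" using assms by (simp add: bij_betw_def)
  finally have im: "f ` {x\<in>A. P (f x)} = {x\<in>A. P x}" .
  have "inj_on f {x\<in>A. P (f x)}" by (rule inj_on_subset[of f A]) (use assms in \<open>auto simp: bij_betw_def\<close>)
  from card_image[OF this] show ?thesis by (simp only: im)
qed

text \<open>Pairs of swaps and rows are counted twice. For fixed swaps the atom keeps its size, as
  \<open>transposed ts\<close> permutes the sign set; for fixed \<open>x\<close>, disjoint swaps are
  at least half of all tuples, hence the factor 2.\<close>

lemma swap_bound: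
  assumes n: "0 < n" "(2 * m) ^ 2 \<le> n" and M: "0 \<le> M"
    and w: "\<And>x. x \<in> sign_set n s \<Longrightarrow> atoms_le (vsum (swap_step v x)) (tuples m ({..<n} \<times> {..<n} \<times> UNIV)) M"
  shows "atoms_le (\<lambda>x. ip n x v) (sign_set n s) (2 * M)"
  unfolding atoms_le_def
proof
  fix a
  let ?S = "sign_set n s" and ?W = "disjoint_swaps n m" and ?T = "tuples m ({..<n} \<times> {..<n} \<times> (UNIV :: bool set))"
  have fin: "finite ?W" "finite ?T" by (auto simp: disjoint_swaps_def)
  have TW: "card ?T \<le> 2 * card ?W" by (rule card_tuples_le_disjoint_swaps) (use n in simp)
  have "card ?T > 0" using n by (simp add: card_tuples card_UNIV_bool)
  then have W: "card ?W > 0" using TW by linarith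
  have eq: "card {x\<in>?S. ip n (transposed ts x) v = a} = card {x\<in>?S. ip n x v = a}" if "ts \<in> ?W" for ts
    by (rule card_Collect_bij[OF bij_transposed[OF that]])
  have "card ?W * card {x\<in>?S. ip n x v = a} = (\<Sum>ts\<in>?W. card {x\<in>?S. ip n (transposed ts x) v = a})"
    using eq by simp
  also have "\<dots> = (\<Sum>ts\<in>?W. card {x\<in>?S. ip n x v + vsum (swap_step v x) ts = a})"
    using ip_transposed by (intro sum.cong refl) simp
  also have "\<dots> = (\<Sum>x\<in>?S. card {ts\<in>?W. ip n x v + vsum (swap_step v x) ts = a})"
    using fin card_pairs_eq_sum[of ?W ?S "\<lambda>ts x. ip n x v + vsum (swap_step v x) ts = a"]
      card_pairs_eq_sum'[of ?W ?S "\<lambda>ts x. ip n x v + vsum (swap_step v x) ts = a"] by simp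
  finally have "real (card ?W * card {x\<in>?S. ip n x v = a}) = (\<Sum>x\<in>?S. real (card {ts\<in>?W. ip n x v + vsum (swap_step v x) ts = a}))"
    by simp
  also have "\<dots> \<le> (\<Sum>x\<in>?S. M * (2 * real (card ?W)))"
  proof (intro sum_mono)
    fix x assume x: "x \<in> ?S"
    have "real (card {ts\<in>?W. ip n x v + vsum (swap_step v x) ts = a}) \<le> real (card {ts\<in>?T. vsum (swap_step v x) ts = a - ip n x v})"
      using fin by (intro of_nat_mono card_mono) (auto simp: disjoint_swaps_def)
    also have "\<dots> \<le> M * real (card ?T)" using w[OF x] by (simp add: atoms_le_def)
    also have "\<dots> \<le> M * (2 * real (card ?W))" using TW M by (intro mult_left_mono) auto
    finally show "real (card {ts\<in>?W. ip n x v + vsum (swap_step v x) ts = a}) \<le> M * (2 * real (card ?W))" .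
  qed
  finally show "real (card {x\<in>?S. ip n x v = a}) \<le> 2 * M * real (card ?S)"
    using W by (simp add: mult_ac)
qed

text \<open>The count is half of \<open>n + \<tau> * sum x {..<n}\<close>, so at least
  \<open>(\<epsilon> * n - 1) / 2\<close>, and \<open>2 \<le> \<epsilon> * n\<close> absorbs the
  1.\<close>

lemma card_sign_ge:
  assumes x: "x \<in> sign_set n s" and \<tau>: "\<tau> \<in> {-1, 1}" and s: "real_of_int \<bar>s\<bar> \<le> (1 - \<epsilon>) * real n" and n: "2 \<le> \<epsilon> * real n"
  shows "\<epsilon> * real n / 4 \<le> real (card {j\<in>{..<n}. x j = \<tau>})"
proof -
  have "(\<Sum>j<n. \<tau> * x j) = (\<Sum>j<n. 2 * (if x j = \<tau> then 1 else 0) - 1)"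
    using x \<tau> by (intro sum.cong) (auto simp: sign_set_iff sign_vec_def)
  also have "\<dots> = 2 * int (card {j\<in>{..<n}. x j = \<tau>}) - int n"
  proof -
    have "int (card {j\<in>{..<n}. x j = \<tau>}) = (\<Sum>j<n. if x j = \<tau> then 1 else 0)"
      by (simp only: card_eq_sum_indicator finite_lessThan of_nat_sum if_distrib[of of_nat] of_nat_1 of_nat_0)
    then show ?thesis by (simp only: sum_subtractf sum_distrib_left[symmetric]) simp
  qed
  finally have *: "2 * int (card {j\<in>{..<n}. x j = \<tau>}) = int n + \<tau> * sum x {..<n}" by (simp add: sum_distrib_left)
  have "\<bar>\<tau> * sum x {..<n}\<bar> \<le> \<bar>s\<bar> + 1" using x \<tau> by (auto simp: sign_set_iff)
  then have "int n - \<bar>s\<bar> - 1 \<le> 2 * int (card {j\<in>{..<n}. x j = \<tau>})" using * by linarith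
  then have "real n - real_of_int \<bar>s\<bar> - 1 \<le> 2 * real (card {j\<in>{..<n}. x j = \<tau>})" by linarith
  then show ?thesis using s n by (simp add: algebra_simps)
qed

text \<open>A swap changes the inner product only if it exchanges opposite signs at unequal entries
  of \<open>v\<close>. Were such pairs rare, the value at some \<open>j0\<close> in \<open>N\<close>
  would be shared by at least half of \<open>P\<close>; by \<open>v\<close> with
  \<open>\<beta> = v j0\<close>, many entries over \<open>N\<close> differ from it, and all of these
  are discordant with that half.\<close>

lemma discordant_pairs:
  fixes v :: "nat \<Rightarrow> complex"
  assumes P: "finite P" "finite N" and \<epsilon>: "0 < \<epsilon>" "0 < \<delta>" "\<delta> \<le> \<epsilon> / 4" and r: "0 < r"
    and card: "\<epsilon> * r / 4 \<le> real (card P)" "\<epsilon> * r / 4 \<le> real (card N)" 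
    and v: "\<And>\<beta>. \<delta> * r \<le> real (card {i\<in>P. v i \<noteq> \<beta>}) + real (card {i\<in>N. v i \<noteq> \<beta>})"
  shows "\<epsilon> * \<delta> / 16 * r ^ 2 \<le> real (card {(i, j) \<in> P \<times> N. v i \<noteq> v j})"
proof (rule ccontr)
  assume neg: "\<not> ?thesis"
  have \<epsilon>r: "0 < \<epsilon> * r" using \<epsilon> r by simp
  define a where "a j = real (card {i\<in>P. v i \<noteq> v j})" for j
  have tot: "real (card {(i, j) \<in> P \<times> N. v i \<noteq> v j}) = (\<Sum>j\<in>N. a j)"
    using P by (subst card_pairs_eq_sum') (auto simp: a_def)
  have "\<exists>j\<in>N. a j < \<delta> * r / 2"
  proof (rule ccontr)
    assume "\<not> ?thesis"
    then have "(\<Sum>j\<in>N. \<delta> * r / 2) \<le> (\<Sum>j\<in>N. a j)" by (intro sum_mono) auto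
    moreover have "(\<epsilon> * r / 4) * (\<delta> * r / 2) \<le> real (card N) * (\<delta> * r / 2)" using card(2) \<epsilon> r by (intro mult_right_mono) auto
    moreover have "\<epsilon> * \<delta> / 16 * r ^ 2 \<le> (\<epsilon> * r / 4) * (\<delta> * r / 2)" using \<epsilon> by (simp add: power2_eq_square)
    ultimately show False using neg tot by simp
  qed
  then obtain j0 where j0: "j0 \<in> N" "a j0 < \<delta> * r / 2" by blast
  define P' where "P' = {i\<in>P. v i = v j0}"
  define N' where "N' = {i\<in>N. v i \<noteq> v j0}"
  have N': "\<delta> * r / 2 \<le> real (card N')" using v[of "v j0"] j0(2) by (simp add: a_def N'_def)
  have "card P = card P' + card {i\<in>P. v i \<noteq> v j0}"
    using P by (subst card_Un_disjoint[symmetric]) (auto simp: P'_def intro: arg_cong[where f = card])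
  moreover have "\<delta> * r / 2 \<le> \<epsilon> / 4 * r / 2" using \<epsilon> r by (intro divide_right_mono mult_right_mono) auto
  ultimately have P': "\<epsilon> * r / 8 \<le> real (card P')" using card(1) j0(2) by (simp add: a_def)
  have "(\<epsilon> * r / 8) * (\<delta> * r / 2) \<le> real (card P') * real (card N')"
    using P' N' \<epsilon> r by (intro mult_mono) auto
  also have "\<dots> = real (card (P' \<times> N'))" by (simp add: card_cartesian_product)
  also have "\<dots> \<le> real (card {(i, j) \<in> P \<times> N. v i \<noteq> v j})"
  proof (intro of_nat_mono card_mono)
    show "finite {(i, j) \<in> P \<times> N. v i \<noteq> v j}" by (rule finite_subset[of _ "P \<times> N"]) (use P in auto)
  qed (auto simp: P'_def N'_def)
  finally show False using neg by (simp add: power2_eq_square mult_ac)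
qed

lemma spread_small_ball_finite:
  assumes \<epsilon>: "0 < \<epsilon>" "\<epsilon> \<le> 1" "0 < \<delta>" "\<delta> \<le> \<epsilon> / 4" and s: "real_of_int \<bar>s\<bar> \<le> (1 - \<epsilon>) * real n" and n: "2 \<le> \<epsilon> * real n" "(2 * m) ^ 2 \<le> n"
    and R: "0 < R" and v: "\<And>\<beta>. \<delta> * real n \<le> real (card {i\<in>{..<n}. v i \<noteq> \<beta>})"
  shows "atoms_le (\<lambda>x. ip n x v) (sign_set n s) (2 * (1 / real R + (1 - (\<epsilon> * \<delta> / 64) / real R ^ 2) ^ m * (2 * real R)))"
proof (rule swap_bound)
  have n0: "0 < n" using n \<epsilon> by (intro Nat.gr0I) auto
  then show "0 < n" .
  have "\<epsilon> * \<delta> \<le> 1 * 1" using \<epsilon> by (intro mult_mono) auto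
  then have c1: "0 \<le> \<epsilon> * \<delta> / 64" "\<epsilon> * \<delta> / 64 \<le> 1" using \<epsilon> by auto
  have "1 \<le> real R ^ 2" using R by (simp add: one_le_power)
  then have "\<epsilon> * \<delta> / 64 \<le> 1 * real R ^ 2" using c1 by linarith
  then have "(\<epsilon> * \<delta> / 64) / real R ^ 2 \<le> 1" using R by (subst pos_divide_le_eq) auto
  then show "0 \<le> 1 / real R + (1 - (\<epsilon> * \<delta> / 64) / real R ^ 2) ^ m * (2 * real R)" by simp
  fix x assume x: "x \<in> sign_set n s"
  let ?\<Omega> = "{..<n} \<times> {..<n} \<times> (UNIV :: bool set)"
  let ?w = "swap_step v x"
  define P where "P = {j\<in>{..<n}. x j = 1}"
  define N where "N = {j\<in>{..<n}. x j = -1}"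
  have fPN: "finite P" "finite N" by (auto simp: P_def N_def)
  have PN: "P \<union> N = {..<n}" "P \<inter> N = {}" using x by (fastforce simp: P_def N_def sign_set_iff sign_vec_def)+
  have "\<epsilon> * \<delta> / 16 * real n ^ 2 \<le> real (card {(i, j) \<in> P \<times> N. v i \<noteq> v j})"
  proof (rule discordant_pairs[OF fPN])
    show "\<epsilon> * real n / 4 \<le> real (card P)" "\<epsilon> * real n / 4 \<le> real (card N)"
      using card_sign_ge[OF x _ s n(1), of 1] card_sign_ge[OF x _ s n(1), of "-1"] by (auto simp: P_def N_def)
    fix \<beta>
    have "{i\<in>{..<n}. v i \<noteq> \<beta>} = {i\<in>P. v i \<noteq> \<beta>} \<union> {i\<in>N. v i \<noteq> \<beta>}" using PN by auto
    moreover have "card ({i\<in>P. v i \<noteq> \<beta>} \<union> {i\<in>N. v i \<noteq> \<beta>}) = card {i\<in>P. v i \<noteq> \<beta>} + card {i\<in>N. v i \<noteq> \<beta>}"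
      using PN fPN by (intro card_Un_disjoint) auto
    ultimately show "\<delta> * real n \<le> real (card {i\<in>P. v i \<noteq> \<beta>}) + real (card {i\<in>N. v i \<noteq> \<beta>})"
      using v[of \<beta>] by simp
  qed (use \<epsilon> n0 in auto)
  also have "card {(i, j) \<in> P \<times> N. v i \<noteq> v j} \<le> card {\<omega>\<in>?\<Omega>. ?w \<omega> \<noteq> 0}"
  proof (rule card_inj_on_le[of "\<lambda>(i, j). (i, j, True)"])
    show "(\<lambda>(i, j). (i, j, True)) ` {(i, j) \<in> P \<times> N. v i \<noteq> v j} \<subseteq> {\<omega>\<in>?\<Omega>. ?w \<omega> \<noteq> 0}"
      by (auto simp: swap_step_def P_def N_def)
  qed (auto simp: inj_on_def)
  finally have nz: "\<epsilon> * \<delta> / 16 * real n ^ 2 \<le> real (card {\<omega>\<in>?\<Omega>. ?w \<omega> \<noteq> 0})" by simp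
  have "card ({..<n} \<times> {..<n}) \<le> card {\<omega>\<in>?\<Omega>. ?w \<omega> = 0}"
  proof (rule card_inj_on_le[of "\<lambda>(i, j). (i, j, False)"])
  qed (auto simp: inj_on_def swap_step_def)
  then have "n ^ 2 \<le> card {\<omega>\<in>?\<Omega>. ?w \<omega> = 0}" by (simp add: power2_eq_square)
  then have z: "real n ^ 2 \<le> real (card {\<omega>\<in>?\<Omega>. ?w \<omega> = 0})" by (simp only: of_nat_power[symmetric] of_nat_le_iff)
  \<comment> \<open>There are \<open>2 * n^2\<close> triples, so at least
    \<open>\<epsilon> * \<delta> / 16 * n^2\<close> nonzero steps paired with at least
    \<open>n^2\<close> zero steps form a proportion \<open>\<epsilon> * \<delta> / 64\<close> of all
    pairs.\<close>
  have "\<epsilon> * \<delta> / 64 * real (card ?\<Omega>) ^ 2 = (\<epsilon> * \<delta> / 16 * real n ^ 2) * real n ^ 2"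
    by (simp add: card_UNIV_bool power2_eq_square)
  also have "\<dots> \<le> real (card {\<omega>\<in>?\<Omega>. ?w \<omega> \<noteq> 0}) * real (card {\<omega>\<in>?\<Omega>. ?w \<omega> = 0})"
    using nz z by (intro mult_mono) auto
  also have "\<dots> = real (card ({\<omega>\<in>?\<Omega>. ?w \<omega> \<noteq> 0} \<times> {\<omega>\<in>?\<Omega>. ?w \<omega> = 0}))" by (simp only: card_cartesian_product of_nat_mult)
  also have "\<dots> \<le> real (card {(a, b) \<in> ?\<Omega> \<times> ?\<Omega>. ?w a \<noteq> ?w b})"
  proof (intro of_nat_mono card_mono)
    show "finite {(a, b) \<in> ?\<Omega> \<times> ?\<Omega>. ?w a \<noteq> ?w b}" by (rule finite_subset[of _ "?\<Omega> \<times> ?\<Omega>"]) auto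
  qed auto
  finally show "atoms_le (vsum ?w) (tuples m ?\<Omega>) (1 / real R + (1 - (\<epsilon> * \<delta> / 64) / real R ^ 2) ^ m * (2 * real R))"
    using n0 c1 R by (intro small_ball_walk_atom) auto
qed (use n in auto)

lemma spread_small_ball:
  fixes \<epsilon> \<delta> c1 :: real
  assumes \<epsilon>: "0 < \<epsilon>" "\<epsilon> \<le> 1" "0 < \<delta>" "\<delta> \<le> \<epsilon> / 4" and c1: "0 < c1"
  obtains n0 where "\<And>n s v. n0 \<le> n \<Longrightarrow> real_of_int \<bar>s\<bar> \<le> (1 - \<epsilon>) * real n \<Longrightarrow>
      (\<And>\<beta>. \<delta> * real n \<le> real (card {i\<in>{..<n}. v i \<noteq> \<beta>})) \<Longrightarrow> atoms_le (\<lambda>x. ip n x v) (sign_set n s) c1"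
proof -
  obtain R :: nat where R: "4 / c1 < real R" using reals_Archimedean2 by blast
  have R0: "0 < R" using R c1 by (intro Nat.gr0I) (auto simp: divide_less_eq)
  have R1: "1 / real R \<le> c1 / 4" using R R0 c1 by (simp add: field_simps)
  define l where "l = 1 - (\<epsilon> * \<delta> / 64) / real R ^ 2"
  have "\<epsilon> * \<delta> \<le> 1 * 1" using \<epsilon> by (intro mult_mono) auto
  moreover have "1 \<le> real R ^ 2" using R0 by (simp add: one_le_power)
  ultimately have "\<epsilon> * \<delta> / 64 \<le> 1 * real R ^ 2" by linarith
  then have "(\<epsilon> * \<delta> / 64) / real R ^ 2 \<le> 1" using R0 by (subst pos_divide_le_eq) auto
  then have l: "0 \<le> l" "l < 1" using \<epsilon> R0 by (auto simp: l_def)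
  have "(\<lambda>m. l ^ m * (2 * real R)) \<longlonglongrightarrow> 0 * (2 * real R)"
    using l by (intro tendsto_mult LIMSEQ_power_zero tendsto_const) auto
  then have "eventually (\<lambda>m. l ^ m * (2 * real R) < c1 / 4) sequentially"
    using c1 by (intro order_tendstoD) auto
  then obtain m where m: "l ^ m * (2 * real R) < c1 / 4" by (auto simp: eventually_sequentially)
  show thesis
  proof (rule that[of "max ((2 * m) ^ 2) (nat \<lceil>2 / \<epsilon>\<rceil>)"])
    fix n s and v :: "nat \<Rightarrow> complex"
    assume n: "max ((2 * m) ^ 2) (nat \<lceil>2 / \<epsilon>\<rceil>) \<le> n" and s: "real_of_int \<bar>s\<bar> \<le> (1 - \<epsilon>) * real n"
      and v: "\<And>\<beta>. \<delta> * real n \<le> real (card {i\<in>{..<n}. v i \<noteq> \<beta>})"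
    have "2 / \<epsilon> \<le> real n" using n by linarith
    then have "2 \<le> \<epsilon> * real n" using \<epsilon> by (simp add: field_simps)
    then have at: "atoms_le (\<lambda>x. ip n x v) (sign_set n s) (2 * (1 / real R + l ^ m * (2 * real R)))"
      unfolding l_def using n by (intro spread_small_ball_finite \<epsilon> s R0 v) auto
    have "2 * (1 / real R + l ^ m * (2 * real R)) \<le> c1" using m R1 by simp
    then show "atoms_le (\<lambda>x. ip n x v) (sign_set n s) c1"
      using at unfolding atoms_le_def by (meson mult_right_mono of_nat_0_le_iff order.trans)
  qed
qed

text \<open>
  Flipping coordinate \<open>i\<close> exchanges the two admissible row sums on a positive proportion of the sign
  set; it is here that both sums \<open>s - 1\<close> and \<open>s + 1\<close> are needed, as \<open>v\<close> may be constant.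
\<close>

lemma nonzero_atom_bound:
  assumes \<epsilon>: "0 < \<epsilon>" "\<epsilon> \<le> 1" and s: "real_of_int \<bar>s\<bar> \<le> (1 - \<epsilon>) * real n" and n: "2 \<le> \<epsilon> * real n"
    and i: "i < n" "v i \<noteq> 0"
  shows "atoms_le (\<lambda>x. ip n x v) (sign_set n s) (1 - \<epsilon> / 8)"
  unfolding atoms_le_def
proof
  fix a
  let ?S = "sign_set n s"
  define U where "U k = {x \<in> ?S. (sum x {..<n} = s - 1 \<and> x k = -1) \<or> (sum x {..<n} = s + 1 \<and> x k = 1)}" for k
  have fU: "finite (U k)" for k by (simp add: U_def)
  have cU: "card (U k) = card (U i)" if "k < n" for k
  proof (cases "k = i")
    case False
    have into: "x(p := x q, q := x p) \<in> U p" if "x \<in> U q" "p < n" "q < n" "p \<noteq> q" for x p q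
    proof -
      have "(x(p := x q, q := x p)) p = x q" using that by simp
      then show ?thesis
        using that sign_set_swap[OF that(2-4), of x s] sum_swap_coords[OF that(2-4), of x]
        unfolding U_def by (simp del: fun_upd_apply)
    qed
    have "bij_betw (\<lambda>x. x(i := x k, k := x i)) (U k) (U i)"
    proof (rule bij_betw_byWitness[where f' = "\<lambda>x. x(k := x i, i := x k)"])
      show "(\<lambda>x. x(i := x k, k := x i)) ` U k \<subseteq> U i" using into[of _ k i] that i False by blast
      show "(\<lambda>x. x(k := x i, i := x k)) ` U i \<subseteq> U k" using into[of _ i k] that i False by blast
    qed (use False in auto)
    then show ?thesis by (rule bij_betw_same_card)
  qed simp
  \<comment> \<open>By exchangeability \<open>card (U i)\<close> is the average over
    \<open>k\<close>, and for fixed \<open>x\<close> the admissible \<open>k\<close> are the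
    positions of one sign, counted by \<open>card_sign_ge\<close>.\<close>
  have "real n * real (card (U i)) = (\<Sum>k<n. real (card (U k)))" using cU by simp
  also have "\<dots> = (\<Sum>x\<in>?S. real (card {k\<in>{..<n}. (sum x {..<n} = s - 1 \<and> x k = -1) \<or> (sum x {..<n} = s + 1 \<and> x k = 1)}))"
  proof -
    have "(\<Sum>k<n. card (U k)) = (\<Sum>x\<in>?S. card {k\<in>{..<n}. (sum x {..<n} = s - 1 \<and> x k = -1) \<or> (sum x {..<n} = s + 1 \<and> x k = 1)})"
      using card_pairs_eq_sum[of "{..<n}" ?S "\<lambda>k x. (sum x {..<n} = s - 1 \<and> x k = -1) \<or> (sum x {..<n} = s + 1 \<and> x k = 1)"]
        card_pairs_eq_sum'[of "{..<n}" ?S "\<lambda>k x. (sum x {..<n} = s - 1 \<and> x k = -1) \<or> (sum x {..<n} = s + 1 \<and> x k = 1)"]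
      by (simp add: U_def)
    then show ?thesis by (simp only: of_nat_sum[symmetric])
  qed
  also have "\<dots> \<ge> (\<Sum>x\<in>?S. \<epsilon> * real n / 4)"
  proof (intro sum_mono)
    fix x assume x: "x \<in> ?S"
    have fin: "finite {k\<in>{..<n}. (sum x {..<n} = s - 1 \<and> x k = -1) \<or> (sum x {..<n} = s + 1 \<and> x k = 1)}" by simp
    from x consider "sum x {..<n} = s - 1" | "sum x {..<n} = s + 1" by (auto simp: sign_set_iff)
    then show "\<epsilon> * real n / 4 \<le> real (card {k\<in>{..<n}. (sum x {..<n} = s - 1 \<and> x k = -1) \<or> (sum x {..<n} = s + 1 \<and> x k = 1)})"
      by cases (use card_sign_ge[OF x _ s n, of 1] card_sign_ge[OF x _ s n, of "-1"] in auto)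
  qed
  finally have "real n * (\<epsilon> / 4 * real (card ?S)) \<le> real n * real (card (U i))" by (simp add: mult_ac)
  then have Ui: "\<epsilon> / 4 * real (card ?S) \<le> real (card (U i))" using i by simp
  define V where "V = {x \<in> U i. ip n x v = a}"
  \<comment> \<open>A flip at \<open>i\<close> changes the inner product by a nonzero multiple of
    \<open>v i\<close>, so it moves \<open>V\<close> off itself inside \<open>U i\<close>.\<close>
  have "2 * card V \<le> card (U i)"
  proof -
    let ?f = "\<lambda>x. x(i := - x i)"
    have ipf: "ip n (?f x) v = ip n x v - 2 * of_int (x i) * v i" for x
      unfolding ip_def using i(1) by (simp add: sum.remove[of "{..<n}" i])
    have sumf: "sum (?f x) {..<n} = sum x {..<n} - 2 * x i" for x :: "nat \<Rightarrow> int"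
      using i(1) by (simp add: sum.remove[of "{..<n}" i])
    have "?f x \<in> U i" if "x \<in> U i" for x
      using that i(1) sumf[of x] by (auto simp: U_def sign_set_iff sign_vec_def)
    then have sub: "?f ` V \<subseteq> U i" by (auto simp: V_def)
    have disj: "?f ` V \<inter> V = {}"
    proof -
      have False if "y \<in> V" "?f y \<in> V" for y
      proof -
        have "of_int (y i) * v i = 0" using that ipf[of y] unfolding V_def by simp
        moreover have "y i \<noteq> 0" using that(1) by (auto simp: V_def U_def)
        ultimately show False using i(2) by simp
      qed
      then show ?thesis by blast
    qed
    have "inj_on ?f V" by (rule inj_on_inverseI[where g = ?f]) simp
    then have "2 * card V = card (?f ` V) + card V" by (simp add: card_image)
    also have "\<dots> = card (?f ` V \<union> V)" using disj fU by (intro card_Un_disjoint[symmetric]) (auto simp: V_def)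
    also have "\<dots> \<le> card (U i)" using sub by (intro card_mono fU) (auto simp: V_def)
    finally show ?thesis .
  qed
  moreover have "card {x\<in>?S. ip n x v = a} \<le> card V + card (?S - U i)"
    by (rule order.trans[OF card_mono card_Un_le]) (auto simp: V_def U_def)
  moreover have "card (?S - U i) = card ?S - card (U i)" "card (U i) \<le> card ?S"
    by (auto simp: U_def intro!: card_Diff_subset card_mono)
  ultimately have "real (card {x\<in>?S. ip n x v = a}) \<le> real (card ?S) - real (card (U i)) / 2" by linarith
  then show "real (card {x\<in>?S. ip n x v = a}) \<le> (1 - \<epsilon> / 8) * real (card ?S)" using Ui by (simp add: algebra_simps)
qed

subsection \<open>Exposing the rows\<close>

lemma prob_bind_le:
  assumes "\<And>x. x \<in> A \<Longrightarrow> measure_pmf.prob (f x) E \<le> c1" "\<And>x. x \<notin> A \<Longrightarrow> measure_pmf.prob (f x) E \<le> c2" "0 \<le> c1" "0 \<le> c2"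
  shows "measure_pmf.prob (bind_pmf p f) E \<le> c1 * measure_pmf.prob p A + c2"
proof -
  have "emeasure (measure_pmf (bind_pmf p f)) E = (\<integral>\<^sup>+x. emeasure (measure_pmf (f x)) E \<partial>measure_pmf p)" by simp
  also have "\<dots> \<le> (\<integral>\<^sup>+x. ennreal c1 * indicator A x + ennreal c2 \<partial>measure_pmf p)"
  proof (intro nn_integral_mono)
    fix x
    show "emeasure (measure_pmf (f x)) E \<le> ennreal c1 * indicator A x + ennreal c2"
    proof (cases "x \<in> A")
      case True
      then have "emeasure (measure_pmf (f x)) E \<le> ennreal c1" using assms(1)
        by (simp add: measure_pmf.emeasure_eq_measure ennreal_leI)
      then show ?thesis using True by (simp add: add_increasing2)
    next
      case False
      then show ?thesis using assms(2) by (simp add: measure_pmf.emeasure_eq_measure ennreal_leI)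
    qed
  qed
  also have "\<dots> = ennreal c1 * emeasure (measure_pmf p) A + ennreal c2"
    by (subst nn_integral_add) (auto simp: nn_integral_cmult_indicator)
  also have "\<dots> = ennreal (c1 * measure_pmf.prob p A + c2)"
    using assms by (simp add: measure_pmf.emeasure_eq_measure ennreal_mult ennreal_plus)
  finally have "ennreal (measure_pmf.prob (bind_pmf p f) E) \<le> ennreal (c1 * measure_pmf.prob p A + c2)"
    by (simp only: measure_pmf.emeasure_eq_measure)
  then show ?thesis by (subst (asm) ennreal_le_iff) (use assms in auto)
qed

text \<open>Markov's inequality for the number of \<open>z\<close> whose event occurs.\<close>

lemma prob_double_count:
  assumes "finite Z" and "\<And>X. X \<in> E \<Longrightarrow> c \<le> real (card {z\<in>Z. X \<in> Ez z})" 
  shows "c * measure_pmf.prob p E \<le> (\<Sum>z\<in>Z. measure_pmf.prob p (Ez z))"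
proof -
  have int: "integrable (measure_pmf p) (indicator A :: _ \<Rightarrow> real)" for A
    by (rule measure_pmf.integrable_const_bound[where B = 1]) (auto simp: indicator_def)
  have "c * measure_pmf.prob p E = measure_pmf.expectation p (\<lambda>X. c * indicator E X)" by simp
  also have "\<dots> \<le> measure_pmf.expectation p (\<lambda>X. \<Sum>z\<in>Z. indicator (Ez z) X)"
  proof (rule integral_mono)
    fix X
    have "(\<Sum>z\<in>Z. indicator (Ez z) X) = real (card {z\<in>Z. X \<in> Ez z})"
      using assms(1) by (simp add: indicator_def sum.If_cases Int_def)
    then show "c * indicator E X \<le> (\<Sum>z\<in>Z. indicator (Ez z) X :: real)"
      using assms(2)[of X] by (auto simp: indicator_def)
  qed (use int in auto)
  also have "\<dots> = (\<Sum>z\<in>Z. measure_pmf.prob p (Ez z))"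
    using int by (subst Bochner_Integration.integral_sum) auto
  finally show ?thesis .
qed

definition form :: "nat \<Rightarrow> (nat \<Rightarrow> complex) \<Rightarrow> (nat \<Rightarrow> int) \<Rightarrow> (nat \<Rightarrow> complex) \<Rightarrow> complex" where
  "form n f x v = (\<Sum>j<n. (of_int (x j) + f j) * v j)"

text \<open>The deterministic row only translates the atom, so bounds uniform over all atoms of
  \<open>ip\<close> pass to \<open>form\<close>.\<close>

lemma form_eq: "form n f x v = ip n x v + (\<Sum>j<n. f j * v j)"
  by (simp add: form_def ip_def algebra_simps sum.distrib)

text \<open>Dimension is tracked only through an upper bound, the number of generators, which may be
  dependent.\<close>

definition spanned :: "nat \<Rightarrow> (nat \<Rightarrow> nat \<Rightarrow> complex) \<Rightarrow> nat set \<Rightarrow> (nat \<Rightarrow> complex) set" where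
  "spanned n b I = {v. \<exists>z. \<forall>j<n. v j = (\<Sum>k\<in>I. z k * b k j)}"

text \<open>One step of Gaussian elimination: a generator on which the functional is nonzero
  corrects all the others and is dropped.\<close>

lemma spanned_hyperplane:
  assumes V: "V \<subseteq> spanned n b I" and I: "finite I" and v0: "v0 \<in> V" "(\<Sum>j<n. y j * v0 j) \<noteq> 0"
  obtains k b' where "k \<in> I" "{v \<in> V. (\<Sum>j<n. y j * v j) = 0} \<subseteq> spanned n b' (I - {k})"
proof -
  define p where "p k = (\<Sum>j<n. y j * b k j)" for k
  have lin: "(\<Sum>j<n. y j * v j) = (\<Sum>k\<in>I. z k * p k)" if "\<forall>j<n. v j = (\<Sum>k\<in>I. z k * b k j)" for v z
  proof -
    have "(\<Sum>j<n. y j * v j) = (\<Sum>j<n. \<Sum>k\<in>I. z k * (y j * b k j))"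
      using that by (intro sum.cong) (auto simp: sum_distrib_left mult_ac)
    also have "\<dots> = (\<Sum>k\<in>I. \<Sum>j<n. z k * (y j * b k j))" by (rule sum.swap)
    finally show ?thesis by (simp add: p_def sum_distrib_left)
  qed
  obtain z0 where "\<forall>j<n. v0 j = (\<Sum>k\<in>I. z0 k * b k j)" using V v0 by (auto simp: spanned_def)
  from lin[OF this] have "(\<Sum>k\<in>I. z0 k * p k) \<noteq> 0" using v0 by simp
  then obtain k where "k \<in> I" "z0 k * p k \<noteq> 0" by (rule sum.not_neutral_contains_not_neutral)
  then have k: "k \<in> I" "p k \<noteq> 0" by auto
  define b' where "b' l j = b l j - p l / p k * b k j" for l j
  have "{v \<in> V. (\<Sum>j<n. y j * v j) = 0} \<subseteq> spanned n b' (I - {k})"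
  proof clarify
    fix v assume v: "v \<in> V" "(\<Sum>j<n. y j * v j) = 0"
    then obtain z where z: "\<forall>j<n. v j = (\<Sum>k\<in>I. z k * b k j)" using V by (auto simp: spanned_def)
    have "(\<Sum>l\<in>I. z l * p l) = 0" using lin[OF z] v by simp
    then have zk: "z k * p k = - (\<Sum>l\<in>I-{k}. z l * p l)" using I k by (simp add: sum.remove add_eq_0_iff2)
    have "v j = (\<Sum>l\<in>I-{k}. z l * b' l j)" if "j < n" for j
    proof -
      have "(\<Sum>l\<in>I-{k}. z l * b' l j) = (\<Sum>l\<in>I-{k}. z l * b l j) - (\<Sum>l\<in>I-{k}. z l * p l) / p k * b k j"
        by (simp add: b'_def algebra_simps sum_subtractf sum_distrib_left sum_divide_distrib)
      also have "(\<Sum>l\<in>I-{k}. z l * p l) = - (z k * p k)" using zk by simp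
      finally show ?thesis using z that I k by (simp add: sum.remove)
    qed
    then show "v \<in> spanned n b' (I - {k})" by (auto simp: spanned_def)
  qed
  with k that show thesis by blast
qed

definition kernel_event :: "nat \<Rightarrow> (nat \<Rightarrow> nat \<Rightarrow> complex) \<Rightarrow> nat set \<Rightarrow> (nat \<Rightarrow> complex) set \<Rightarrow> (nat \<Rightarrow> nat \<Rightarrow> int) set" where
  "kernel_event n F T V = {X. \<exists>v\<in>V. \<forall>i\<in>T. form n (F i) (X i) v = 0}"

text \<open>
  A new row either annihilates a fixed vector of \<open>V \<inter> B\<close>, which has probability at most \<open>\<rho>\<close>, or cuts
  the dimension of \<open>V\<close>, which gains the factor \<open>1 / \<mu>\<close>.
\<close>

lemma exposure_bound:
  assumes T: "finite T" and \<rho>: "0 \<le> \<rho>" and \<mu>1: "1 \<le> \<mu>"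
    and B: "\<And>v a. v \<in> B \<Longrightarrow> measure_pmf.prob p {x. ip n x v = a} \<le> \<rho>" "\<And>v. v \<in> B \<Longrightarrow> \<exists>j<n. v j \<noteq> 0"
    and I: "finite I" "V \<subseteq> spanned n b I"
  shows "measure_pmf.prob (Pi_pmf T undefined (\<lambda>_. p)) (kernel_event n F T (V \<inter> B)) \<le> (\<rho> + 1 / \<mu>) ^ card T * \<mu> ^ card I"
  using T I
proof (induction T arbitrary: I V b rule: finite_induct)
  case empty
  show ?case using order.trans[OF measure_pmf.prob_le_1 one_le_power[OF \<mu>1]]
    by (simp only: card.empty power_0 mult_1)
next
  case (insert i T)
  have \<mu>: "0 < \<mu>" using \<mu>1 by simp
  let ?Pi = "Pi_pmf T undefined (\<lambda>_. p)"
  let ?lam = "\<rho> + 1 / \<mu>"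
  have lam: "0 \<le> ?lam" using \<rho> \<mu> by simp
  show ?case
  proof (cases "V \<inter> B = {}")
    case True
    then show ?thesis using lam \<mu> by (simp add: kernel_event_def)
  next
    case False
    then obtain v0 where v0: "v0 \<in> V" "v0 \<in> B" by blast
    define W where "W x = {v \<in> V. form n (F i) x v = 0}" for x
    have eq: "(\<lambda>f. f(i := x)) -` kernel_event n F (insert i T) (V \<inter> B) = kernel_event n F T (W x \<inter> B)" for x
    proof (rule set_eqI)
      fix X
      have upd: "(X(i := x)) k = X k" if "k \<in> T" for k using that insert.hyps by auto
      have "(\<forall>k\<in>insert i T. form n (F k) ((X(i := x)) k) v = 0) \<longleftrightarrow> form n (F i) x v = 0 \<and> (\<forall>k\<in>T. form n (F k) (X k) v = 0)" for v
      proof -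
        have "(\<forall>k\<in>insert i T. form n (F k) ((X(i := x)) k) v = 0) \<longleftrightarrow>
            form n (F i) ((X(i := x)) i) v = 0 \<and> (\<forall>k\<in>T. form n (F k) ((X(i := x)) k) v = 0)" by blast
        also have "(\<forall>k\<in>T. form n (F k) ((X(i := x)) k) v = 0) \<longleftrightarrow> (\<forall>k\<in>T. form n (F k) (X k) v = 0)"
          by (intro ball_cong refl) (simp only: upd)
        finally show ?thesis by (simp only: fun_upd_same)
      qed
      then show "X \<in> (\<lambda>f. f(i := x)) -` kernel_event n F (insert i T) (V \<inter> B) \<longleftrightarrow> X \<in> kernel_event n F T (W x \<inter> B)"
        unfolding vimage_eq kernel_event_def mem_Collect_eq W_def by blast
    qed
    \<comment> \<open>Vectors of \<open>B\<close> are nonzero, so a generator is left; this keeps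
      \<open>card I - 1\<close> from truncating.\<close>
    have "I \<noteq> {}"
    proof
      assume "I = {}"
      then have "\<forall>j<n. v0 j = 0" using v0 insert.prems by (auto simp: spanned_def)
      then show False using B(2)[OF v0(2)] by auto
    qed
    then have cI: "card I > 0" using insert.prems by (simp add: card_gt_0_iff)
    define A where "A = {x. form n (F i) x v0 = 0}"
    have pA: "measure_pmf.prob p A \<le> \<rho>"
    proof -
      have "A = {x. ip n x v0 = - (\<Sum>j<n. F i j * v0 j)}" by (auto simp: A_def form_eq eq_neg_iff_add_eq_0)
      then show ?thesis using B(1)[OF v0(2)] by simp
    qed
    have "Pi_pmf (insert i T) undefined (\<lambda>_. p) = bind_pmf p (\<lambda>x. map_pmf (\<lambda>f. f(i := x)) ?Pi)"
      using insert.hyps by (subst Pi_pmf_insert') (auto simp: map_pmf_def)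
    then have "measure_pmf.prob (Pi_pmf (insert i T) undefined (\<lambda>_. p)) (kernel_event n F (insert i T) (V \<inter> B))
      = measure_pmf.prob (bind_pmf p (\<lambda>x. map_pmf (\<lambda>f. f(i := x)) ?Pi)) (kernel_event n F (insert i T) (V \<inter> B))" by simp
    also have "\<dots> \<le> ?lam ^ card T * \<mu> ^ card I * measure_pmf.prob p A + ?lam ^ card T * \<mu> ^ (card I - 1)"
    proof (rule prob_bind_le)
      fix x assume "x \<in> A"
      have "W x \<subseteq> spanned n b I" using insert.prems by (auto simp: W_def)
      then show "measure_pmf.prob (map_pmf (\<lambda>f. f(i := x)) ?Pi) (kernel_event n F (insert i T) (V \<inter> B)) \<le> ?lam ^ card T * \<mu> ^ card I"
        unfolding measure_map_pmf eq using insert.prems by (intro insert.IH)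
    next
      fix x assume "x \<notin> A"
      then have "(\<Sum>j<n. (of_int (x j) + F i j) * v0 j) \<noteq> 0" by (simp add: A_def form_def)
      from spanned_hyperplane[OF insert.prems(2,1) v0(1) this]
      obtain k b' where "k \<in> I" "{v \<in> V. (\<Sum>j<n. (of_int (x j) + F i j) * v j) = 0} \<subseteq> spanned n b' (I - {k})" .
      then have k: "k \<in> I" "W x \<subseteq> spanned n b' (I - {k})" by (simp_all add: W_def form_def)
      then have "measure_pmf.prob ?Pi (kernel_event n F T (W x \<inter> B)) \<le> ?lam ^ card T * \<mu> ^ card (I - {k})"
        using insert.prems by (intro insert.IH) auto
      then show "measure_pmf.prob (map_pmf (\<lambda>f. f(i := x)) ?Pi) (kernel_event n F (insert i T) (V \<inter> B)) \<le> ?lam ^ card T * \<mu> ^ (card I - 1)"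
        unfolding measure_map_pmf eq using k insert.prems by simp
    qed (use lam \<mu> in auto)
    also have "\<dots> \<le> ?lam ^ card T * \<mu> ^ card I * \<rho> + ?lam ^ card T * \<mu> ^ (card I - 1)"
      using pA lam \<mu> by (intro add_right_mono mult_left_mono) auto
    also have "?lam ^ card T * \<mu> ^ card I * \<rho> + ?lam ^ card T * \<mu> ^ (card I - 1) = ?lam ^ card T * (\<mu> ^ card I * (\<rho> + 1 / \<mu>))"
    proof -
      have "\<mu> ^ card I = \<mu> * \<mu> ^ (card I - 1)" using cI by (simp add: power_eq_if)
      then have "\<mu> ^ (card I - 1) = \<mu> ^ card I * (1 / \<mu>)" using \<mu> by simp
      then show ?thesis by (simp only: distrib_left mult.assoc)
    qed
    finally show ?thesis using insert.hyps by (simp add: mult_ac)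
  qed
qed

section \<open>Subspaces cut out by additive relations, and almost constant vectors\<close>

lemma vsum_count:
  assumes "set xs \<subseteq> S" "finite S"
  shows "vsum v xs = (\<Sum>j\<in>S. of_nat (count (mset xs) j) * v j)"
  using assms(1)
proof (induction xs)
  case (Cons a xs)
  have "(\<Sum>j\<in>S. of_nat (count (mset (a # xs)) j) * v j) = (\<Sum>j\<in>S. (if j = a then v j else 0) + of_nat (count (mset xs) j) * v j)"
    by (intro sum.cong) (auto simp: algebra_simps)
  then show ?case using Cons assms(2) by (simp add: sum.distrib)
qed simp

text \<open>Stronger than \<open>spanned\<close>: the coefficients are the coordinates of
  \<open>v\<close> on \<open>S\<close> itself. Relations are drawn among these coordinates, and a
  nontrivial one can be solved for one of them, so \<open>S\<close> loses exactly one element and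
  the next relation can be sought in the rest.\<close>

definition coordinates_determine :: "nat \<Rightarrow> (nat \<Rightarrow> complex) set \<Rightarrow> nat set \<Rightarrow> bool" where
  "coordinates_determine n V S \<longleftrightarrow> (\<exists>b. \<forall>v\<in>V. \<forall>j<n. v j = (\<Sum>k\<in>S. v k * b k j))"

lemma coordinates_determine_relation:
  assumes V: "coordinates_determine n V S" and S: "finite S" and xs: "set xs \<subseteq> S" "set ys \<subseteq> S" "mset xs \<noteq> mset ys"
  obtains i where "i \<in> S" "coordinates_determine n {v \<in> V. vsum v xs = vsum v ys} (S - {i})"
proof -
  obtain i where i: "count (mset xs) i \<noteq> count (mset ys) i" using xs(3) multiset_eq_iff by blast
  have iS: "i \<in> S"
  proof (rule ccontr)
    assume "i \<notin> S"
    then have "count (mset xs) i = 0" "count (mset ys) i = 0" using xs(1,2) by (auto simp: count_eq_zero_iff)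
    then show False using i by (simp only:)
  qed
  define c where "c j = (of_nat (count (mset xs) j) - of_nat (count (mset ys) j) :: complex)" for j
  have ci: "c i \<noteq> 0" using i by (simp add: c_def)
  obtain b where b: "\<And>v j. v \<in> V \<Longrightarrow> j < n \<Longrightarrow> v j = (\<Sum>k\<in>S. v k * b k j)" using V by (auto simp: coordinates_determine_def)
  define b' where "b' k j = b k j - c k / c i * b i j" for k j
  have "v j = (\<Sum>k\<in>S-{i}. v k * b' k j)" if v: "v \<in> V" "vsum v xs = vsum v ys" and j: "j < n" for v j
  proof -
    have "(\<Sum>k\<in>S. c k * v k) = 0"
      using v(2) vsum_count[OF xs(1) S, of v] vsum_count[OF xs(2) S, of v] by (simp add: c_def algebra_simps sum_subtractf)
    then have vi: "c i * v i = - (\<Sum>k\<in>S-{i}. c k * v k)" using S iS by (simp add: sum.remove add_eq_0_iff2)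
    have "(\<Sum>k\<in>S-{i}. v k * b' k j) = (\<Sum>k\<in>S-{i}. v k * b k j) - (\<Sum>k\<in>S-{i}. c k * v k) / c i * b i j"
      by (simp add: b'_def algebra_simps sum_subtractf sum_distrib_left sum_divide_distrib)
    also have "(\<Sum>k\<in>S-{i}. c k * v k) = - (c i * v i)" using vi by simp
    finally show ?thesis using b[OF v(1) j] ci S iS by (simp add: sum.remove)
  qed
  then have "coordinates_determine n {v \<in> V. vsum v xs = vsum v ys} (S - {i})" unfolding coordinates_determine_def by blast
  with iS that show thesis by blast
qed

text \<open>
  Each \<open>v\<close> satisfies at least a proportion \<open>\<eta>\<close> of the candidate relations, so that the probability for
  \<open>V\<close> is at most \<open>1 / \<eta>\<close> times the average of those for the subspaces cut out by one relation.
\<close>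

lemma relation_steps:
  fixes \<rho> \<mu> \<eta> :: real
  assumes T: "finite T" and \<rho>: "0 \<le> \<rho>" and \<mu>: "1 \<le> \<mu>" and \<eta>: "0 < \<eta>"
    and B: "\<And>v a. v \<in> B \<Longrightarrow> measure_pmf.prob p {x. ip n x v = a} \<le> \<rho>" "\<And>v. v \<in> B \<Longrightarrow> \<exists>j<n. v j \<noteq> 0"
    and rel: "\<And>v S. v \<in> B \<Longrightarrow> S \<subseteq> {..<n} \<Longrightarrow> s0 < card S \<Longrightarrow> \<eta> * real (card S) ^ (2 * K) \<le>
        real (card {(xs, ys) \<in> tuples K S \<times> tuples K S. mset xs \<noteq> mset ys \<and> vsum v xs = vsum v ys})"
    and S: "S \<subseteq> {..<n}" "card S = s0 + d" and V: "coordinates_determine n V S"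
  shows "measure_pmf.prob (Pi_pmf T undefined (\<lambda>_. p)) (kernel_event n F T (V \<inter> B))
    \<le> (1 / \<eta>) ^ d * ((\<rho> + 1 / \<mu>) ^ card T * \<mu> ^ s0)"
  using S V
proof (induction d arbitrary: S V)
  case 0
  then obtain b where b: "\<forall>v\<in>V. \<forall>j<n. v j = (\<Sum>k\<in>S. v k * b k j)" by (auto simp: coordinates_determine_def)
  have "V \<subseteq> spanned n b S" unfolding spanned_def using b by blast
  moreover have "finite S" using 0 finite_subset by blast
  ultimately have "measure_pmf.prob (Pi_pmf T undefined (\<lambda>_. p)) (kernel_event n F T (V \<inter> B)) \<le> (\<rho> + 1 / \<mu>) ^ card T * \<mu> ^ card S"
    using \<mu> by (intro exposure_bound T \<rho> B) auto
  then show ?case using 0 by simp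
next
  case (Suc d)
  let ?Pi = "Pi_pmf T undefined (\<lambda>_. p)"
  let ?M = "(1 / \<eta>) ^ d * ((\<rho> + 1 / \<mu>) ^ card T * \<mu> ^ s0)"
  have M: "0 \<le> ?M" using \<rho> \<mu> \<eta> by simp
  have fS: "finite S" using Suc finite_subset by blast
  have cS: "real (card S) > 0" using Suc.prems by simp
  define Z where "Z = {(xs, ys) \<in> tuples K S \<times> tuples K S. mset xs \<noteq> mset ys}"
  have Zsub: "Z \<subseteq> tuples K S \<times> tuples K S" by (auto simp: Z_def)
  have fZ: "finite Z" using finite_subset[OF Zsub] fS by simp
  have cZ: "real (card Z) \<le> real (card S) ^ (2 * K)"
  proof -
    have "card Z \<le> card (tuples K S \<times> tuples K S)" using fS by (intro card_mono Zsub) simp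
    also have "\<dots> = card S ^ (2 * K)" using fS by (simp add: card_tuples card_cartesian_product mult_2 power_add)
    finally show ?thesis by (simp only: of_nat_power[symmetric] of_nat_le_iff)
  qed
  define Ez where "Ez z = kernel_event n F T ({v \<in> V. vsum v (fst z) = vsum v (snd z)} \<inter> B)" for z
  have IH: "measure_pmf.prob ?Pi (Ez z) \<le> ?M" if "z \<in> Z" for z
  proof -
    have z: "set (fst z) \<subseteq> S" "set (snd z) \<subseteq> S" "mset (fst z) \<noteq> mset (snd z)" using that by (auto simp: Z_def tuples_def)
    obtain i where i: "i \<in> S" "coordinates_determine n {v \<in> V. vsum v (fst z) = vsum v (snd z)} (S - {i})"
      using coordinates_determine_relation[OF Suc.prems(3) fS z] .
    have "card (S - {i}) = s0 + d" "S - {i} \<subseteq> {..<n}" using i Suc.prems fS by auto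
    then show ?thesis unfolding Ez_def using Suc.IH i by blast
  qed
  have "\<eta> * real (card S) ^ (2 * K) * measure_pmf.prob ?Pi (kernel_event n F T (V \<inter> B)) \<le> (\<Sum>z\<in>Z. measure_pmf.prob ?Pi (Ez z))"
  proof (rule prob_double_count[OF fZ])
    fix X assume "X \<in> kernel_event n F T (V \<inter> B)"
    then obtain v where v: "v \<in> V" "v \<in> B" "\<forall>i\<in>T. form n (F i) (X i) v = 0" by (auto simp: kernel_event_def)
    have "\<eta> * real (card S) ^ (2 * K) \<le> real (card {(xs, ys) \<in> tuples K S \<times> tuples K S. mset xs \<noteq> mset ys \<and> vsum v xs = vsum v ys})"
      using Suc.prems by (intro rel v) auto
    also have "\<dots> \<le> real (card {z \<in> Z. X \<in> Ez z})"
      using v fZ by (intro of_nat_mono card_mono) (auto simp: Z_def Ez_def kernel_event_def)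
    finally show "\<eta> * real (card S) ^ (2 * K) \<le> real (card {z \<in> Z. X \<in> Ez z})" .
  qed
  also have "\<dots> \<le> real (card Z) * ?M" using sum_mono[of Z, OF IH] by simp
  also have "\<dots> \<le> real (card S) ^ (2 * K) * ?M" using cZ M by (intro mult_right_mono)
  finally have "real (card S) ^ (2 * K) * (\<eta> * measure_pmf.prob ?Pi (kernel_event n F T (V \<inter> B))) \<le> real (card S) ^ (2 * K) * ?M"
    by (simp only: mult_ac)
  then have "\<eta> * measure_pmf.prob ?Pi (kernel_event n F T (V \<inter> B)) \<le> ?M" using cS by (simp add: zero_less_power)
  then show ?case using \<eta> by (simp add: field_simps)
qed

lemma sum_Pow_power: "finite A \<Longrightarrow> (\<Sum>D\<in>Pow A. (x::real) ^ card D) = (1 + x) ^ card A"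
  using prod_add[of A "\<lambda>_. x" "\<lambda>_. 1"] by (simp add: add.commute)

text \<open>Union bound over the exceptional set \<open>D\<close>, whose vectors have
  \<open>card D + 1\<close> generators. The weight \<open>\<alpha> ^ card D\<close> stands in for
  binomial estimates: \<open>\<mu> ^ card D\<close> is at most
  \<open>(\<mu> / \<alpha>) ^ e * \<alpha> ^ card D\<close>, and the weights of all subsets add up
  to \<open>(1 + \<alpha>) ^ n\<close>.\<close>

lemma almost_constant_bound:
  fixes \<rho> \<mu> \<alpha> :: real
  assumes T: "finite T" and \<rho>: "0 \<le> \<rho>" and \<mu>: "1 \<le> \<mu>" and \<alpha>: "0 < \<alpha>" "\<alpha> \<le> 1"
    and B: "\<And>v a. v \<in> B \<Longrightarrow> measure_pmf.prob p {x. ip n x v = a} \<le> \<rho>" "\<And>v. v \<in> B \<Longrightarrow> \<exists>j<n. v j \<noteq> 0"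
    and Bc: "\<And>v. v \<in> B \<Longrightarrow> \<exists>\<beta>. card {i\<in>{..<n}. v i \<noteq> \<beta>} \<le> e"
  shows "measure_pmf.prob (Pi_pmf T undefined (\<lambda>_. p)) (kernel_event n F T B)
    \<le> (\<rho> + 1 / \<mu>) ^ card T * \<mu> * ((\<mu> / \<alpha>) ^ e * (1 + \<alpha>) ^ n)"
proof -
  let ?Pi = "Pi_pmf T undefined (\<lambda>_. p)"
  let ?lam = "\<rho> + 1 / \<mu>"
  have lam: "0 \<le> ?lam" using \<rho> \<mu> by simp
  define \<D> where "\<D> = {D \<in> Pow {..<n}. card D \<le> e}"
  define VD where "VD D = {v :: nat \<Rightarrow> complex. \<exists>\<beta>. \<forall>i<n. i \<notin> D \<longrightarrow> v i = \<beta>}" for D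
  have f\<D>: "finite \<D>" by (simp add: \<D>_def)
  have "measure_pmf.prob ?Pi (kernel_event n F T B) \<le> measure_pmf.prob ?Pi (\<Union>D\<in>\<D>. kernel_event n F T (VD D \<inter> B))"
  proof (intro measure_pmf.finite_measure_mono subsetI)
    fix X assume "X \<in> kernel_event n F T B"
    then obtain v where v: "v \<in> B" "\<forall>i\<in>T. form n (F i) (X i) v = 0" by (auto simp: kernel_event_def)
    obtain \<beta> where "card {i\<in>{..<n}. v i \<noteq> \<beta>} \<le> e" using Bc[OF v(1)] by blast
    then have "{i\<in>{..<n}. v i \<noteq> \<beta>} \<in> \<D>" "v \<in> VD {i\<in>{..<n}. v i \<noteq> \<beta>}" by (auto simp: \<D>_def VD_def)
    then show "X \<in> (\<Union>D\<in>\<D>. kernel_event n F T (VD D \<inter> B))" using v unfolding kernel_event_def by blast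
  qed simp
  also have "\<dots> \<le> (\<Sum>D\<in>\<D>. measure_pmf.prob ?Pi (kernel_event n F T (VD D \<inter> B)))"
    using f\<D> by (intro measure_pmf.finite_measure_subadditive_finite) auto
  also have "\<dots> \<le> (\<Sum>D\<in>\<D>. ?lam ^ card T * \<mu> * ((\<mu> / \<alpha>) ^ e * \<alpha> ^ card D))"
  proof (intro sum_mono)
    fix D assume D: "D \<in> \<D>"
    then have fD: "finite D" and nD: "n \<notin> D" by (auto simp: \<D>_def dest: finite_subset)
    \<comment> \<open>The label \<open>n\<close>, not a coordinate, stands for the indicator of the
      complement of \<open>D\<close>; labels in \<open>D\<close> stand for unit vectors.\<close>
    define b where "b k j = (if k = n then (if j \<in> D then 0 else 1) else if k = j then 1 else 0 :: complex)" for k j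
    have "VD D \<subseteq> spanned n b (insert n D)"
    proof
      fix v assume "v \<in> VD D"
      then obtain \<beta> where \<beta>: "\<forall>i<n. i \<notin> D \<longrightarrow> v i = \<beta>" by (auto simp: VD_def)
      have "v j = (\<Sum>k\<in>insert n D. (if k = n then \<beta> else v k) * b k j)" if j: "j < n" for j
      proof -
        have "(\<Sum>k\<in>D. (if k = n then \<beta> else v k) * b k j) = (\<Sum>k\<in>D. if k = j then v j else 0)"
          using nD by (intro sum.cong) (auto simp: b_def)
        then show ?thesis using \<beta> j fD nD by (auto simp: b_def)
      qed
      then show "v \<in> spanned n b (insert n D)" unfolding spanned_def mem_Collect_eq
        by (intro exI[of _ "\<lambda>k. if k = n then \<beta> else v k"] allI impI)
    qed
    then have "measure_pmf.prob ?Pi (kernel_event n F T (VD D \<inter> B)) \<le> ?lam ^ card T * \<mu> ^ card (insert n D)"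
      using \<mu> fD by (intro exposure_bound T \<rho> B) auto
    also have "\<mu> ^ card (insert n D) = \<mu> * ((\<mu> / \<alpha>) ^ card D * \<alpha> ^ card D)"
      using fD nD \<alpha> by (simp add: power_mult_distrib[symmetric])
    also have "?lam ^ card T * (\<mu> * ((\<mu> / \<alpha>) ^ card D * \<alpha> ^ card D)) \<le> ?lam ^ card T * (\<mu> * ((\<mu> / \<alpha>) ^ e * \<alpha> ^ card D))"
      using D \<mu> \<alpha> lam by (intro mult_left_mono mult_right_mono power_increasing) (auto simp: \<D>_def field_simps)
    finally show "measure_pmf.prob ?Pi (kernel_event n F T (VD D \<inter> B)) \<le> ?lam ^ card T * \<mu> * ((\<mu> / \<alpha>) ^ e * \<alpha> ^ card D)"
      by (simp add: mult_ac)
  qed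
  also have "\<dots> = ?lam ^ card T * \<mu> * ((\<mu> / \<alpha>) ^ e * (\<Sum>D\<in>\<D>. \<alpha> ^ card D))" by (simp add: sum_distrib_left)
  also have "\<dots> \<le> ?lam ^ card T * \<mu> * ((\<mu> / \<alpha>) ^ e * (\<Sum>D\<in>Pow {..<n}. \<alpha> ^ card D))"
    using lam \<mu> \<alpha> by (intro mult_left_mono sum_mono2) (auto simp: \<D>_def)
  finally show ?thesis by (simp add: sum_Pow_power)
qed

subsection \<open>Structured null vectors\<close>

lemma homogeneous_system_solution:
  fixes A :: "nat \<Rightarrow> nat \<Rightarrow> complex"
  assumes "finite I" "finite J" "card I < card J"
  shows "\<exists>v. (\<exists>j\<in>J. v j \<noteq> 0) \<and> (\<forall>i\<in>I. (\<Sum>j\<in>J. A i j * v j) = 0)"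
  using assms
proof (induction I arbitrary: J A rule: finite_induct)
  case empty
  then obtain j where "j \<in> J" by fastforce
  then show ?case by (intro exI[of _ "\<lambda>_. 1"]) auto
next
  case (insert i I)
  show ?case
  proof (cases "\<forall>j\<in>J. A i j = 0")
    case True
    have "card I < card J" using insert by simp
    then obtain v where "\<exists>j\<in>J. v j \<noteq> 0" "\<forall>i\<in>I. (\<Sum>j\<in>J. A i j * v j) = 0" using insert.IH[OF insert.prems(1)] by blast
    then show ?thesis using True by (intro exI[of _ v]) auto
  next
    case False
    then obtain j0 where j0: "j0 \<in> J" "A i j0 \<noteq> 0" by blast
    define A' where "A' k j = A k j - A k j0 * A i j / A i j0" for k j
    have "card I < card (J - {j0})" using insert j0 by simp
    then obtain v where v: "\<exists>j\<in>J-{j0}. v j \<noteq> 0" "\<forall>k\<in>I. (\<Sum>j\<in>J-{j0}. A' k j * v j) = 0"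
      using insert.IH[of "J - {j0}" A'] insert.prems by auto
    define w where "w = v(j0 := - (\<Sum>j\<in>J-{j0}. A i j * v j) / A i j0)"
    have sw: "(\<Sum>j\<in>J. A k j * w j) = (\<Sum>j\<in>J-{j0}. A' k j * v j)" for k
    proof -
      have "(\<Sum>j\<in>J. A k j * w j) = A k j0 * w j0 + (\<Sum>j\<in>J-{j0}. A k j * w j)"
        using insert.prems j0 by (simp add: sum.remove)
      also have "(\<Sum>j\<in>J-{j0}. A k j * w j) = (\<Sum>j\<in>J-{j0}. A k j * v j)" by (intro sum.cong) (auto simp: w_def)
      also have "A k j0 * w j0 = - (\<Sum>j\<in>J-{j0}. A k j0 * A i j / A i j0 * v j)"
        by (simp add: w_def sum_distrib_left sum_divide_distrib sum_negf mult_ac)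
      finally show ?thesis by (simp add: A'_def algebra_simps sum_subtractf)
    qed
    have "A' i j = 0" for j using j0 by (simp add: A'_def)
    then have "\<forall>k\<in>insert i I. (\<Sum>j\<in>J. A k j * w j) = 0" using v(2) by (simp add: sw)
    moreover have "\<exists>j\<in>J. w j \<noteq> 0" using v(1) by (auto simp: w_def)
    ultimately show ?thesis by blast
  qed
qed

lemma atoms_le_mono: "atoms_le X \<Omega> q \<Longrightarrow> q \<le> q' \<Longrightarrow> atoms_le X \<Omega> q'"
  unfolding atoms_le_def by (meson mult_right_mono of_nat_0_le_iff order.trans)

text \<open>A rearrangement of \<open>xs\<close> is a list over the at most \<open>K\<close> entries
  of \<open>xs\<close>.\<close>

lemma card_degenerate_relations:
  assumes "finite S"
  shows "card {(xs, ys) \<in> tuples K S \<times> tuples K S. mset xs = mset ys} \<le> K ^ K * card S ^ K"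
proof -
  have "card {(xs, ys) \<in> tuples K S \<times> tuples K S. mset xs = mset ys} = (\<Sum>xs\<in>tuples K S. card {ys\<in>tuples K S. mset xs = mset ys})"
    using assms by (subst card_pairs_eq_sum) auto
  also have "\<dots> \<le> (\<Sum>xs\<in>tuples K S. K ^ K)"
  proof (intro sum_mono)
    fix xs assume xs: "xs \<in> tuples K S"
    have "{ys\<in>tuples K S. mset xs = mset ys} \<subseteq> tuples K (set xs)"
      by (auto simp: tuples_def dest: mset_eq_setD)
    then have "card {ys\<in>tuples K S. mset xs = mset ys} \<le> card (tuples K (set xs))" by (intro card_mono) auto
    also have "\<dots> = card (set xs) ^ K" by (rule card_tuples) simp
    also have "\<dots> \<le> K ^ K" using xs card_length[of xs] by (intro power_mono) (auto simp: tuples_def)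
    finally show "card {ys\<in>tuples K S. mset xs = mset ys} \<le> K ^ K" .
  qed
  finally show ?thesis using assms by (simp add: card_tuples mult.commute)
qed

text \<open>Contrapositive: with normalised energy below \<open>2 * g * q\<close>, the triplings
  would push every atom to at most \<open>q / 2\<close>. The 8 collects the 2 in
  \<open>2 * g\<close> (half is later lost to degenerate relations), the 2 for distinct tuples and
  the 2 in \<open>q / 2\<close>.\<close>

lemma energy_lower_bound:
  assumes \<epsilon>: "0 < \<epsilon>" "\<epsilon> \<le> 1" and s: "real_of_int \<bar>s\<bar> \<le> (1 - \<epsilon>) * real n"
    and n: "2 \<le> \<epsilon> * real n" "real (3 ^ r * (2 * K)) \<le> \<epsilon> * real n / 8" "4 * (3 ^ r * (2 * K)) ^ 2 \<le> n"
    and S: "S \<subseteq> {..<n}" "(1 - \<epsilon> / 8) * real n \<le> real (card S)"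
    and v: "\<not> atoms_le (\<lambda>x. ip n x v) (sign_set n s) (q / 2)"
    and g: "0 < g" "(19/20) ^ r * 4 ^ K * (8 * g) \<le> 1" and q: "0 < q" "q \<le> 1 / (4 ^ K * (20 * g))"
  shows "2 * g * q * real (card S) ^ (2 * K) \<le> real (energy v K S)"
proof -
  let ?m = "3 ^ r * (2 * K)"
  have fS: "finite S" using S finite_subset by blast
  have n0: "real n > 0" using n(1) by (cases n) auto
  have cS: "real n / 2 \<le> real (card S)"
  proof -
    have "1 / 2 * real n \<le> (1 - \<epsilon> / 8) * real n" using \<epsilon> by (intro mult_right_mono) auto
    then show ?thesis using S by simp
  qed
  then have cS0: "real (card S) > 0" using n0 by linarith
  define e where "e = real (energy v K S) / real (card S) ^ (2 * K)"
  have e: "real (energy v K S) = e * real (card S) ^ (2 * K)" "0 \<le> e" using cS0 by (auto simp: e_def)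
  \<comment> \<open>Triplings need atoms of at most \<open>1/10\<close> to start; otherwise the
    energy exceeds a constant and the upper limit on \<open>q\<close> suffices.\<close>
  have "2 * g * q \<le> e"
  proof (cases "4 ^ K * e \<le> 1/10")
    case False
    have "2 * g * q \<le> 2 * g * (1 / (4 ^ K * (20 * g)))" using g q by (intro mult_left_mono) auto
    also have "\<dots> = 1 / (4 ^ K * 10)" using g by simp
    also have "\<dots> \<le> e" using False by (simp add: field_simps)
    finally show ?thesis .
  next
    case True
    have "atoms_le (\<lambda>x. ip n x v) (sign_set n s) (2 * ((19/20) ^ r * (4 ^ K * e)))"
    proof (rule slice_bound[OF S(1), of s ?m])
      fix x and \<tau> :: int assume x: "x \<in> sign_set n s" "\<tau> \<in> {-1, 1}"
      \<comment> \<open>At most \<open>\<epsilon> * n / 8\<close> coordinates lie outside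
        \<open>S\<close>, half of the \<open>\<epsilon> * n / 4\<close> guaranteed for each
        sign.\<close>
      have "card {j\<in>{..<n}. x j = \<tau>} \<le> card ({j\<in>S. x j = \<tau>} \<union> ({..<n} - S))" using fS by (intro card_mono) auto
      also have "\<dots> \<le> card {j\<in>S. x j = \<tau>} + card ({..<n} - S)" by (rule card_Un_le)
      also have "card ({..<n} - S) = n - card S" using S fS by (simp add: card_Diff_subset)
      finally have "real (card {j\<in>{..<n}. x j = \<tau>}) \<le> real (card {j\<in>S. x j = \<tau>}) + (real n - real (card S))"
        using card_mono[OF _ S(1)] by (simp add: of_nat_diff flip: of_nat_add)
      then have "real ?m \<le> real (card {j\<in>S. x j = \<tau>})"
        using card_sign_ge[OF x s n(1)] n(2) S(2) by (simp add: algebra_simps)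
      then show "?m \<le> card {j\<in>S. x j = \<tau>}" by (simp only: of_nat_le_iff)
    next
      fix T assume T: "T \<subseteq> S" "card S \<le> 2 * card T"
      have "real n / 2 \<le> real (2 * card T)" using cS T(2) by linarith
      then have "?m ^ 2 \<le> card T" using n(3) by linarith
      then show "atoms_le (vsum v) (dtuples ?m T) (2 * ((19/20) ^ r * (4 ^ K * e)))"
        using T True e finite_subset[OF T(1) fS] fS by (intro atoms_le_dtuples[of T S]) auto
    qed
    then have "\<not> 2 * ((19/20) ^ r * (4 ^ K * e)) \<le> q / 2" using v atoms_le_mono by blast
    then have "q < 4 * ((19/20) ^ r * 4 ^ K) * e" by simp
    then have "2 * g * q \<le> 2 * g * (4 * ((19/20) ^ r * 4 ^ K) * e)" using g by (intro mult_left_mono) auto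
    also have "\<dots> = ((19/20) ^ r * 4 ^ K * (8 * g)) * e" by simp
    also have "\<dots> \<le> 1 * e" using g e by (intro mult_right_mono) auto
    finally show ?thesis by simp
  qed
  then show ?thesis using e(1) by (simp add: mult_right_mono)
qed

lemma nondegenerate_relations:
  assumes "finite S" "0 < card S" "2 * \<eta> * real (card S) ^ (2 * K) \<le> real (energy v K S)"
    and "real K ^ K \<le> \<eta> * real (card S) ^ K"
  shows "\<eta> * real (card S) ^ (2 * K) \<le>
    real (card {(xs, ys) \<in> tuples K S \<times> tuples K S. mset xs \<noteq> mset ys \<and> vsum v xs = vsum v ys})"
proof -
  let ?N = "{(xs, ys) \<in> tuples K S \<times> tuples K S. mset xs \<noteq> mset ys \<and> vsum v xs = vsum v ys}"
  let ?D = "{(xs, ys) \<in> tuples K S \<times> tuples K S. mset xs = mset ys}"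
  have "finite (tuples K S \<times> tuples K S)" using assms(1) by simp
  then have fin: "finite ?N" "finite ?D" by (auto elim!: rev_finite_subset)
  have "energy v K S \<le> card (?N \<union> ?D)" unfolding energy_def using fin by (intro card_mono) auto
  also have "\<dots> \<le> card ?N + K ^ K * card S ^ K"
    using card_Un_le[of ?N ?D] card_degenerate_relations[OF assms(1), of K] by linarith
  finally have "real (energy v K S) \<le> real (card ?N + K ^ K * card S ^ K)" by (rule of_nat_mono)
  also have "\<dots> = real (card ?N) + real K ^ K * real (card S) ^ K" by simp
  also have "real K ^ K * real (card S) ^ K \<le> \<eta> * real (card S) ^ K * real (card S) ^ K"
    using assms(4) by (intro mult_right_mono) auto
  also have "\<dots> = \<eta> * real (card S) ^ (2 * K)" by (simp add: mult_2 power_add)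
  finally show ?thesis using assms(3) by simp
qed

lemma prob_sign_set:
  assumes "sign_set n s \<noteq> {}" "atoms_le (\<lambda>x. ip n x v) (sign_set n s) q"
  shows "measure_pmf.prob (pmf_of_set (sign_set n s)) {x. ip n x v = a} \<le> q"
proof -
  have "sign_set n s \<inter> {x. ip n x v = a} = {x \<in> sign_set n s. ip n x v = a}" by auto
  moreover have "card (sign_set n s) > 0" using assms(1) by (simp add: card_gt_0_iff)
  ultimately show ?thesis using assms by (simp add: measure_pmf_of_set atoms_le_def pos_divide_le_eq)
qed

text \<open>The choice \<open>\<mu> = 1 / q\<close> turns \<open>\<rho> + 1 / \<mu>\<close> into
  \<open>2 * q\<close>. The exponents of \<open>q\<close> add up to
  \<open>- d + (n - 1) - (n - d) = - 1\<close>, and \<open>h * d \<ge> n\<close> makes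
  \<open>g ^ d \<ge> 4 ^ n\<close>.\<close>

lemma structured_bound:
  assumes \<epsilon>: "0 < \<epsilon>" "\<epsilon> \<le> 1" and s: "real_of_int \<bar>s\<bar> \<le> (1 - \<epsilon>) * real n" "sign_set n s \<noteq> {}"
    and n: "2 \<le> \<epsilon> * real n" "real (3 ^ r * (2 * K)) \<le> \<epsilon> * real n / 8" "4 * (3 ^ r * (2 * K)) ^ 2 \<le> n" "16 \<le> \<epsilon> * real n"
    and g: "g = 4 ^ h" "16 / \<epsilon> \<le> real h" "(19/20) ^ r * 4 ^ K * (8 * g) \<le> 1"
    and q: "0 < q" "q \<le> 1" "q \<le> 1 / (4 ^ K * (20 * g))" "(2 * real K) ^ K \<le> q * real n ^ K"
  shows "measure_pmf.prob (Pi_pmf {1..<n} undefined (\<lambda>_. pmf_of_set (sign_set n s)))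
     (kernel_event n F {1..<n} {v. (\<exists>j<n. v j \<noteq> 0) \<and> atoms_le (\<lambda>x. ip n x v) (sign_set n s) q
        \<and> \<not> atoms_le (\<lambda>x. ip n x v) (sign_set n s) (q / 2)}) \<le> 1 / (q * 2 ^ n)"
proof -
  let ?B = "{v. (\<exists>j<n. v j \<noteq> 0) \<and> atoms_le (\<lambda>x. ip n x v) (sign_set n s) q \<and> \<not> atoms_le (\<lambda>x. ip n x v) (sign_set n s) (q / 2)}"
  let ?P = "measure_pmf.prob (Pi_pmf {1..<n} undefined (\<lambda>_. pmf_of_set (sign_set n s))) (kernel_event n F {1..<n} ?B)"
  have g1: "1 \<le> g" by (simp add: g)
  have n1: "1 \<le> n" using n(1) by (cases n) auto
  \<comment> \<open>Rounding down loses at most half, because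
    \<open>\<epsilon> * n / 8 \<ge> 2\<close>.\<close>
  define d where "d = nat \<lfloor>\<epsilon> * real n / 8\<rfloor>"
  have d: "real d \<le> \<epsilon> * real n / 8" "\<epsilon> * real n / 16 \<le> real d"
    using n(1,4) by (simp_all add: d_def) linarith+
  have "\<epsilon> * real n / 8 \<le> 1 * real n / 8" using \<epsilon> by (intro divide_right_mono mult_right_mono) auto
  then have dn: "d \<le> n" using d(1) by linarith
  have "coordinates_determine n UNIV {..<n}"
    unfolding coordinates_determine_def
  proof (intro exI[of _ "\<lambda>k j. if k = j then 1 else 0"] ballI allI impI)
    fix v :: "nat \<Rightarrow> complex" and j assume "j < n"
    then show "v j = (\<Sum>k<n. v k * (if k = j then 1 else 0))" by (simp add: if_distrib cong: if_cong)
  qed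
  then have "measure_pmf.prob (Pi_pmf {1..<n} undefined (\<lambda>_. pmf_of_set (sign_set n s))) (kernel_event n F {1..<n} (UNIV \<inter> ?B))
    \<le> (1 / (g * q)) ^ d * ((q + 1 / (1 / q)) ^ card {1..<n} * (1 / q) ^ (n - d))"
  proof (rule relation_steps[rotated -1])
    fix v and S :: "nat set"
    assume v: "v \<in> ?B" and S: "S \<subseteq> {..<n}" "n - d < card S"
    have fS: "finite S" using S finite_subset by blast
    have S2: "(1 - \<epsilon> / 8) * real n \<le> real (card S)" using S(2) d(1) dn by (simp add: algebra_simps)
    have "1 / 2 * real n \<le> (1 - \<epsilon> / 8) * real n" using \<epsilon> by (intro mult_right_mono) auto
    then have cS: "real n / 2 \<le> real (card S)" using S2 by simp
    have "2 * g * q * real (card S) ^ (2 * K) \<le> real (energy v K S)"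
      by (rule energy_lower_bound[OF \<epsilon> s(1) n(1-3) S(1) S2]) (use v g g1 q in auto)
    moreover have "real K ^ K \<le> g * q * real (card S) ^ K"
    proof -
      have "2 ^ K * real K ^ K \<le> q * real n ^ K" using q(4) by (simp add: power_mult_distrib)
      also have "real n ^ K = 2 ^ K * (real n / 2) ^ K" by (simp add: power_divide)
      finally have "real K ^ K \<le> 1 * q * (real n / 2) ^ K" by simp
      also have "\<dots> \<le> g * q * real (card S) ^ K" using g1 q cS by (intro mult_mono power_mono) auto
      finally show ?thesis .
    qed
    ultimately show "g * q * real (card S) ^ (2 * K) \<le> real (card {(xs, ys) \<in> tuples K S \<times> tuples K S. mset xs \<noteq> mset ys \<and> vsum v xs = vsum v ys})"
      using fS S(2) by (intro nondegenerate_relations) (auto simp: mult_ac)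
  next
    fix v a assume "v \<in> ?B"
    then show "measure_pmf.prob (pmf_of_set (sign_set n s)) {x. ip n x v = a} \<le> q" using s by (intro prob_sign_set) auto
  qed (use q g1 dn in auto)
  also have "\<dots> = 2 ^ (n - 1) * ((1 / g) ^ d * ((1 / q) ^ d * (1 / q) ^ (n - d)) * q ^ (n - 1))"
    using q by (simp add: power_mult_distrib power_divide mult_2[symmetric])
  also have "(1 / q) ^ d * (1 / q) ^ (n - d) = (1 / q) ^ Suc (n - 1)"
    using dn n1 by (simp add: power_add[symmetric])
  also have "2 ^ (n - 1) * ((1 / g) ^ d * (1 / q) ^ Suc (n - 1) * q ^ (n - 1)) = 2 ^ (n - 1) * ((1 / g) ^ d * (1 / q))"
    using q by (simp add: power_divide)
  also have "\<dots> \<le> 2 ^ (n - 1) * ((1 / 4) ^ n * (1 / q))"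
  proof -
    have "real n \<le> 16 / \<epsilon> * (\<epsilon> * real n / 16)" using \<epsilon> by simp
    also have "\<dots> \<le> real h * real d" using g(2) d(2) \<epsilon> by (intro mult_mono) auto
    finally have "n \<le> h * d" by (simp only: of_nat_mult[symmetric] of_nat_le_iff)
    have "(1 / g) ^ d = (1 / 4) ^ (h * d)" by (simp add: g power_mult power_divide)
    also have "\<dots> \<le> (1 / 4) ^ n" using \<open>n \<le> h * d\<close> by (intro power_decreasing) auto
    finally show ?thesis using q by (intro mult_left_mono mult_right_mono) auto
  qed
  also have "\<dots> \<le> 2 ^ n * ((1 / 4) ^ n * (1 / q))" using q by (intro mult_right_mono power_increasing) auto
  also have "\<dots> = 1 / (q * 2 ^ n)"
  proof -
    have "(4::real) ^ n = 2 ^ n * 2 ^ n" by (simp add: power_mult_distrib[symmetric])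
    then show ?thesis by (simp add: power_divide)
  qed
  finally show ?thesis by simp
qed

text \<open>Fixing the largest atom up to a factor 2 leaves few scales for the final union
  bound.\<close>

lemma exists_dyadic_scale:
  fixes p :: "real \<Rightarrow> bool"
  assumes "p 1" "\<not> p \<xi>" "\<And>q q'. p q \<Longrightarrow> q \<le> q' \<Longrightarrow> p q'" "0 < \<xi>"
  obtains t where "p (1 / 2 ^ t)" "\<not> p (1 / 2 ^ t / 2)"
proof -
  obtain N :: nat where "(1/2) ^ N < \<xi>" using real_arch_pow_inv[of \<xi> "1/2"] assms by auto
  then have "\<not> p (1 / 2 ^ N)" using assms(2,3) by (force simp: power_one_over)
  then obtain t where "\<not> p (1 / 2 ^ Suc t)" "p (1 / 2 ^ t)"
    using assms(1) by (induction N) auto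
  then show thesis using that[of t] by (simp add: field_simps)
qed

section \<open>Conditioning on all rows but one, and the choice of constants\<close>

lemma span_prob_split:
  assumes n: "1 \<le> n" and ne: "sign_set n s \<noteq> {}" and \<xi>: "0 \<le> \<xi>"
    and good: "\<And>X v. X \<notin> A \<Longrightarrow> (\<exists>j<n. v j \<noteq> 0) \<Longrightarrow> (\<forall>i\<in>{1..<n}. form n (F i) (X i) v = 0) \<Longrightarrow>
        atoms_le (\<lambda>x. ip n x v) (sign_set n s) \<xi>"
  shows "measure_pmf.prob (Pi_pmf {..<n} undefined (\<lambda>_. pmf_of_set (sign_set n s)))
           {X. in_cspan n (\<lambda>j. of_int (X 0 j) + F 0 j) {1..<n} (\<lambda>i j. of_int (X i j) + F i j)}
       \<le> measure_pmf.prob (Pi_pmf {1..<n} undefined (\<lambda>_. pmf_of_set (sign_set n s))) A + \<xi>"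
proof -
  let ?p = "pmf_of_set (sign_set n s)"
  let ?E = "{X. in_cspan n (\<lambda>j. of_int (X 0 j) + F 0 j) {1..<n} (\<lambda>i j. of_int (X i j) + F i j)}"
  have ins: "{..<n} = insert 0 {1..<n}" using n by auto
  have "Pi_pmf {..<n} undefined (\<lambda>_. ?p) = bind_pmf (Pi_pmf {1..<n} undefined (\<lambda>_. ?p)) (\<lambda>X. map_pmf (\<lambda>x. X(0 := x)) ?p)"
    unfolding ins by (subst Pi_pmf_insert') (auto simp: map_pmf_def intro: bind_commute_pmf)
  then have "measure_pmf.prob (Pi_pmf {..<n} undefined (\<lambda>_. ?p)) ?E =
      measure_pmf.prob (bind_pmf (Pi_pmf {1..<n} undefined (\<lambda>_. ?p)) (\<lambda>X. map_pmf (\<lambda>x. X(0 := x)) ?p)) ?E" by (rule arg_cong)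
  also have "\<dots> \<le> 1 * measure_pmf.prob (Pi_pmf {1..<n} undefined (\<lambda>_. ?p)) A + \<xi>"
  proof (rule prob_bind_le)
    fix X :: "nat \<Rightarrow> nat \<Rightarrow> int" assume X: "X \<notin> A"
    \<comment> \<open>There are \<open>n - 1\<close> equations in \<open>n\<close> unknowns;
      \<open>v\<close> depends on the rows \<open>1..<n\<close> only, so row 0 is still
      uniform.\<close>
    obtain v where v: "\<exists>j\<in>{..<n}. v j \<noteq> 0" "\<forall>i\<in>{1..<n}. (\<Sum>j<n. (of_int (X i j) + F i j) * v j) = 0"
      using homogeneous_system_solution[of "{1..<n}" "{..<n}" "\<lambda>i j. of_int (X i j) + F i j"] n by auto
    have at: "atoms_le (\<lambda>x. ip n x v) (sign_set n s) \<xi>"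
      by (rule good[OF X]) (use v in \<open>auto simp: form_def\<close>)
    have "(\<lambda>x. X(0 := x)) -` ?E \<subseteq> {x. ip n x v = - (\<Sum>j<n. F 0 j * v j)}"
    proof
      fix x assume "x \<in> (\<lambda>x. X(0 := x)) -` ?E"
      then obtain c where c: "\<forall>j<n. of_int (x j) + F 0 j = (\<Sum>i\<in>{1..<n}. c i * (of_int ((X(0 := x)) i j) + F i j))"
        by (auto simp: in_cspan_def)
      have "form n (F 0) x v = (\<Sum>j<n. (\<Sum>i\<in>{1..<n}. c i * (of_int (X i j) + F i j)) * v j)"
        unfolding form_def using c by (intro sum.cong) auto
      also have "\<dots> = (\<Sum>j<n. \<Sum>i\<in>{1..<n}. c i * ((of_int (X i j) + F i j) * v j))"
        by (simp only: sum_distrib_right mult.assoc)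
      also have "\<dots> = (\<Sum>i\<in>{1..<n}. c i * (\<Sum>j<n. (of_int (X i j) + F i j) * v j))"
        by (subst sum.swap) (simp only: sum_distrib_left)
      also have "\<dots> = 0" using v(2) by (intro sum.neutral) auto
      finally show "x \<in> {x. ip n x v = - (\<Sum>j<n. F 0 j * v j)}" by (simp add: form_eq eq_neg_iff_add_eq_0)
    qed
    then have "measure_pmf.prob ?p ((\<lambda>x. X(0 := x)) -` ?E) \<le> measure_pmf.prob ?p {x. ip n x v = - (\<Sum>j<n. F 0 j * v j)}"
      by (intro measure_pmf.finite_measure_mono) auto
    also have "\<dots> \<le> \<xi>" by (rule prob_sign_set[OF ne at])
    finally show "measure_pmf.prob (map_pmf (\<lambda>x. X(0 := x)) ?p) ?E \<le> \<xi>" by (simp only: measure_map_pmf)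
  qed (use \<xi> in auto)
  finally show ?thesis by simp
qed

lemma almost_constant_bound_sign_set:
  fixes \<epsilon> :: real
  assumes \<epsilon>: "0 < \<epsilon>" "\<epsilon> \<le> 1"
  shows "\<exists>\<delta> \<theta>. 0 < \<delta> \<and> \<delta> \<le> \<epsilon> / 4 \<and> 0 < \<theta> \<and> \<theta> < 1 \<and>
    (\<forall>n s F. 2 \<le> \<epsilon> * real n \<longrightarrow> real_of_int \<bar>s\<bar> \<le> (1 - \<epsilon>) * real n \<longrightarrow> sign_set n s \<noteq> {} \<longrightarrow>
      measure_pmf.prob (Pi_pmf {1..<n} undefined (\<lambda>_. pmf_of_set (sign_set n s)))
        (kernel_event n F {1..<n} {v. (\<exists>j<n. v j \<noteq> 0) \<and> (\<exists>\<beta>. real (card {i\<in>{..<n}. v i \<noteq> \<beta>}) < \<delta> * real n)}) \<le> 32 / \<epsilon> * \<theta> ^ n)"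
proof -
  \<comment> \<open>Here \<open>\<rho> = 1 - \<epsilon>/8\<close> and
    \<open>\<mu> = 16/\<epsilon>\<close> give the base \<open>1 - \<epsilon>/16\<close>, and
    \<open>\<alpha> = \<epsilon>/32\<close> gives back at most half of that gap, leaving
    \<open>\<theta>0\<close>. \<open>M\<close> is \<open>\<mu> / \<alpha>\<close>, and
    \<open>\<delta>\<close> is so small that \<open>M powr \<delta>\<close> costs at most a square
    root of \<open>\<theta>0\<close>.\<close>
  define \<theta>0 where "\<theta>0 = 1 - \<epsilon> / 32"
  define M where "M = 512 / \<epsilon>\<^sup>2"
  define \<delta> where "\<delta> = min (\<epsilon> / 4) (ln (1 / \<theta>0) / (2 * ln M))"
  have \<theta>0: "0 < \<theta>0" "\<theta>0 < 1" using \<epsilon> by (auto simp: \<theta>0_def)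
  have "\<epsilon>\<^sup>2 \<le> 1" using \<epsilon> by (simp add: power_le_one)
  then have M: "1 < M" using \<epsilon> by (simp add: M_def field_simps)
  have \<delta>: "0 < \<delta>" "\<delta> \<le> \<epsilon> / 4" using \<epsilon> \<theta>0 M by (auto simp: \<delta>_def)
  define \<theta> where "\<theta> = M powr \<delta> * \<theta>0"
  have "0 < \<theta>" using M \<theta>0 by (simp add: \<theta>_def)
  moreover have "\<theta> < 1"
  proof -
    have "\<delta> * ln M \<le> ln (1 / \<theta>0) / (2 * ln M) * ln M" using M by (intro mult_right_mono) (auto simp: \<delta>_def)
    also have "\<dots> = - ln \<theta>0 / 2" using M \<theta>0 by (simp add: ln_div)
    finally have "ln \<theta> \<le> ln \<theta>0 / 2" using M \<theta>0 by (simp add: \<theta>_def ln_mult)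
    also have "\<dots> < 0" using \<theta>0 by simp
    finally show ?thesis using \<open>0 < \<theta>\<close> by simp
  qed
  moreover have "measure_pmf.prob (Pi_pmf {1..<n} undefined (\<lambda>_. pmf_of_set (sign_set n s)))
        (kernel_event n F {1..<n} {v. (\<exists>j<n. v j \<noteq> 0) \<and> (\<exists>\<beta>. real (card {i\<in>{..<n}. v i \<noteq> \<beta>}) < \<delta> * real n)}) \<le> 32 / \<epsilon> * \<theta> ^ n"
    if n: "2 \<le> \<epsilon> * real n" and s: "real_of_int \<bar>s\<bar> \<le> (1 - \<epsilon>) * real n" "sign_set n s \<noteq> {}" for n s F
  proof -
    let ?B = "{v. (\<exists>j<n. v j \<noteq> 0) \<and> (\<exists>\<beta>. real (card {i\<in>{..<n}. v i \<noteq> \<beta>}) < \<delta> * real n)}"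
    define e where "e = nat \<lfloor>\<delta> * real n\<rfloor>"
    define l where "l = 1 - \<epsilon> / 16"
    have l: "1/2 \<le> l" "l \<le> 1" using \<epsilon> by (auto simp: l_def)
    have n1: "1 \<le> n" using n by (cases n) auto
    have "measure_pmf.prob (Pi_pmf {1..<n} undefined (\<lambda>_. pmf_of_set (sign_set n s))) (kernel_event n F {1..<n} ?B)
      \<le> ((1 - \<epsilon> / 8) + 1 / (16 / \<epsilon>)) ^ card {1..<n} * (16 / \<epsilon>) * (((16 / \<epsilon>) / (\<epsilon> / 32)) ^ e * (1 + \<epsilon> / 32) ^ n)"
    proof (rule almost_constant_bound)
      fix v :: "nat \<Rightarrow> complex" and a assume "v \<in> ?B"
      then obtain j where "j < n" "v j \<noteq> 0" by blast
      then show "measure_pmf.prob (pmf_of_set (sign_set n s)) {x. ip n x v = a} \<le> 1 - \<epsilon> / 8"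
        using nonzero_atom_bound[OF \<epsilon> s(1) n] by (intro prob_sign_set s) auto
    next
      fix v :: "nat \<Rightarrow> complex" assume "v \<in> ?B"
      then obtain \<beta> where "real (card {i\<in>{..<n}. v i \<noteq> \<beta>}) < \<delta> * real n" by blast
      then have "card {i\<in>{..<n}. v i \<noteq> \<beta>} \<le> e" unfolding e_def by linarith
      then show "\<exists>\<beta>. card {i\<in>{..<n}. v i \<noteq> \<beta>} \<le> e" by blast
    qed (use \<epsilon> in auto)
    also have "(1 - \<epsilon> / 8) + 1 / (16 / \<epsilon>) = l" using \<epsilon> by (simp add: l_def)
    also have "(16 / \<epsilon>) / (\<epsilon> / 32) = M" using \<epsilon> by (simp add: M_def power2_eq_square)
    also have "l ^ card {1..<n} * (16 / \<epsilon>) * (M ^ e * (1 + \<epsilon> / 32) ^ n) \<le> (2 * l ^ n) * (16 / \<epsilon>) * ((M powr \<delta>) ^ n * (1 + \<epsilon> / 32) ^ n)"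
    proof (intro mult_mono)
      \<comment> \<open>Only \<open>n - 1\<close> rows are exposed; \<open>l \<ge> 1/2\<close>
        repairs the exponent at the price of 2, whence \<open>32/\<epsilon>\<close>.\<close>
      have "l ^ n = l * l ^ (n - 1)" using n1 by (simp add: power_eq_if)
      moreover have "1/2 * l ^ (n - 1) \<le> l * l ^ (n - 1)" using l by (intro mult_right_mono) auto
      ultimately show "l ^ card {1..<n} \<le> 2 * l ^ n" by simp
      have "M ^ e = M powr real e" using M by (simp add: powr_realpow)
      also have "\<dots> \<le> M powr (\<delta> * real n)" using M \<delta> by (intro powr_mono) (auto simp: e_def)
      also have "\<dots> = (M powr \<delta>) ^ n" using M by (simp add: powr_powr[symmetric] powr_realpow)
      finally show "M ^ e \<le> (M powr \<delta>) ^ n" .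
    qed (use M l \<epsilon> in auto)
    also have "\<dots> = 32 / \<epsilon> * (M powr \<delta> * (l * (1 + \<epsilon> / 32))) ^ n" by (simp add: power_mult_distrib)
    also have "\<dots> \<le> 32 / \<epsilon> * \<theta> ^ n"
    proof -
      have "l * (1 + \<epsilon> / 32) \<le> \<theta>0" using \<epsilon> by (simp add: l_def \<theta>0_def algebra_simps)
      then show ?thesis unfolding \<theta>_def using l M \<epsilon> by (intro mult_left_mono power_mono) auto
    qed
    finally show ?thesis .
  qed
  ultimately show ?thesis using \<delta> by (intro exI[of _ \<delta>] exI[of _ \<theta>] conjI allI impI)
qed

text \<open>The constants \<open>K\<close>, \<open>g\<close> and \<open>r\<close> determine the
  threshold \<open>c2\<close>, and only then is the spread case invoked with target
  \<open>c2 / 2\<close>. For large \<open>n\<close> the factor 3 counts the almost constant null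
  vectors, all dyadic scales together, and the last row, each contributing at most
  \<open>n powr (- B)\<close>.\<close>

theorem theorem3p4:
  fixes \<epsilon> \<gamma> :: real
  assumes "0 < \<epsilon>" and "\<epsilon> \<le> 1"
  shows "\<forall>B>0. \<exists>C. \<forall>(n::nat) (s::int) (F::nat \<Rightarrow> nat \<Rightarrow> complex).
     real_of_int \<bar>s\<bar> \<le> (1 - \<epsilon>) * real n
     \<and> (\<forall>i<n. \<forall>j<n. cmod (F i j) \<le> real n powr \<gamma>)
     \<and> sign_set n s \<noteq> {}
     \<longrightarrow> measure_pmf.prob (Pi_pmf {..<n} undefined (\<lambda>_. pmf_of_set (sign_set n s)))
           {X. in_cspan n (\<lambda>j. of_int (X 0 j) + F 0 j) {1..<n} (\<lambda>i j. of_int (X i j) + F i j)}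
         \<le> C * real n powr (- B)"
proof (intro allI impI)
  fix B :: real assume B: "B > 0"
  note \<epsilon> = assms
  obtain \<delta> \<theta> where \<delta>: "0 < \<delta>" "\<delta> \<le> \<epsilon> / 4" and \<theta>: "0 < \<theta>" "\<theta> < 1"
    and part1: "\<forall>n s F. 2 \<le> \<epsilon> * real n \<longrightarrow> real_of_int \<bar>s\<bar> \<le> (1 - \<epsilon>) * real n \<longrightarrow> sign_set n s \<noteq> {} \<longrightarrow>
      measure_pmf.prob (Pi_pmf {1..<n} undefined (\<lambda>_. pmf_of_set (sign_set n s)))
        (kernel_event n F {1..<n} {v. (\<exists>j<n. v j \<noteq> 0) \<and> (\<exists>\<beta>. real (card {i\<in>{..<n}. v i \<noteq> \<beta>}) < \<delta> * real n)}) \<le> 32 / \<epsilon> * \<theta> ^ n"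
    using almost_constant_bound_sign_set[OF \<epsilon>] by (elim exE conjE)
  define K where "K = nat \<lceil>B\<rceil> + 1"
  have K: "B + 1 \<le> real K" unfolding K_def by linarith
  define h where "h = nat \<lceil>16 / \<epsilon>\<rceil>"
  have h: "16 / \<epsilon> \<le> real h" unfolding h_def by linarith
  define g :: real where "g = 4 ^ h"
  have g: "0 < g" by (simp add: g_def)
  obtain r where "(19/20) ^ r < 1 / (4 ^ K * (8 * g))"
    using real_arch_pow_inv[of "1 / (4 ^ K * (8 * g))" "19/20"] g by auto
  then have r: "(19/20) ^ r * 4 ^ K * (8 * g) \<le> 1" using g by (simp add: field_simps)
  define c2 where "c2 = 1 / (4 ^ K * (20 * g))"
  have c2: "0 < c2" using g by (simp add: c2_def)
  obtain n1 where spread: "\<And>n s v. n1 \<le> n \<Longrightarrow> real_of_int \<bar>s\<bar> \<le> (1 - \<epsilon>) * real n \<Longrightarrow>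
      (\<And>\<beta>. \<delta> * real n \<le> real (card {i\<in>{..<n}. v i \<noteq> \<beta>})) \<Longrightarrow> atoms_le (\<lambda>x. ip n x v) (sign_set n s) (c2 / 2)"
    using spread_small_ball[OF \<epsilon> \<delta>, of "c2 / 2"] c2 by auto
  define m where "m = 3 ^ r * (2 * K)"
  have "eventually (\<lambda>n::nat. 32 / \<epsilon> * \<theta> ^ n \<le> real n powr (- B)) at_top" using \<theta> \<epsilon> by real_asymp
  moreover have "eventually (\<lambda>n::nat. real (n + 1) * (real n powr B / 2 ^ n) \<le> real n powr (- B)) at_top" by real_asymp
  moreover have "eventually (\<lambda>n::nat. real n powr B < 2 ^ n) at_top" by real_asymp
  moreover have "eventually (\<lambda>n::nat. max (16 / \<epsilon>) (max (8 * real m / \<epsilon>) (max (4 * real m ^ 2) (max ((2 * real K) ^ K) (real n1)))) \<le> real n) at_top"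
    by real_asymp
  ultimately have "eventually (\<lambda>n::nat. 32 / \<epsilon> * \<theta> ^ n \<le> real n powr (- B) \<and>
     real (n + 1) * (real n powr B / 2 ^ n) \<le> real n powr (- B) \<and> real n powr B < 2 ^ n \<and>
     max (16 / \<epsilon>) (max (8 * real m / \<epsilon>) (max (4 * real m ^ 2) (max ((2 * real K) ^ K) (real n1)))) \<le> real n) at_top"
    by eventually_elim auto
  then obtain n0 where n0: "\<And>n. n0 \<le> n \<Longrightarrow> 32 / \<epsilon> * \<theta> ^ n \<le> real n powr (- B) \<and>
     real (n + 1) * (real n powr B / 2 ^ n) \<le> real n powr (- B) \<and> real n powr B < 2 ^ n \<and>
     max (16 / \<epsilon>) (max (8 * real m / \<epsilon>) (max (4 * real m ^ 2) (max ((2 * real K) ^ K) (real n1)))) \<le> real n"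
    unfolding eventually_sequentially by blast
  define C where "C = max 3 (real n0 powr B)"
  have main: "measure_pmf.prob (Pi_pmf {..<n} undefined (\<lambda>_. pmf_of_set (sign_set n s)))
           {X. in_cspan n (\<lambda>j. of_int (X 0 j) + F 0 j) {1..<n} (\<lambda>i j. of_int (X i j) + F i j)} \<le> 3 * real n powr (- B)"
    if n: "n0 \<le> n" and s: "real_of_int \<bar>s\<bar> \<le> (1 - \<epsilon>) * real n" "sign_set n s \<noteq> {}" for n s F
  proof -
    let ?S = "sign_set n s"
    let ?Pi = "Pi_pmf {1..<n} undefined (\<lambda>_. pmf_of_set ?S)"
    let ?at = "\<lambda>v q. atoms_le (\<lambda>x. ip n x v) ?S q"
    have N: "32 / \<epsilon> * \<theta> ^ n \<le> real n powr (- B)" "real (n + 1) * (real n powr B / 2 ^ n) \<le> real n powr (- B)"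
       "real n powr B < 2 ^ n" "16 / \<epsilon> \<le> real n" "8 * real m / \<epsilon> \<le> real n" "4 * real m ^ 2 \<le> real n"
       "(2 * real K) ^ K \<le> real n" "n1 \<le> n" using n0[OF n] by auto
    have \<epsilon>n: "16 \<le> \<epsilon> * real n" "2 \<le> \<epsilon> * real n" using N(4) \<epsilon> by (auto simp: field_simps)
    have n1: "1 \<le> n" using \<epsilon>n by (cases n) auto
    define \<xi> where "\<xi> = real n powr (- B)"
    have \<xi>: "0 < \<xi>" using n1 by (simp add: \<xi>_def)
    define B1 where "B1 = {v :: nat \<Rightarrow> complex. (\<exists>j<n. v j \<noteq> 0) \<and> (\<exists>\<beta>. real (card {i\<in>{..<n}. v i \<noteq> \<beta>}) < \<delta> * real n)}"
    define B2 where "B2 t = {v. (\<exists>j<n. v j \<noteq> 0) \<and> ?at v (1 / 2 ^ t) \<and> \<not> ?at v (1 / 2 ^ t / 2)}" for t :: nat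
    define I where "I = {t. t \<le> n \<and> \<xi> \<le> 1 / 2 ^ t \<and> 1 / 2 ^ t \<le> c2}"
    have fI: "finite I" "card I \<le> n + 1"
      using card_mono[of "{..n}" I] by (auto simp: I_def)
    define A where "A = kernel_event n F {1..<n} B1 \<union> (\<Union>t\<in>I. kernel_event n F {1..<n} (B2 t))"
    have "measure_pmf.prob ?Pi A \<le> measure_pmf.prob ?Pi (kernel_event n F {1..<n} B1) + measure_pmf.prob ?Pi (\<Union>t\<in>I. kernel_event n F {1..<n} (B2 t))"
      unfolding A_def by (rule measure_Un_le) auto
    also have "measure_pmf.prob ?Pi (kernel_event n F {1..<n} B1) \<le> \<xi>"
      unfolding B1_def \<xi>_def using part1[rule_format, OF \<epsilon>n(2) s] N(1) by (rule order.trans)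
    also have "measure_pmf.prob ?Pi (\<Union>t\<in>I. kernel_event n F {1..<n} (B2 t)) \<le> (\<Sum>t\<in>I. measure_pmf.prob ?Pi (kernel_event n F {1..<n} (B2 t)))"
      using fI by (intro measure_pmf.finite_measure_subadditive_finite) auto
    also have "\<dots> \<le> (\<Sum>t\<in>I. real n powr B / 2 ^ n)"
    proof (intro sum_mono)
      fix t assume t: "t \<in> I"
      let ?q = "1 / 2 ^ t :: real"
      have q: "\<xi> \<le> ?q" "?q \<le> 1 / (4 ^ K * (20 * g))" using t by (auto simp: I_def c2_def)
      \<comment> \<open>From \<open>q \<ge> n powr (- B)\<close> and \<open>K \<ge> B + 1\<close> a
        full factor \<open>n\<close> remains to exceed the constant.\<close>
      have "(2 * real K) ^ K \<le> ?q * real n ^ K"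
      proof -
        have "(2 * real K) ^ K \<le> real n powr 1" using N(7) n1 by simp
        also have "\<dots> \<le> real n powr (- B + real K)" using K n1 by (intro powr_mono) auto
        also have "\<dots> = \<xi> * real n ^ K" unfolding \<xi>_def powr_add using n1 by (simp add: powr_realpow)
        also have "\<dots> \<le> ?q * real n ^ K" using q by (intro mult_right_mono) auto
        finally show ?thesis .
      qed
      moreover have "real (3 ^ r * (2 * K)) \<le> \<epsilon> * real n / 8"
        unfolding m_def[symmetric] using N(5) \<epsilon> by (simp add: field_simps)
      moreover have "4 * (3 ^ r * (2 * K)) ^ 2 \<le> n"
      proof -
        have "real (4 * m ^ 2) \<le> real n" using N(6) by simp
        then show ?thesis by (simp only: of_nat_le_iff m_def)
      qed
      ultimately have "measure_pmf.prob ?Pi (kernel_event n F {1..<n} (B2 t)) \<le> 1 / (?q * 2 ^ n)"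
        unfolding B2_def using q by (intro structured_bound[OF \<epsilon> s \<epsilon>n(2) _ _ \<epsilon>n(1) g_def h r]) auto
      also have "\<dots> \<le> 1 / (\<xi> * 2 ^ n)" using q \<xi> by (intro divide_left_mono mult_right_mono) auto
      also have "\<dots> = real n powr B / 2 ^ n" using n1 by (simp add: \<xi>_def powr_minus divide_simps)
      finally show "measure_pmf.prob ?Pi (kernel_event n F {1..<n} (B2 t)) \<le> real n powr B / 2 ^ n" .
    qed
    also have "\<dots> = real (card I) * (real n powr B / 2 ^ n)" by simp
    also have "\<dots> \<le> real (n + 1) * (real n powr B / 2 ^ n)"
      using fI(2) by (intro mult_right_mono) (auto simp del: of_nat_add)
    also have "\<dots> \<le> \<xi>" using N(2) by (simp add: \<xi>_def)
    finally have PA: "measure_pmf.prob ?Pi A \<le> \<xi> + \<xi>" by simp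
    have "measure_pmf.prob (Pi_pmf {..<n} undefined (\<lambda>_. pmf_of_set ?S))
           {X. in_cspan n (\<lambda>j. of_int (X 0 j) + F 0 j) {1..<n} (\<lambda>i j. of_int (X i j) + F i j)} \<le> measure_pmf.prob ?Pi A + \<xi>"
    proof (rule span_prob_split[OF n1 s(2)])
      fix X v
      assume X: "X \<notin> A" and v: "\<exists>j<n. v j \<noteq> 0" "\<forall>i\<in>{1..<n}. form n (F i) (X i) v = 0"
      show "?at v \<xi>"
      proof (rule ccontr)
        assume neg: "\<not> ?at v \<xi>"
        have "v \<notin> B1" using X v(2) by (auto simp: A_def kernel_event_def)
        then have "\<And>\<beta>. \<delta> * real n \<le> real (card {i\<in>{..<n}. v i \<noteq> \<beta>})" using v(1) by (auto simp: B1_def not_less)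
        then have c2v: "?at v (c2 / 2)" by (rule spread[OF N(8) s(1)])
        have "?at v 1" unfolding atoms_le_def by (auto intro!: card_mono)
        then obtain t where t: "?at v (1 / 2 ^ t)" "\<not> ?at v (1 / 2 ^ t / 2)"
          using exists_dyadic_scale[of "?at v" \<xi>] neg \<xi> atoms_le_mono by blast
        have t1: "\<xi> \<le> 1 / 2 ^ t" using t(1) neg atoms_le_mono linear by blast
        have "1 / 2 ^ t / 2 \<le> c2 / 2" using t(2) c2v atoms_le_mono linear by blast
        then have t2: "1 / 2 ^ t \<le> c2" by simp
        \<comment> \<open>The polynomial \<open>\<xi>\<close> lies above \<open>1 / 2 ^ n\<close>,
          which confines \<open>t\<close> to the at most \<open>n + 1\<close> scales of
          \<open>I\<close>.\<close>
        have "2 ^ t \<le> real n powr B" using t1 n1 by (simp add: \<xi>_def powr_minus divide_simps)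
        then have "(2::real) ^ t < 2 ^ n" using N(3) by linarith
        then have "t < n" by simp
        then have "t \<in> I" using t1 t2 by (simp add: I_def)
        moreover have "v \<in> B2 t" using t v(1) by (simp add: B2_def)
        ultimately have "X \<in> A" using v(2) by (auto simp: A_def kernel_event_def)
        then show False using X by simp
      qed
    qed (use \<xi> in simp)
    then show ?thesis using PA by (simp add: \<xi>_def)
  qed
  show "\<exists>C. \<forall>(n::nat) (s::int) (F::nat \<Rightarrow> nat \<Rightarrow> complex).
     real_of_int \<bar>s\<bar> \<le> (1 - \<epsilon>) * real n
     \<and> (\<forall>i<n. \<forall>j<n. cmod (F i j) \<le> real n powr \<gamma>)
     \<and> sign_set n s \<noteq> {}
     \<longrightarrow> measure_pmf.prob (Pi_pmf {..<n} undefined (\<lambda>_. pmf_of_set (sign_set n s)))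
           {X. in_cspan n (\<lambda>j. of_int (X 0 j) + F 0 j) {1..<n} (\<lambda>i j. of_int (X i j) + F i j)}
         \<le> C * real n powr (- B)"
  proof (intro exI[of _ C] allI impI, elim conjE)
    fix n s and F :: "nat \<Rightarrow> nat \<Rightarrow> complex"
    assume s: "real_of_int \<bar>s\<bar> \<le> (1 - \<epsilon>) * real n" "sign_set n s \<noteq> {}"
    show "measure_pmf.prob (Pi_pmf {..<n} undefined (\<lambda>_. pmf_of_set (sign_set n s)))
           {X. in_cspan n (\<lambda>j. of_int (X 0 j) + F 0 j) {1..<n} (\<lambda>i j. of_int (X i j) + F i j)} \<le> C * real n powr (- B)"
    proof (cases "n0 \<le> n")
      case True
      have "3 * real n powr (- B) \<le> C * real n powr (- B)" by (intro mult_right_mono) (auto simp: C_def)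
      then show ?thesis using main[OF True s, of F] by linarith
    next
      case False
      \<comment> \<open>For \<open>n = 0\<close> the bound forces \<open>s = 0\<close>, while the
        empty sum is neither \<open>-1\<close> nor 1, so the sign set would be empty.\<close>
      have "n \<noteq> 0"
      proof
        assume "n = 0"
        then show False using s by (auto simp: sign_set_def)
      qed
      then have "1 = real n powr B * real n powr (- B)" by (simp add: powr_minus)
      also have "\<dots> \<le> C * real n powr (- B)"
      proof (intro mult_right_mono)
        have "real n powr B \<le> real n0 powr B" using False B by (intro powr_mono2) auto
        then show "real n powr B \<le> C" by (simp add: C_def)
      qed simp
      finally show ?thesis by (meson measure_pmf.prob_le_1 order.trans)
    qed
  qed
qed

end
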